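(* For a prime $p\ge 11$ put $T=\varphi(p-1)-1$ and let $(s_n)$ be the $T$-periodic binary sequence with $s_n\equiv g_{n+1}+g_{n+2}\bmod 2$ for $n=0,1,\ldots,T-1$, where $1<g_1<g_2<\cdots<g_{\varphi(p-1)}<p-1$ are all primitive roots modulo $p$ in increasing order. Let $(a_0,\ldots,a_{\ell-1})\in \mathbb{F}_2^\ell$ be a pattern of fixed length $\ell\ge 1$ with $w$ coordinates equal to $1$ and $\ell-w$ coordinates equal to $0$. Let $N_\ell(w)$ be the number of $n\in\{0,1,\ldots,T-\ell\}$ with $s_{n+i}=a_i$ for $i=0,\ldots,\ell-1$. Then $$N_\ell(w)=\left(\left(\frac{1}{2-\varphi(p-1)/p}\right)^w\left(\frac{1-\varphi(p-1)/p}{2-\varphi(p-1)/p}\right)^{\ell-w}+o(1)\right)T,\qquad p\rightarrow \infty.$$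
   Context: $\varphi$ is Euler's totient function, and $\mathbb{F}_2=\{0,1\}$. Primitive roots modulo $p$ are represented by integers in $\{1,\ldots,p-1\}$. The limit is over primes $p\to\infty$ with the length $\ell$ and the pattern $(a_0,\ldots,a_{\ell-1})$ fixed; $o(1)$ denotes a quantity tending to $0$ in this limit. The count $N_\ell(w)$ is that of the given pattern (the notation records only $\ell$ and $w$ since the asymptotic formula depends only on these). *)

theory Defs
  imports "HOL-Number_Theory.Number_Theory" "HOL-Library.Z2" Complex_Main
begin

definition primroots :: "nat \<Rightarrow> nat set" where
  "primroots p = {g \<in> {1..p - 1}. residue_primroot p g}"

(* g_1 < g_2 < ...; the index i starts at 1 and is meaningful for i \<le> totient (p - 1) *)
definition nth_primroot :: "nat \<Rightarrow> nat \<Rightarrow> nat" where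
  "nth_primroot p i = sorted_list_of_set (primroots p) ! (i - 1)"

definition seq_period :: "nat \<Rightarrow> nat" where
  "seq_period p = totient (p - 1) - 1"

(* Type bit is the field with two elements, so of_nat is reduction mod 2;
   reducing the index mod the period makes the sequence periodic. *)
definition primroot_seq :: "nat \<Rightarrow> nat \<Rightarrow> bit" where
  "primroot_seq p n =
     (let m = n mod seq_period p
      in of_nat (nth_primroot p (m + 1) + nth_primroot p (m + 2)))"

(* n + length a \<le> T avoids the truncated difference T - length a, which would
   wrongly admit n = 0 when T < length a. *)
definition pattern_count :: "nat \<Rightarrow> bit list \<Rightarrow> nat" where
  "pattern_count p a =
     card {n. n + length a \<le> seq_period p \<and>
              (\<forall>i<length a. primroot_seq p (n + i) = a ! i)}"

abbreviation primes_at_top :: "nat filter" where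
  "primes_at_top \<equiv> inf at_top (principal {p. prime p})"

end

(*
The role of Weil's bound for character sums is played by Stepanov's method, in an elementary form
that only needs integer polynomials modulo p. Let d be the product of the primes q <= Y dividing
p - 1, with Y a small multiple of ln p. Then d is at most a tiny power of p, while the numbers whose
discrete logarithm is prime to d (a superset U of the primitive roots) outnumber the primitive roots
only by a factor 1 + o(1), because p - 1 has few prime factors larger than Y; deleting o(|U|)
elements of U changes the count of a gap pattern by o(|U|) only.

Since powers of d may be lost, it suffices to count the x with prescribed class modulo d of a
combination of discrete logarithms of x + h, h in H. Stepanov's auxiliary polynomial shows that the
classes that are not tiny are equally large. That no class is tiny is seen one prime q | d at a time:
there the relevant functions have distinct orders of vanishing at a point -h, so all q classes
occur, and hence the number of classes that are not tiny is divisible by every such q.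

This gives the joint distribution of any bounded number of the events x + h in U. By a truncated
Moebius expansion these correlations determine, up to a small error, the probability of any event
depending on a window of length C p / |U|, which therefore may be computed for independent trials;
there the gaps are geometric, and a gap is odd with probability 1 / (2 - |U| / p).
*)

theory Submission
  imports Defs "HOL-Computational_Algebra.Polynomial_Factorial" "HOL-Computational_Algebra.Squarefree"
begin

section \<open>Stepanov's method modulo a prime\<close>

text \<open>The density \<theta> = phi(d)/d has no positive lower bound as p grows, so every error
  must be small against \<theta> p and not just against p. This is why windows have length about C /
  \<theta>, and why the truncation at size r is judged by the binomial moment (C + 1)^r / r!, in
  which the powers of \<theta> have cancelled. The accuracy fixes C and r before p enters; the
  constant in Y then makes d^(r+1) <= y = p^(1/400). Losses polynomial in d become bounded powers of
  y, against a main term \<theta> p >= y^399; the exponents are generous, only some power saving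
  matters. Stepanov's method bounds classes from above only. Lower bounds come from the total: n
  classes of size at most about p / n that fill almost all of {0..<p} must all have size about p /
  n. Integer polynomials stand for polynomials over the field with p elements: zero means divisible
  by \<open>[:int p:]\<close>, and linear algebra becomes the pigeonhole principle for coefficients
  in {0..<p}. Characters enter only once the classes are known to be equally large, as Fourier
  analysis modulo d.\<close>

lemmas cong_mod_def = unique_euclidean_semiring_class.cong_def

section \<open>Divisibility of integer polynomials by p and multiplicities of zeros\<close>

lemma const_dvd_iff_coeff: "[:c:] dvd P \<longleftrightarrow> (\<forall>n. c dvd coeff P n)"
  for c :: int by (rule const_poly_dvd_iff)

lemma const_dvd_const: "[:c:] dvd [:a:] \<longleftrightarrow> c dvd a" for c a :: int
  by (auto simp: const_dvd_iff_coeff coeff_pCons split: nat.splits)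

lemma prime_elem_const: "prime p \<Longrightarrow> prime_elem [:int p:]"
  by (rule lift_prime_elem_poly) (auto intro: prime_imp_prime_elem)

lemma dvd_poly_eval: "[:c:] dvd P \<Longrightarrow> c dvd poly P x" for c :: int
  by (auto simp: dvd_def)

lemma dvd_pderiv: "[:c:] dvd P \<Longrightarrow> [:c:] dvd pderiv P" for c :: int
  by (auto simp: const_dvd_iff_coeff coeff_pderiv)

text \<open>Leibniz's rule has only two terms for a linear factor; at \<open>l = 0\<close> the
  truncated \<open>l - 1\<close> is harmless because of the factor \<open>l\<close>.\<close>

lemma funpow_pderiv_linear_factor:
  "(pderiv ^^ l) ([:-x, 1:] * Q) =
     [:-x, 1:] * (pderiv ^^ l) Q + of_nat l * (pderiv ^^ (l - 1)) Q" for Q :: "int poly"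
proof (induction l)
  case (Suc l)
  have "of_nat l * (pderiv ^^ l) Q = of_nat l * pderiv ((pderiv ^^ (l - 1)) Q)"
    by (cases l) auto
  then show ?case
    unfolding funpow.simps o_apply Suc.IH
    by (auto simp add: pderiv_add pderiv_mult pderiv_pCons algebra_simps pderiv_of_nat one_pCons[symmetric] simp del: mult_pCons_left mult_pCons_right)
qed auto

text \<open>In characteristic p the vanishing of derivatives detects multiplicities only up to p,
  because the l-th derivative carries the factor l!. The induction splits off one linear factor
  modulo p at a time. The degree over the integers may exceed that of the reduction, which only
  weakens the bound.\<close>

lemma sum_multiplicities_le_degree:
  fixes P :: "int poly" and mu :: "int \<Rightarrow> nat"
  assumes "prime p" "finite X"
    and "\<And>x y. x \<in> X \<Longrightarrow> y \<in> X \<Longrightarrow> [x = y] (mod int p) \<Longrightarrow> x = y"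
    and "\<And>x. x \<in> X \<Longrightarrow> mu x \<le> p"
    and "\<And>x l. x \<in> X \<Longrightarrow> l < mu x \<Longrightarrow> int p dvd poly ((pderiv ^^ l) P) x"
    and "\<not> [:int p:] dvd P"
  shows "(\<Sum>x\<in>X. mu x) \<le> degree P"
  using assms(4-6)
proof (induction "degree P" arbitrary: P mu)
  case (0 P mu)
  have "mu x = 0" if "x \<in> X" for x
  proof (rule ccontr)
    assume "mu x \<noteq> 0"
    with 0 that have "int p dvd poly P x" using "0.prems"(2)[of x 0] by simp
    moreover obtain c where "P = [:c:]" using 0(1) by (metis degree_eq_zeroE)
    ultimately show False using 0 by (simp add: const_dvd_const)
  qed
  then show ?case by simp
next
  case (Suc n P mu)
  show ?case
  proof (cases "\<exists>x\<in>X. mu x > 0")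
    case False
    then show ?thesis by simp
  next
    case True
    then obtain x where x: "x \<in> X" "mu x > 0" by blast
    define Q where "Q = synthetic_div P x"
    have P: "P = [:-x, 1:] * Q + [:poly P x:]"
      unfolding Q_def using synthetic_div_correct'[of x P] by simp
    have px: "int p dvd poly P x" using Suc.prems(2)[of x 0] x by simp
    have degQ: "degree Q = n" unfolding Q_def using Suc(2) by (simp add: degree_synthetic_div)
    have nQ: "\<not> [:int p:] dvd Q"
    proof
      assume "[:int p:] dvd Q"
      then have "[:int p:] dvd [:-x, 1:] * Q + [:poly P x:]"
        using px by (intro dvd_add dvd_mult) (auto simp: const_dvd_const)
      with P Suc.prems(3) show False by simp
    qed
    have der: "int p dvd poly ((pderiv ^^ l) P) y \<longleftrightarrow>
        int p dvd (y - x) * poly ((pderiv ^^ l) Q) y + int l * poly ((pderiv ^^ (l - 1)) Q) y" for l y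
    proof -
      have 1: "(pderiv ^^ l) P = (pderiv ^^ l) ([:-x, 1:] * Q) + (pderiv ^^ l) [:poly P x:]"
        by (subst P) (rule higher_pderiv_add)
      have "[:int p:] dvd (pderiv ^^ l) [:poly P x:]"
      proof (induction l)
        case 0 then show ?case using px by (auto simp: const_dvd_const)
      qed (simp add: dvd_pderiv)
      then have "int p dvd poly ((pderiv ^^ l) [:poly P x:]) y" by (rule dvd_poly_eval)
      moreover have "poly ((pderiv ^^ l) P) y =
          (y - x) * poly ((pderiv ^^ l) Q) y + int l * poly ((pderiv ^^ (l - 1)) Q) y +
          poly ((pderiv ^^ l) [:poly P x:]) y"
        unfolding 1 funpow_pderiv_linear_factor by (simp add: algebra_simps)
      ultimately show ?thesis by (simp add: dvd_add_left_iff)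
    qed
    define mu' where "mu' = mu(x := mu x - 1)"
    have "(\<Sum>y\<in>X. mu' y) \<le> degree Q"
    proof (rule Suc.hyps(1))
      show "n = degree Q" using degQ by simp
      show "\<And>y. y \<in> X \<Longrightarrow> mu' y \<le> p" using Suc.prems(1) unfolding mu'_def by (auto simp: le_diff_conv le_SucI)
      show "\<not> [:int p:] dvd Q" by fact
      show "int p dvd poly ((pderiv ^^ l) Q) y" if "y \<in> X" "l < mu' y" for y l
      proof (cases "y = x")
        case True
        then have l: "Suc l < mu x" "Suc l < p" using that Suc.prems(1)[of x] by (auto simp: mu'_def)
        \<comment> \<open>At \<open>x\<close> the term with the factor \<open>y - x\<close> drops
          out of \<open>der\<close>, leaving \<open>Suc l\<close> times the \<open>l\<close>-th
          derivative of \<open>Q\<close>; \<open>Suc l < p\<close> makes this factor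
          cancellable.\<close>
        have "int p dvd poly ((pderiv ^^ Suc l) P) x" using Suc.prems(2)[of x "Suc l"] x l by simp
        then have "int p dvd int (Suc l) * poly ((pderiv ^^ l) Q) x" unfolding der by simp
        moreover have "\<not> int p dvd int (Suc l)" using l by (metis int_dvd_int_iff nat_dvd_not_less zero_less_Suc)
        ultimately show ?thesis using \<open>prime p\<close> True
          by (metis prime_dvd_mult_iff prime_nat_int_transfer)
      next
        case False
        then have "\<not> int p dvd y - x" using assms(3) that x
          by (metis cong_iff_dvd_diff)
        have "l < mu y" using that False by (simp add: mu'_def)
        \<comment> \<open>Away from \<open>x\<close> no order is lost: once the derivative of
          \<open>Q\<close> of order \<open>l\<close> vanishes, \<open>der\<close> leaves
          \<open>y - x\<close> times the next one, and \<open>y - x\<close> is invertible modulo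
          \<open>p\<close>.\<close>
        then show ?thesis
        proof (induction l)
          case 0
          then have "int p dvd (y - x) * poly Q y" using der[of 0 y] Suc.prems(2)[of y 0] that by simp
          then show ?case using \<open>\<not> int p dvd y - x\<close> \<open>prime p\<close>
            by (metis funpow_0 prime_dvd_mult_iff prime_nat_int_transfer)
        next
          case (Suc l)
          then have "int p dvd poly ((pderiv ^^ l) Q) y" by simp
          moreover have "int p dvd poly ((pderiv ^^ Suc l) P) y" using Suc.prems Suc that \<open>\<And>x l. x \<in> X \<Longrightarrow> l < mu x \<Longrightarrow> int p dvd poly ((pderiv ^^ l) P) x\<close> by blast
          ultimately have "int p dvd (y - x) * poly ((pderiv ^^ Suc l) Q) y"
            unfolding der by (metis diff_Suc_1 dvd_add_left_iff dvd_mult)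
          then show ?case using \<open>\<not> int p dvd y - x\<close> \<open>prime p\<close>
            by (metis prime_dvd_mult_iff prime_nat_int_transfer)
        qed
      qed
    qed
    moreover have "(\<Sum>y\<in>X. mu y) = Suc (\<Sum>y\<in>X. mu' y)"
      using x assms(2) unfolding mu'_def
      by (simp add: sum.remove[of X x])
    ultimately show ?thesis using degQ Suc(2) by simp
  qed
qed

text \<open>Iterating \<open>W d/dx\<close> instead of \<open>d/dx\<close> keeps all coefficients polynomial.\<close>

definition wderiv :: "int poly \<Rightarrow> int poly \<Rightarrow> int poly" where
  "wderiv W P = W * pderiv P"

lemma pderiv_sum_poly: "pderiv (\<Sum>i\<in>I. f i) = (\<Sum>i\<in>I. pderiv (f i))" for f :: "'a \<Rightarrow> int poly"
  by (induction I rule: infinite_finite_induct) (auto simp: pderiv_add)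

text \<open>The system is triangular with \<open>W ^ l\<close> on the diagonal, so at points where
  \<open>p\<close> does not divide the value of \<open>W\<close> it can be solved for the ordinary
  derivatives.\<close>

lemma funpow_wderiv_expand:
  "\<exists>u. (wderiv W ^^ l) P = W ^ l * (pderiv ^^ l) P + (\<Sum>i<l. u i * (pderiv ^^ i) P)"
proof (induction l)
  case (Suc l)
  then obtain u where u: "(wderiv W ^^ l) P = W ^ l * (pderiv ^^ l) P + (\<Sum>i<l. u i * (pderiv ^^ i) P)"
    by blast
  define v where "v i = (if i < l then W * pderiv (u i) else W * pderiv (W ^ l)) +
                        (if i > 0 then W * u (i - 1) else 0)" for i
  have "(\<Sum>i<Suc l. v i * (pderiv ^^ i) P) =
     (\<Sum>i<l. W * pderiv (u i) * (pderiv ^^ i) P) + W * pderiv (W ^ l) * (pderiv ^^ l) P +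
     (\<Sum>i<Suc l. (if i > 0 then W * u (i - 1) else 0) * (pderiv ^^ i) P)"
    unfolding v_def distrib_right sum.distrib by (simp add: mult_ac)
  also have "(\<Sum>i<Suc l. (if i > 0 then W * u (i - 1) else 0) * (pderiv ^^ i) P)
      = (\<Sum>i<l. W * u i * pderiv ((pderiv ^^ i) P))"
    by (subst sum.lessThan_Suc_shift) simp
  finally have "(wderiv W ^^ Suc l) P = W ^ Suc l * (pderiv ^^ Suc l) P + (\<Sum>i<Suc l. v i * (pderiv ^^ i) P)"
    unfolding funpow.simps o_apply u
    by (simp add: wderiv_def pderiv_add pderiv_mult pderiv_sum_poly sum_distrib_left sum.distrib algebra_simps)
  then show ?case by blast
qed auto

lemma dvd_pderivs_of_wderivs:
  assumes "prime p" "\<not> int p dvd poly W x"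
    and "\<And>l. l < M \<Longrightarrow> int p dvd poly ((wderiv W ^^ l) P) x" "l < M"
  shows "int p dvd poly ((pderiv ^^ l) P) x"
  using assms(4)
proof (induction l rule: less_induct)
  case (less l)
  obtain u where u: "(wderiv W ^^ l) P = W ^ l * (pderiv ^^ l) P + (\<Sum>i<l. u i * (pderiv ^^ i) P)"
    using funpow_wderiv_expand by blast
  have "int p dvd (\<Sum>i<l. poly (u i) x * poly ((pderiv ^^ i) P) x)"
    using less by (intro dvd_sum dvd_mult) auto
  moreover have "int p dvd poly ((wderiv W ^^ l) P) x" using assms(3) less by simp
  ultimately have "int p dvd poly W x ^ l * poly ((pderiv ^^ l) P) x"
    unfolding u by (simp add: poly_sum dvd_add_left_iff)
  then show ?case using assms(1,2)
    by (metis prime_dvd_mult_iff prime_dvd_power prime_nat_int_transfer)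
qed


lemma wderiv_diff: "wderiv W (P - Q) = wderiv W P - wderiv W Q"
  by (simp add: wderiv_def pderiv_diff algebra_simps)

lemma wderiv_smult: "wderiv W (smult a P) = smult a (wderiv W P)"
  by (simp add: wderiv_def pderiv_smult)

lemma wderiv_sum: "wderiv W (\<Sum>i\<in>I. f i) = (\<Sum>i\<in>I. wderiv W (f i))"
  by (simp add: wderiv_def pderiv_sum_poly sum_distrib_left)

lemma funpow_wderiv_smult: "(wderiv W ^^ l) (smult a P) = smult a ((wderiv W ^^ l) P)"
  by (induction l) (auto simp: wderiv_smult)

lemma funpow_wderiv_sum: "(wderiv W ^^ l) (\<Sum>i\<in>I. f i) = (\<Sum>i\<in>I. (wderiv W ^^ l) (f i))"
  by (induction l) (auto simp: wderiv_sum)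

lemma dvd_wderiv: "[:c:] dvd P \<Longrightarrow> [:c:] dvd wderiv W P"
  by (simp add: wderiv_def dvd_pderiv dvd_mult)

text \<open>If \<open>W F' = V F\<close>, then \<open>W d/dx (c F^s) = (twist W V s c) F^s\<close>.\<close>

definition twist :: "int poly \<Rightarrow> int poly \<Rightarrow> nat \<Rightarrow> int poly \<Rightarrow> int poly" where
  "twist W V s c = W * pderiv c + smult (int s) (V * c)"

lemma twist_diff: "twist W V s (c - c') = twist W V s c - twist W V s c'"
  by (simp add: twist_def pderiv_diff algebra_simps smult_diff_right)

lemma funpow_twist_diff:
  "(twist W V s ^^ l) (c - c') = (twist W V s ^^ l) c - (twist W V s ^^ l) c'"
  by (induction l) (auto simp: twist_diff)

lemma degree_twist_le:
  assumes "degree W \<le> k" "degree V \<le> k"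
  shows "degree (twist W V s c) \<le> degree c + k"
  unfolding twist_def
proof (intro degree_add_le)
  have "degree (W * pderiv c) \<le> degree W + degree (pderiv c)" by (rule degree_mult_le)
  also have "degree (pderiv c) \<le> degree c" by (simp add: degree_pderiv)
  finally show "degree (W * pderiv c) \<le> degree c + k" using assms by simp
  have "degree (smult (int s) (V * c)) \<le> degree (V * c)" by (rule degree_smult_le)
  also have "\<dots> \<le> degree V + degree c" by (rule degree_mult_le)
  finally show "degree (smult (int s) (V * c)) \<le> degree c + k" using assms by simp
qed

lemma degree_funpow_twist_le:
  assumes "degree W \<le> k" "degree V \<le> k"
  shows "degree ((twist W V s ^^ l) c) \<le> degree c + l * k"
  by (induction l) (auto intro: order_trans[OF degree_twist_le[OF assms]])

lemma wderiv_power: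
  assumes "W * pderiv F = V * F"
  shows "W * pderiv (F ^ s) = smult (int s) (V * F ^ s)"
proof (induction s)
  case (Suc s)
  have "W * pderiv (F ^ Suc s) = F * (W * pderiv (F ^ s)) + F ^ s * (W * pderiv F)"
    by (simp add: pderiv_mult algebra_simps)
  also have "\<dots> = smult (int (Suc s)) (V * F ^ Suc s)"
    unfolding Suc assms by (simp add: algebra_simps smult_add_left)
  finally show ?case .
qed auto

text \<open>Modulo \<open>p\<close> the power \<open>x^(p j)\<close> has derivative zero and behaves
  like a constant; the exact difference is the term in which the derivation hits this power.\<close>

lemma wderiv_twist:
  assumes "W * pderiv F = V * F"
  shows "[:int p:] dvd wderiv W (c * monom 1 (p * j) * F ^ s) - twist W V s c * monom 1 (p * j) * F ^ s"
proof -
  have "wderiv W (c * monom 1 (p * j) * F ^ s) - twist W V s c * monom 1 (p * j) * F ^ s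
      = c * monom 1 (p * j) * (W * pderiv (F ^ s)) + W * (pderiv c * monom 1 (p * j)) * F ^ s
        + W * c * pderiv (monom 1 (p * j)) * F ^ s - twist W V s c * monom 1 (p * j) * F ^ s"
    by (simp add: wderiv_def pderiv_mult algebra_simps)
  also have "\<dots> = W * c * pderiv (monom 1 (p * j)) * F ^ s"
    unfolding wderiv_power[OF assms] twist_def by (simp add: algebra_simps)
  also have "pderiv (monom (1::int) (p * j)) = [:int p:] * monom (int j) (p * j - 1)"
    by (simp add: pderiv_monom smult_monom)
  finally show ?thesis by (metis dvd_triv_left dvd_mult dvd_mult2)
qed

lemma funpow_wderiv_twist:
  assumes "W * pderiv F = V * F"
  shows "[:int p:] dvd (wderiv W ^^ l) (c * monom 1 (p * j) * F ^ s)
                      - (twist W V s ^^ l) c * monom 1 (p * j) * F ^ s"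
proof (induction l)
  case (Suc l)
  let ?A = "(wderiv W ^^ l) (c * monom 1 (p * j) * F ^ s)"
  let ?c = "(twist W V s ^^ l) c"
  have "[:int p:] dvd wderiv W (?A - ?c * monom 1 (p * j) * F ^ s)"
    using Suc by (rule dvd_wderiv)
  moreover have "[:int p:] dvd wderiv W (?c * monom 1 (p * j) * F ^ s)
      - twist W V s ?c * monom 1 (p * j) * F ^ s"
    by (rule wderiv_twist[OF assms])
  ultimately have "[:int p:] dvd wderiv W (?A - ?c * monom 1 (p * j) * F ^ s) +
     (wderiv W (?c * monom 1 (p * j) * F ^ s) - twist W V s ?c * monom 1 (p * j) * F ^ s)"
    by (rule dvd_add)
  then show ?case by (simp add: wderiv_diff)
qed auto

lemma fermat_power_cong_int:
  assumes "prime p"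
  shows "[x ^ (p * j) = x ^ j] (mod int p)"
proof -
  have "[x ^ p = x] (mod int p)"
  proof (cases "int p dvd x")
    case True
    then have "[x = 0] (mod int p)" by (simp add: cong_0_iff)
    moreover have "[x ^ p = 0] (mod int p)"
      using True assms by (simp add: cong_0_iff dvd_trans[OF True dvd_power] prime_gt_0_nat)
    ultimately show ?thesis by (metis cong_sym cong_trans)
  next
    case False
    define y where "y = nat (x mod int p)"
    have y: "[x = int y] (mod int p)"
      unfolding y_def using prime_gt_0_nat[OF assms] by (simp add: cong_def)
    then have "\<not> p dvd y" using False by (metis cong_dvd_iff int_dvd_int_iff)
    then have "[y ^ (p - 1) = 1] (mod p)" by (rule fermat_theorem[OF assms])
    then have "[y ^ (p - 1) * y = 1 * y] (mod p)" by (rule cong_scalar_right)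
    then have "[y ^ p = y] (mod p)" using prime_gt_0_nat[OF assms]
      by (metis mult.left_neutral power_minus_mult)
    then have "[int y ^ p = int y] (mod int p)" by (metis cong_int_iff of_nat_power)
    then show ?thesis using y by (meson cong_pow cong_sym cong_trans)
  qed
  then show ?thesis unfolding power_mult by (rule cong_pow)
qed

text \<open>The auxiliary function of Stepanov's method; on the points considered,
  \<open>x^p\<close> may be replaced by \<open>x\<close> and \<open>F\<close> by a constant.\<close>

definition auxpoly ::
  "nat \<Rightarrow> int poly \<Rightarrow> nat \<Rightarrow> 'b set \<Rightarrow> nat \<Rightarrow> ('b \<Rightarrow> nat \<Rightarrow> int) \<Rightarrow> (nat \<Rightarrow> 'b \<Rightarrow> int poly) \<Rightarrow> int poly"
  where "auxpoly p F J B d lam c =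
    (\<Sum>j<J. \<Sum>b\<in>B. \<Sum>s<d. smult (lam b s) (c j b * monom 1 (p * j) * F ^ s))"

text \<open>Its degree involves neither the exponents \<open>p * j\<close> nor the degree of
  \<open>F\<close>, which is what makes the vanishing conditions few.\<close>

definition condpoly ::
  "int poly \<Rightarrow> int poly \<Rightarrow> int \<Rightarrow> nat \<Rightarrow> 'b set \<Rightarrow> nat \<Rightarrow> ('b \<Rightarrow> nat \<Rightarrow> int) \<Rightarrow> nat
    \<Rightarrow> (nat \<Rightarrow> 'b \<Rightarrow> int poly) \<Rightarrow> int poly"
  where "condpoly W V \<beta> J B d lam l c =
    (\<Sum>j<J. \<Sum>b\<in>B. \<Sum>s<d. smult (lam b s * \<beta> ^ s) ((twist W V s ^^ l) (c j b) * monom 1 j))"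

lemma funpow_wderiv_auxpoly_cong:
  assumes "prime p" "W * pderiv F = V * F" "[poly F x = \<beta>] (mod int p)"
  shows "[poly ((wderiv W ^^ l) (auxpoly p F J B d lam c)) x = poly (condpoly W V \<beta> J B d lam l c) x] (mod int p)"
proof -
  have "[poly ((wderiv W ^^ l) (c j b * monom 1 (p * j) * F ^ s)) x
       = \<beta> ^ s * poly ((twist W V s ^^ l) (c j b) * monom 1 j) x] (mod int p)" for j b s
  proof -
    have "[poly ((wderiv W ^^ l) (c j b * monom 1 (p * j) * F ^ s)) x
        = poly ((twist W V s ^^ l) (c j b) * monom 1 (p * j) * F ^ s) x] (mod int p)"
      using dvd_poly_eval[OF funpow_wderiv_twist[OF assms(2)], of p l "c j b" j s x]
      by (simp add: cong_iff_dvd_diff)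
    also have "poly ((twist W V s ^^ l) (c j b) * monom 1 (p * j) * F ^ s) x =
       poly ((twist W V s ^^ l) (c j b)) x * x ^ (p * j) * poly F x ^ s"
      by (simp add: poly_monom)
    also have "[\<dots> = poly ((twist W V s ^^ l) (c j b)) x * x ^ j * \<beta> ^ s] (mod int p)"
      by (intro cong_mult cong_refl cong_pow assms fermat_power_cong_int)
    also have "poly ((twist W V s ^^ l) (c j b)) x * x ^ j * \<beta> ^ s =
        \<beta> ^ s * poly ((twist W V s ^^ l) (c j b) * monom 1 j) x"
      by (simp add: poly_monom)
    finally show ?thesis .
  qed
  then show ?thesis
    unfolding auxpoly_def condpoly_def funpow_wderiv_sum funpow_wderiv_smult poly_sum poly_smult
      mult.assoc
    by (intro cong_sum cong_mult cong_refl)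
qed

lemma condpoly_diff:
  "condpoly W V \<beta> J B d lam l (\<lambda>j b. c j b - c' j b) =
     condpoly W V \<beta> J B d lam l c - condpoly W V \<beta> J B d lam l c'"
  by (simp add: condpoly_def funpow_twist_diff left_diff_distrib smult_diff_right sum_subtractf)

lemma degree_condpoly_less:
  assumes "degree W \<le> k" "degree V \<le> k" "\<And>j b. j < J \<Longrightarrow> b \<in> B \<Longrightarrow> degree (c j b) < A"
    "l \<le> M" "J \<ge> 1" "A \<ge> 1"
  shows "degree (condpoly W V \<beta> J B d lam l c) < A + k * M + J"
proof -
  have "degree (condpoly W V \<beta> J B d lam l c) \<le> (A - 1) + k * M + (J - 1)"
    unfolding condpoly_def
  proof (rule degree_sum_le)
  show "finite {..<J}" by simp
next
    fix j
    assume j: "j \<in> {..<J}"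
    show "degree (\<Sum>b\<in>B. \<Sum>s<d. smult (lam b s * \<beta> ^ s) ((twist W V s ^^ l) (c j b) * monom 1 j))
       \<le> A - 1 + k * M + (J - 1)"
    proof (cases "finite B")
      case True
      have "degree (smult (lam b s * \<beta> ^ s) ((twist W V s ^^ l) (c j b) * monom 1 j)) \<le> A - 1 + k * M + (J - 1)"
        if "b \<in> B" for b s
      proof -
        have "degree (smult (lam b s * \<beta> ^ s) ((twist W V s ^^ l) (c j b) * monom 1 j)) \<le>
            degree ((twist W V s ^^ l) (c j b) * monom 1 j)" by (rule degree_smult_le)
        also have "\<dots> \<le> degree ((twist W V s ^^ l) (c j b)) + degree (monom (1::int) j)"
          by (rule degree_mult_le)
        also have "\<dots> \<le> (degree (c j b) + l * k) + j"
          by (intro add_mono degree_funpow_twist_le assms degree_monom_le)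
        also have "\<dots> \<le> ((A - 1) + M * k) + (J - 1)"
          using assms(3)[of j b] that j assms(4-6) by (intro add_mono mult_right_mono) auto
        finally show ?thesis by (simp add: mult.commute)
      qed
      then show ?thesis using True by (intro degree_sum_le) auto
    qed auto
  qed
  then show ?thesis using assms by linarith
qed

lemma degree_auxpoly_le:
  assumes "\<And>j b. j < J \<Longrightarrow> b \<in> B \<Longrightarrow> degree (c j b) < A"
  shows "degree (auxpoly p F J B d lam c) \<le> A + p * J + d * degree F"
  unfolding auxpoly_def
proof (rule degree_sum_le)
  show "finite {..<J}" by simp
next
  fix j
  assume j: "j \<in> {..<J}"
  show "degree (\<Sum>b\<in>B. \<Sum>s<d. smult (lam b s) (c j b * monom 1 (p * j) * F ^ s))
       \<le> A + p * J + d * degree F"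
  proof (cases "finite B")
    case True
    have "degree (smult (lam b s) (c j b * monom 1 (p * j) * F ^ s)) \<le> A + p * J + d * degree F"
      if "b \<in> B" "s < d" for b s
    proof -
      have "degree (smult (lam b s) (c j b * monom 1 (p * j) * F ^ s)) \<le>
          degree (c j b * monom 1 (p * j) * F ^ s)" by (rule degree_smult_le)
      also have "\<dots> \<le> degree (c j b * monom 1 (p * j)) + degree (F ^ s)" by (rule degree_mult_le)
      also have "\<dots> \<le> (degree (c j b) + degree (monom (1::int) (p * j))) + s * degree F"
        by (intro add_mono degree_mult_le order_trans[OF degree_power_le]) (simp add: mult.commute)
      also have "\<dots> \<le> (A + p * J) + d * degree F"
        using assms[of j b] that j
        by (intro add_mono mult_right_mono order_trans[OF degree_monom_le] mult_left_mono) auto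
      finally show ?thesis .
    qed
    then show ?thesis using True by (intro degree_sum_le) auto
  qed auto
qed

text \<open>There are \<open>J * card B * A\<close> unknown coefficients, while vanishing to order
  \<open>M\<close> on all of \<open>X\<close> follows from \<open>M * (A + k * M + J)\<close>
  coefficient conditions, whatever the size of \<open>X\<close>. Two choices with equal conditions
  differ by a choice that is nontrivial modulo \<open>p\<close>; by \<open>nv\<close> its auxiliary
  polynomial is nonzero, so the degree bounds the zeros. The matrix \<open>lam\<close> is a
  parameter because the method is run twice: with single powers of \<open>F\<close>, and with
  combinations of powers that pick out a class.\<close>

lemma stepanov_bound:
  fixes lam :: "'b \<Rightarrow> nat \<Rightarrow> int"
  assumes p: "prime p" and fin: "finite B" "finite X"
    and inj: "\<And>x y. x \<in> X \<Longrightarrow> y \<in> X \<Longrightarrow> [x = y] (mod int p) \<Longrightarrow> x = y"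
    and WV: "W * pderiv F = V * F" "degree W \<le> k" "degree V \<le> k"
    and X: "\<And>x. x \<in> X \<Longrightarrow> \<not> int p dvd poly W x" "\<And>x. x \<in> X \<Longrightarrow> [poly F x = \<beta>] (mod int p)"
    and par: "M \<le> p" "A \<ge> 1" "J \<ge> 1" "M * (A + k * M + J) < J * card B * A"
    and nv: "\<And>c. (\<And>j b. j < J \<Longrightarrow> b \<in> B \<Longrightarrow> degree (c j b) < A) \<Longrightarrow>
        [:int p:] dvd auxpoly p F J B d lam c \<Longrightarrow> (\<forall>j<J. \<forall>b\<in>B. [:int p:] dvd c j b)"
  shows "M * card X \<le> A + p * J + d * degree F"
proof -
  let ?cond = "condpoly W V \<beta> J B d lam"
  have p0: "p > 1" using p prime_gt_1_nat by blast
  define N where "N = A + k * M + J"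
  define U where "U = ({..<J} \<times> B) \<times> {..<A}"
  define C where "C f j b = (\<Sum>n<A. monom (f ((j, b), n) :: int) n)" for f :: "(nat \<times> 'b) \<times> nat \<Rightarrow> int" and j b
  define Q where "Q f l = ?cond l (C f)" for f l
  define S1 where "S1 = (U \<rightarrow>\<^sub>E {0..<int p})"
  define T where "T = (({..<M} \<times> {..<N}) \<rightarrow>\<^sub>E {0..<int p})"
  define \<Phi> where "\<Phi> f = (\<lambda>ln\<in>{..<M} \<times> {..<N}. coeff (Q f (fst ln)) (snd ln) mod int p)" for f
  have coeff_C: "coeff (C f j b) n = (if n < A then f ((j, b), n) else 0)" for f j b n
    by (simp add: C_def coeff_sum coeff_monom sum.delta if_distrib cong: if_cong)
  have degree_C: "degree (C f j b) < A" for f j b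
  proof -
    have "degree (C f j b) \<le> A - 1"
      by (rule degree_le) (auto simp: coeff_C)
    then show ?thesis using par by linarith
  qed
  have "card T = p ^ (M * N)" unfolding T_def by (simp add: card_PiE)
  also have "\<dots> < p ^ (J * card B * A)"
    using par p0 unfolding N_def by (intro power_strict_increasing) auto
  also have "\<dots> = card S1" unfolding S1_def U_def using fin by (simp add: card_PiE)
  finally have card: "card T < card S1" .
  have finT: "finite T" unfolding T_def by (intro finite_PiE) auto
  have "\<Phi> ` S1 \<subseteq> T" using p0 unfolding \<Phi>_def T_def by (intro image_subsetI restrict_PiE_iff[THEN iffD2]) auto
  with card finT have "\<not> inj_on \<Phi> S1" by (meson card_inj_on_le not_le)
  then obtain f g where fg: "f \<in> S1" "g \<in> S1" "f \<noteq> g" "\<Phi> f = \<Phi> g"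
    unfolding inj_on_def by blast
  define c where "c j b = C f j b - C g j b" for j b
  have degree_c: "degree (c j b) < A" for j b
    unfolding c_def by (intro degree_diff_less degree_C)
  have "f \<noteq> g" "f \<in> U \<rightarrow>\<^sub>E {0..<int p}" "g \<in> U \<rightarrow>\<^sub>E {0..<int p}" using fg unfolding S1_def by auto
  then obtain u where u: "u \<in> U" "f u \<noteq> g u" by (meson PiE_ext)
  obtain j b n where jbn: "u = ((j, b), n)" "j < J" "b \<in> B" "n < A"
    using u unfolding U_def by auto
  have rng: "f u \<in> {0..<int p}" "g u \<in> {0..<int p}" using fg u unfolding S1_def by (auto simp: PiE_iff)
  have nz: "\<not> [:int p:] dvd c j b"
  proof
    assume "[:int p:] dvd c j b"
    then have "int p dvd f u - g u"
      using jbn by (metis const_dvd_iff_coeff c_def coeff_C coeff_diff)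
    then have "[f u = g u] (mod int p)" by (simp add: cong_iff_dvd_diff)
    with rng u(2) show False unfolding cong_mod_def by simp
  qed
  have cond: "[:int p:] dvd ?cond l c" if "l < M" for l
  proof -
    have eq: "?cond l c = Q f l - Q g l"
      unfolding Q_def condpoly_diff[symmetric] c_def ..
    have "int p dvd coeff (Q f l - Q g l) n" for n
    proof (cases "n < N")
      case True
      have "\<Phi> f (l, n) = \<Phi> g (l, n)" using fg by simp
      then have "coeff (Q f l) n mod int p = coeff (Q g l) n mod int p"
        using True that by (simp add: \<Phi>_def)
      then show ?thesis by (simp add: mod_eq_dvd_iff)
    next
      case False
      have "degree (Q h l) < N" for h
        unfolding Q_def N_def using that par by (intro degree_condpoly_less WV degree_C) auto
      then have "coeff (Q h l) n = 0" for h
        using False by (meson coeff_eq_0 less_le_trans not_le)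
      then show ?thesis by simp
    qed
    then show ?thesis unfolding eq const_dvd_iff_coeff by blast
  qed
  let ?P = "auxpoly p F J B d lam c"
  have "\<not> [:int p:] dvd ?P" using nv[of c] degree_c nz jbn by blast
  then have "(\<Sum>x\<in>X. M) \<le> degree ?P"
  proof (rule sum_multiplicities_le_degree[OF p fin(2) inj par(1), rotated -1])
    fix x l
    assume xl: "x \<in> X" "l < M"
    show "int p dvd poly ((pderiv ^^ l) ?P) x"
    proof (rule dvd_pderivs_of_wderivs[OF p X(1)[OF xl(1)] _ xl(2)])
      fix l assume l: "l < M"
      have "[poly ((wderiv W ^^ l) ?P) x = poly (?cond l c) x] (mod int p)"
        by (rule funpow_wderiv_auxpoly_cong[OF p WV(1) X(2)[OF xl(1)]])
      moreover have "int p dvd poly (?cond l c) x"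
        using cond[OF l] by (rule dvd_poly_eval)
      ultimately show "int p dvd poly ((wderiv W ^^ l) ?P) x" by (simp add: cong_dvd_iff)
    qed
  qed auto
  also have "\<dots> \<le> A + p * J + d * degree F"
    using degree_c by (intro degree_auxpoly_le) auto
  finally show ?thesis by (simp add: mult.commute)
qed

text \<open>Distinct terms have distinct orders of vanishing at \<open>0\<close> modulo \<open>p\<close>.\<close>

lemma auxpoly_nonvanishing_ramified:
  assumes "prime p" "prime q" "p = R * q + 1" "\<not> q dvd e" "A + J \<le> R"
    and F: "F = monom 1 (R * e) * U" "\<not> int p dvd coeff U 0"
    and deg: "\<And>j b. j < J \<Longrightarrow> b \<in> {..<q} \<Longrightarrow> degree (c j b) < A"
    and dvd: "[:int p:] dvd auxpoly p F J {..<q} q (\<lambda>b s. if b = s then 1 else 0) c"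
  shows "\<forall>j<J. \<forall>b\<in>{..<q}. [:int p:] dvd c j b"
proof (rule ccontr)
  assume contra: "\<not> ?thesis"
  define Z where "Z = {(j, b). j < J \<and> b < q \<and> \<not> [:int p:] dvd c j b}"
  define o' where "o' j b = (LEAST n. \<not> int p dvd coeff (c j b) n)" for j b
  define val where "val = (\<lambda>(j, b). p * j + R * e * b + o' j b)"
  have Z_o: "\<not> int p dvd coeff (c j b) (o' j b)" if "(j, b) \<in> Z" for j b
    unfolding o'_def by (rule LeastI_ex) (use that in \<open>auto simp: Z_def const_dvd_iff_coeff\<close>)
  have o_less: "int p dvd coeff (c j b) n" if "n < o' j b" for j b n
    using that not_less_Least unfolding o'_def by blast
  have o_A: "o' j b < A" if "(j, b) \<in> Z" for j b
  proof -
    have "coeff (c j b) (o' j b) \<noteq> 0" using Z_o[OF that] by auto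
    then have "o' j b \<le> degree (c j b)" by (rule le_degree)
    then show ?thesis using deg[of j b] that by (auto simp: Z_def)
  qed
  have inj: "(j, b) = (j', b')" if *: "(j, b) \<in> Z" "(j', b') \<in> Z" "val (j, b) = val (j', b')" for j b j' b'
  proof -
    have R0: "R > 0" using assms(5) o_A[OF *(1)] by linarith
    \<comment> \<open>Since \<open>p = R * q + 1\<close>, the orders of vanishing are written in
      base \<open>R\<close> with last digit \<open>j + o' j b < R\<close>. The remaining part,
      reduced modulo \<open>q\<close>, determines \<open>b\<close> because \<open>q\<close> does not
      divide \<open>e\<close>, and with \<open>b\<close> also \<open>j\<close>.\<close>
    have eq: "(j + o' j b) + R * (q * j + e * b) = (j' + o' j' b') + R * (q * j' + e * b')"
      using *(3) unfolding val_def assms(3) by (simp add: algebra_simps)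
    have small: "j + o' j b < R" "j' + o' j' b' < R"
      using o_A[OF *(1)] o_A[OF *(2)] * assms(5) unfolding Z_def by auto
    have "((j + o' j b) + R * (q * j + e * b)) div R = ((j' + o' j' b') + R * (q * j' + e * b')) div R"
      using eq by simp
    then have eq': "q * j + e * b = q * j' + e * b'" using small R0 by simp
    have "[q * j + e * b = q * j' + e * b'] (mod q)" using eq' by simp
    then have "[e * b = e * b'] (mod q)" unfolding cong_mod_def by simp
    moreover have "coprime e q" using prime_imp_coprime[OF assms(2,4)] by (rule coprime_imp_coprime) (auto intro: dvd_trans)
    ultimately have "[b = b'] (mod q)" by (simp add: cong_mult_lcancel_nat)
    then have "b = b'" using * cong_less_modulus_unique_nat[of b b' q] by (simp add: Z_def)
    then show ?thesis using eq' assms(2) by (simp add: prime_gt_0_nat)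
  qed
  obtain z where "z \<in> Z" using contra unfolding Z_def by auto
  then obtain jb where jb: "jb \<in> Z" "\<And>y. y \<in> Z \<Longrightarrow> val jb \<le> val y"
    using ex_has_least_nat[of "\<lambda>x. x \<in> Z" z val] by blast
  obtain j0 b0 where jb0: "jb = (j0, b0)" by force
  define n0 where "n0 = val (j0, b0)"
  define t where "t j b = c j b * monom 1 (p * j) * F ^ b" for j b
  have t: "t j b = monom 1 (p * j + R * e * b) * (c j b * U ^ b)" for j b
    by (simp add: t_def F power_mult_distrib monom_power mult_monom algebra_simps)
  have coeff_t: "coeff (t j b) n0 = (if n0 < p * j + R * e * b then 0
      else coeff (c j b * U ^ b) (n0 - (p * j + R * e * b)))" for j b
    unfolding t coeff_monom_mult by simp
  have others: "int p dvd coeff (t j b) n0" if "j < J" "b < q" "(j, b) \<noteq> (j0, b0)" for j b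
  proof (cases "(j, b) \<in> Z")
    case True
    then have "val (j, b) \<noteq> n0" "n0 \<le> val (j, b)"
      using jb jb0 inj[of j b j0 b0] that unfolding n0_def by auto
    then have "n0 < p * j + R * e * b + o' j b" unfolding val_def by simp
    then show ?thesis
      unfolding coeff_t coeff_mult by (auto intro!: dvd_sum dvd_mult2 o_less)
  next
    case False
    then have "[:int p:] dvd c j b" using that by (simp add: Z_def)
    then have "[:int p:] dvd t j b" unfolding t_def by (simp add: dvd_mult2)
    then show ?thesis by (simp add: const_dvd_iff_coeff)
  qed
  \<comment> \<open>At the least order \<open>n0\<close> only the term \<open>(j0, b0)\<close>
    survives modulo \<open>p\<close>, with the product of the lowest coefficients of its
    factors.\<close>
  have main: "\<not> int p dvd coeff (t j0 b0) n0"
  proof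
    assume "int p dvd coeff (t j0 b0) n0"
    then have "int p dvd (\<Sum>i\<le>o' j0 b0. coeff (c j0 b0) i * coeff (U ^ b0) (o' j0 b0 - i))"
      unfolding coeff_t by (simp add: n0_def val_def coeff_mult)
    also have "(\<Sum>i\<le>o' j0 b0. coeff (c j0 b0) i * coeff (U ^ b0) (o' j0 b0 - i)) =
       coeff (c j0 b0) (o' j0 b0) * coeff U 0 ^ b0 +
       (\<Sum>i<o' j0 b0. coeff (c j0 b0) i * coeff (U ^ b0) (o' j0 b0 - i))"
      by (simp add: lessThan_Suc_atMost[symmetric] coeff_0_power)
    finally have "int p dvd coeff (c j0 b0) (o' j0 b0) * coeff U 0 ^ b0"
      by (subst (asm) dvd_add_left_iff) (auto intro!: dvd_sum dvd_mult2 o_less)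
    then have "int p dvd coeff (c j0 b0) (o' j0 b0) \<or> int p dvd coeff U 0"
      using \<open>prime p\<close> by (metis prime_dvd_mult_iff prime_dvd_power prime_nat_int_transfer)
    then show False using Z_o jb jb0 F(2) by auto
  qed
  have in_range: "j0 < J" "b0 < q" using jb jb0 by (auto simp: Z_def)
  have sum: "coeff (auxpoly p F J {..<q} q (\<lambda>b s. if b = s then 1 else 0) c) n0 =
      (\<Sum>jb\<in>{..<J} \<times> {..<q}. coeff (t (fst jb) (snd jb)) n0)"
  proof -
    have "auxpoly p F J {..<q} q (\<lambda>b s. if b = s then 1 else 0) c = (\<Sum>j<J. \<Sum>b<q. t j b)"
      unfolding auxpoly_def t_def
      by (intro sum.cong refl) (simp add: if_distrib[of "\<lambda>a. smult a _"] sum.delta cong: if_cong)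
    then show ?thesis by (simp add: coeff_sum sum.cartesian_product case_prod_unfold)
  qed
  have "int p dvd (\<Sum>jb\<in>{..<J} \<times> {..<q} - {(j0, b0)}. coeff (t (fst jb) (snd jb)) n0)"
  proof (rule dvd_sum)
    fix jb assume "jb \<in> {..<J} \<times> {..<q} - {(j0, b0)}"
    then show "int p dvd coeff (t (fst jb) (snd jb)) n0"
      using others[of "fst jb" "snd jb"] by (auto simp: prod_eq_iff)
  qed
  then have "\<not> int p dvd coeff (auxpoly p F J {..<q} q (\<lambda>b s. if b = s then 1 else 0) c) n0"
    using main in_range unfolding sum
    by (subst sum.remove[of _ "(j0, b0)"]) (simp_all add: dvd_add_left_iff)
  with dvd show False by (simp add: const_dvd_iff_coeff)
qed

text \<open>If all classes are large, a relation can be evaluated at the points of each class,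
  after which a factor \<open>X^p - X\<close> can be split off.\<close>

lemma relation_trivial_of_large_classes:
  fixes c :: "nat \<Rightarrow> 'b \<Rightarrow> int poly" and \<delta> :: "'b \<Rightarrow> int poly"
  assumes "prime p" "finite B" "\<And>a. a \<in> B \<Longrightarrow> finite (X a)" "\<And>a. a \<in> B \<Longrightarrow> card (X a) \<ge> N"
    and "\<And>a x y. a \<in> B \<Longrightarrow> x \<in> X a \<Longrightarrow> y \<in> X a \<Longrightarrow> [x = y] (mod int p) \<Longrightarrow> x = y"
    and \<delta>: "\<And>a b x. a \<in> B \<Longrightarrow> b \<in> B \<Longrightarrow> x \<in> X a \<Longrightarrow> [poly (\<delta> b) x = (if a = b then D else 0)] (mod int p)"
    and "\<not> int p dvd D"
    and "\<And>j b. j < J \<Longrightarrow> b \<in> B \<Longrightarrow> degree (c j b) + j < N"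
    and "[:int p:] dvd (\<Sum>j<J. \<Sum>b\<in>B. c j b * monom 1 (p * j) * \<delta> b)"
  shows "\<forall>j<J. \<forall>b\<in>B. [:int p:] dvd c j b"
  using assms(8,9)
proof (induction J arbitrary: c)
  case 0
  then show ?case by simp
next
  case (Suc J c)
  have p1: "p > 1" using assms(1) prime_gt_1_nat by blast
  \<comment> \<open>The relation as seen on class \<open>a\<close>: there \<open>x^p\<close> is
    \<open>x\<close>, \<open>\<delta> a\<close> is the invertible constant \<open>D\<close> and
    every other \<open>\<delta> b\<close> vanishes. Its degree is below the size of the class, so it
    is zero modulo \<open>p\<close>.\<close>
  define C where "C a = (\<Sum>j<Suc J. c j a * monom 1 j)" for a
  have C: "[:int p:] dvd C a" if a: "a \<in> B" for a
  proof (rule ccontr)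
    assume "\<not> [:int p:] dvd C a"
    then have "(\<Sum>x\<in>X a. 1) \<le> degree (C a)"
    proof (rule sum_multiplicities_le_degree[OF assms(1) assms(3)[OF a] assms(5)[OF a], rotated -1])
      fix x :: int and l :: nat
      assume x: "x \<in> X a" and "l < 1"
      then have l: "l = 0" by simp
      have "int p dvd poly (\<Sum>j<Suc J. \<Sum>b\<in>B. c j b * monom 1 (p * j) * \<delta> b) x"
        using Suc.prems(2) by (rule dvd_poly_eval)
      also have "poly (\<Sum>j<Suc J. \<Sum>b\<in>B. c j b * monom 1 (p * j) * \<delta> b) x =
         (\<Sum>j<Suc J. \<Sum>b\<in>B. poly (c j b) x * x ^ (p * j) * poly (\<delta> b) x)"
        by (simp add: poly_sum poly_monom del: sum.lessThan_Suc)
      finally have dvd: "int p dvd \<dots>" .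
      have eq1: "[(\<Sum>j<Suc J. \<Sum>b\<in>B. poly (c j b) x * x ^ (p * j) * poly (\<delta> b) x) =
          (\<Sum>j<Suc J. \<Sum>b\<in>B. poly (c j b) x * x ^ j * (if a = b then D else 0))] (mod int p)"
        using x a by (intro cong_sum cong_mult cong_refl fermat_power_cong_int assms(1) \<delta>)
      have eq2: "(\<Sum>j<Suc J. \<Sum>b\<in>B. poly (c j b) x * x ^ j * (if a = b then D else 0)) = poly (C a) x * D"
      proof -
        have "(\<Sum>b\<in>B. poly (c j b) x * x ^ j * (if a = b then D else 0)) = poly (c j a) x * x ^ j * D" for j
        proof -
          have "(\<Sum>b\<in>B. poly (c j b) x * x ^ j * (if a = b then D else 0))
              = (\<Sum>b\<in>B. if a = b then poly (c j b) x * x ^ j * D else 0)"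
            by (intro sum.cong) auto
          then show ?thesis using a assms(2) by (simp add: sum.delta)
        qed
        then show ?thesis
          unfolding C_def poly_sum sum_distrib_right by (simp add: poly_monom del: sum.lessThan_Suc)
      qed
      have "int p dvd poly (C a) x * D" using dvd unfolding cong_dvd_iff[OF eq1] eq2 .
      then show "int p dvd poly ((pderiv ^^ l) (C a)) x"
        using assms(1,7) l by (metis funpow_0 prime_dvd_mult_iff prime_nat_int_transfer)
    qed (use p1 in auto)
    also have "degree (C a) \<le> N - 1"
      unfolding C_def
    proof (rule degree_sum_le)
      fix j assume "j \<in> {..<Suc J}"
      then have "degree (c j a) + j \<le> N - 1" using Suc.prems(1)[of j a] a by simp
      then show "degree (c j a * monom 1 j) \<le> N - 1"
        using degree_mult_le[of "c j a" "monom 1 j"] degree_monom_le[of "1::int" j] by linarith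
    qed auto
    finally show False using assms(4)[OF a] Suc.prems(1)[of 0 a] a by simp
  qed
  define z :: "int poly" where "z = monom 1 p - monom 1 1"
  define q where "q i a = (\<Sum>j=Suc i..J. c j a * monom 1 (j - Suc i))" for i a
  \<comment> \<open>Division by \<open>y - X\<close> of the polynomial in \<open>y\<close> with
    coefficients \<open>c j a\<close>, taken at \<open>y = X^p\<close>: the remainder is
    \<open>C a\<close>, and the quotient, of degree one less in \<open>y\<close>, has the
    coefficients \<open>q i a\<close>.\<close>
  have split: "(\<Sum>j<Suc J. c j a * monom 1 (p * j)) = C a + z * (\<Sum>i<J. q i a * monom 1 (p * i))" for a
  proof -
    have *: "monom 1 (p * j) = monom 1 j + z * (\<Sum>i<j. monom (1::int) (j - Suc i) * monom 1 (p * i))" for j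
      using power_diff_sumr2[of "monom (1::int) p" j "monom 1 1"]
      by (simp add: z_def monom_power mult.commute algebra_simps)
    have "c j a * monom 1 (p * j) =
        c j a * monom 1 j + (\<Sum>i<j. z * (c j a * monom 1 (j - Suc i) * monom 1 (p * i)))" for j
      by (subst *) (simp add: distrib_left sum_distrib_left mult_ac)
    then have "(\<Sum>j<Suc J. c j a * monom 1 (p * j)) =
        (\<Sum>j<Suc J. c j a * monom 1 j) + (\<Sum>j\<le>J. \<Sum>i<j. z * (c j a * monom 1 (j - Suc i) * monom 1 (p * i)))"
      by (simp only: sum.distrib lessThan_Suc_atMost)
    also have "(\<Sum>j\<le>J. \<Sum>i<j. z * (c j a * monom 1 (j - Suc i) * monom 1 (p * i)))
        = (\<Sum>i<J. \<Sum>j=Suc i..J. z * (c j a * monom 1 (j - Suc i) * monom 1 (p * i)))"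
      by (rule sum.nested_swap')
    finally show ?thesis by (simp add: C_def q_def sum_distrib_left sum_distrib_right del: sum.lessThan_Suc)
  qed
  have "(\<Sum>j<Suc J. \<Sum>b\<in>B. c j b * monom 1 (p * j) * \<delta> b) =
      (\<Sum>b\<in>B. (\<Sum>j<Suc J. c j b * monom 1 (p * j)) * \<delta> b)"
    unfolding sum_distrib_right by (rule sum.swap)
  also have "\<dots> = (\<Sum>b\<in>B. C b * \<delta> b) + z * (\<Sum>b\<in>B. \<Sum>i<J. q i b * monom 1 (p * i) * \<delta> b)"
    unfolding split by (simp add: ring_distribs sum.distrib sum_distrib_left sum_distrib_right mult_ac)
  finally have "[:int p:] dvd (\<Sum>b\<in>B. C b * \<delta> b) + z * (\<Sum>b\<in>B. \<Sum>i<J. q i b * monom 1 (p * i) * \<delta> b)"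
    using Suc.prems(2) by simp
  moreover have "[:int p:] dvd (\<Sum>b\<in>B. C b * \<delta> b)" using C by (intro dvd_sum dvd_mult2) auto
  ultimately have "[:int p:] dvd z * (\<Sum>b\<in>B. \<Sum>i<J. q i b * monom 1 (p * i) * \<delta> b)"
    by (simp add: dvd_add_right_iff)
  moreover have "\<not> [:int p:] dvd z"
  proof
    assume "[:int p:] dvd z"
    then have "int p dvd coeff z p" by (simp add: const_dvd_iff_coeff)
    then show False using p1 by (simp add: z_def)
  qed
  ultimately have "[:int p:] dvd (\<Sum>b\<in>B. \<Sum>i<J. q i b * monom 1 (p * i) * \<delta> b)"
    using prime_elem_dvd_multD[OF prime_elem_const[OF assms(1)]] by blast
  then have "[:int p:] dvd (\<Sum>i<J. \<Sum>b\<in>B. q i b * monom 1 (p * i) * \<delta> b)"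
    by (subst sum.swap)
  moreover have "degree (q i b) + i < N" if "i < J" "b \<in> B" for i b
  proof -
    have "degree (q i b) \<le> N - 1 - i"
      unfolding q_def
    proof (rule degree_sum_le)
      fix j assume j: "j \<in> {Suc i..J}"
      then have "degree (c j b) + j < N" using Suc.prems(1)[of j b] that by simp
      then show "degree (c j b * monom 1 (j - Suc i)) \<le> N - 1 - i"
        using degree_mult_le[of "c j b" "monom 1 (j - Suc i)"] degree_monom_le[of "1::int" "j - Suc i"] j
        unfolding atLeastAtMost_iff by linarith
    qed auto
    moreover have "J < N" using Suc.prems(1)[of J b] that by simp
    ultimately show ?thesis using that by linarith
  qed
  ultimately have IH: "\<forall>i<J. \<forall>b\<in>B. [:int p:] dvd q i b" by (intro Suc.IH)
  \<comment> \<open>Horner's scheme read backwards recovers the \<open>c j b\<close> with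
    \<open>j > 0\<close> from the quotient; \<open>c 0 b\<close> comes from
    \<open>C b\<close>.\<close>
  have q_rec: "q i b = c (Suc i) b + monom 1 1 * q (Suc i) b" if "i < J" for i b
  proof -
    have "q i b = c (Suc i) b + (\<Sum>j=Suc (Suc i)..J. c j b * monom 1 (j - Suc i))"
      unfolding q_def using that by (subst sum.atLeast_Suc_atMost) (auto simp: monom_0)
    also have "(\<Sum>j=Suc (Suc i)..J. c j b * monom 1 (j - Suc i)) = monom 1 1 * q (Suc i) b"
      unfolding q_def sum_distrib_left
    proof (rule sum.cong)
      fix j assume "j \<in> {Suc (Suc i)..J}"
      then have "monom (1::int) (j - Suc i) = monom 1 1 * monom 1 (j - Suc (Suc i))"
        by (simp add: mult_monom Suc_diff_Suc)
      then show "c j b * monom 1 (j - Suc i) = monom 1 1 * (c j b * monom 1 (j - Suc (Suc i)))"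
        by (simp add: mult_ac)
    qed simp
    finally show ?thesis .
  qed
  have pos: "[:int p:] dvd c (Suc i) b" if "i < J" "b \<in> B" for i b
  proof -
    have "[:int p:] dvd q (Suc i) b"
    proof (cases "Suc i < J")
      case False
      then have "q (Suc i) b = 0" by (simp add: q_def)
      then show ?thesis by simp
    qed (use IH that in auto)
    moreover have "[:int p:] dvd c (Suc i) b + monom 1 1 * q (Suc i) b"
      using IH that unfolding q_rec[OF that(1), symmetric] by blast
    ultimately show ?thesis by (simp add: dvd_add_left_iff dvd_mult)
  qed
  have "[:int p:] dvd c 0 b" if "b \<in> B" for b
  proof -
    have "C b = c 0 b + (\<Sum>i<J. c (Suc i) b * monom 1 (Suc i))"
      unfolding C_def by (subst sum.lessThan_Suc_shift) (simp add: monom_0)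
    moreover have "[:int p:] dvd (\<Sum>i<J. c (Suc i) b * monom 1 (Suc i))"
      using pos that by (intro dvd_sum dvd_mult2) auto
    ultimately show ?thesis using C[OF that] by (simp add: dvd_add_left_iff)
  qed
  with pos show ?case by (metis less_Suc_eq_0_disj)
qed

section \<open>Equidistribution of classes of discrete logarithms\<close>

text \<open>Clearing denominators in the logarithmic derivative, the sum of the
  \<open>n h / (X + h)\<close>, gives a \<open>V\<close> whose degree does not grow with the
  exponents. Each derivation in Stepanov's method thus costs only degree \<open>card H\<close>,
  although \<open>F\<close> has degree comparable to \<open>p\<close>.\<close>

lemma linear_product_log_derivative:
  fixes n :: "int \<Rightarrow> nat"
  assumes "finite H"
  shows "\<exists>V. degree V \<le> card H \<and>
    (\<Prod>h\<in>H. [:h, 1:]) * pderiv (\<Prod>h\<in>H. [:h, 1:] ^ n h) = V * (\<Prod>h\<in>H. [:h, 1:] ^ n h)"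
  using assms
proof induction
  case empty
  then show ?case by (intro exI[of _ 0]) simp
next
  case (insert h H)
  let ?W = "\<Prod>h\<in>H. [:h, 1:]" and ?F = "\<Prod>h\<in>H. [:h, 1:] ^ n h" and ?l = "[:h, 1:]"
  obtain V where V: "degree V \<le> card H" "?W * pderiv ?F = V * ?F" using insert by blast
  define V' where "V' = smult (int (n h)) ?W + ?l * V"
  have pl: "?l * pderiv (?l ^ n h) = smult (int (n h)) (?l ^ n h)"
    using wderiv_power[of "?l" "?l" 1 "n h"] by (simp add: pderiv_pCons one_pCons)
  have "(?l * ?W) * pderiv (?l ^ n h * ?F) =
      ?l ^ n h * ?l * (?W * pderiv ?F) + ?W * ?F * (?l * pderiv (?l ^ n h))"
    by (simp only: pderiv_mult) (simp add: algebra_simps del: mult_pCons_left mult_pCons_right)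
  also have "\<dots> = V' * (?l ^ n h * ?F)"
    unfolding V pl V'_def by (simp add: algebra_simps del: mult_pCons_left mult_pCons_right)
  finally have "(?l * ?W) * pderiv (?l ^ n h * ?F) = V' * (?l ^ n h * ?F)" .
  moreover have "degree V' \<le> card (insert h H)"
    unfolding V'_def
  proof (rule degree_add_le)
    have "degree ?W \<le> (\<Sum>h\<in>H. degree [:h, 1:])" using degree_prod_sum_le[OF insert(1), of "\<lambda>h. [:h, 1:]"] by simp
    then have "degree ?W \<le> card H" by simp
    then show "degree (smult (int (n h)) ?W) \<le> card (insert h H)"
      using insert degree_smult_le[of "int (n h)" ?W] by simp
    have "degree (?l * V) \<le> degree ?l + degree V" by (rule degree_mult_le)
    then show "degree (?l * V) \<le> card (insert h H)" using V insert by simp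
  qed
  ultimately show ?case using insert by (intro exI[of _ V']) (simp del: mult_pCons_left mult_pCons_right)
qed

section \<open>Classes of discrete logarithms and their upper bounds\<close>

locale prime_root =
  fixes p g :: nat
  assumes prime: "prime p" and root: "residue_primroot p g"
begin

lemma prime_int: "prime (int p)" using prime by simp

lemma p_gt_1: "p > 1" using prime prime_gt_1_nat by blast

lemma ord_g: "ord p g = p - 1" using root prime by (simp add: residue_primroot_def totient_prime)

lemma coprime_g: "coprime p g" using root by (simp add: residue_primroot_def)

lemma g_power_cong: "[int g ^ i = int g ^ j] (mod int p) \<longleftrightarrow> [i = j] (mod (p - 1))"
  using order_divides_expdiff[OF coprime_g, of i j] unfolding ord_g
  by (metis cong_int_iff of_nat_power)

definition dlog :: "int \<Rightarrow> nat" where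
  "dlog x = (LEAST i. [int g ^ i = x] (mod int p))"

lemma dlog: "[int g ^ dlog x = x] (mod int p)" if "\<not> int p dvd x"
  unfolding dlog_def
proof (rule LeastI_ex)
  define y where "y = nat (x mod int p)"
  have yx: "int y = x mod int p" using p_gt_1 by (simp add: y_def)
  have "y < p" using p_gt_1 by (simp add: y_def nat_less_iff)
  moreover have "y \<noteq> 0" using that yx by (metis of_nat_0 dvd_eq_mod_eq_0)
  ultimately have "y \<in> totatives p"
    using prime by (auto simp: totatives_prime)
  then have "y \<in> (\<lambda>i. g ^ i mod p) ` {..<totient p}"
    using bij_betw_imp_surj_on[OF residue_primroot_is_generator[OF p_gt_1 root]] by simp
  then obtain i where "g ^ i mod p = y" by auto
  then have "int (g ^ i mod p) = x mod int p" using yx by simp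
  then have "[int g ^ i = x] (mod int p)"
    unfolding cong_mod_def by (simp add: zmod_int)
  then show "\<exists>i. [int g ^ i = x] (mod int p)" ..
qed

text \<open>At the excluded points some \<open>dlog (x + h)\<close> would be an unspecified value of
  \<open>LEAST\<close>.\<close>

definition goodpts :: "int set \<Rightarrow> int set" where
  "goodpts H = {x \<in> {0..<int p}. \<forall>h\<in>H. \<not> int p dvd x + h}"

text \<open>The discrete logarithm, modulo \<open>p - 1\<close>, of the product of the
  \<open>(x + h) ^ e h\<close>.\<close>

definition lgsum :: "int set \<Rightarrow> (int \<Rightarrow> nat) \<Rightarrow> int \<Rightarrow> nat" where
  "lgsum H e x = (\<Sum>h\<in>H. e h * dlog (x + h))"

definition cls :: "int set \<Rightarrow> (int \<Rightarrow> nat) \<Rightarrow> nat \<Rightarrow> nat \<Rightarrow> int set" where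
  "cls H e m a = {x \<in> goodpts H. [lgsum H e x = a] (mod m)}"

lemma finite_goodpts [simp]: "finite (goodpts H)"
  by (rule finite_subset[of _ "{0..<int p}"]) (auto simp: goodpts_def)

lemma finite_cls [simp]: "finite (cls H e m a)"
  by (rule finite_subset[of _ "goodpts H"]) (auto simp: cls_def)

text \<open>For \<open>R * m = p - 1\<close> its value at a good point is an \<open>m\<close>-th
  root of unity modulo \<open>p\<close> that identifies the class of \<open>lgsum H e x\<close>
  modulo \<open>m\<close>.\<close>

definition fpoly :: "int set \<Rightarrow> (int \<Rightarrow> nat) \<Rightarrow> nat \<Rightarrow> int poly" where
  "fpoly H e R = (\<Prod>h\<in>H. [:h, 1:] ^ (R * e h))"

lemma poly_fpoly_cong:
  assumes "\<And>h. h \<in> H \<Longrightarrow> \<not> int p dvd x + h"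
  shows "[poly (fpoly H e R) x = (int g ^ R) ^ lgsum H e x] (mod int p)"
proof -
  have "poly (fpoly H e R) x = (\<Prod>h\<in>H. (x + h) ^ (R * e h))"
    by (simp add: fpoly_def poly_prod add.commute)
  also have "[\<dots> = (\<Prod>h\<in>H. (int g ^ dlog (x + h)) ^ (R * e h))] (mod int p)"
    using assms by (intro cong_prod cong_pow cong_sym[OF dlog])
  also have "(\<Prod>h\<in>H. (int g ^ dlog (x + h)) ^ (R * e h)) = (int g ^ R) ^ lgsum H e x"
    by (simp add: lgsum_def power_sum sum_distrib_left mult_ac flip: power_mult)
  finally show ?thesis .
qed

lemma root_power_cong:
  assumes "R * m = p - 1" "[i = j] (mod m)"
  shows "[(int g ^ R) ^ i = (int g ^ R) ^ j] (mod int p)"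
proof -
  have "[R * i = R * j] (mod (R * m))" using assms(2) by (rule cong_cmult_leftI)
  then show ?thesis unfolding power_mult[symmetric] g_power_cong assms(1) .
qed

lemma root_power_cong_1_iff:
  assumes "R * m = p - 1"
  shows "[(int g ^ R) ^ i = 1] (mod int p) \<longleftrightarrow> m dvd i"
proof -
  have R: "R > 0" using assms p_gt_1 by (cases R) auto
  have "[(int g ^ R) ^ i = int g ^ 0] (mod int p) \<longleftrightarrow> [R * i = 0] (mod (p - 1))"
    unfolding power_mult[symmetric] g_power_cong ..
  also have "\<dots> \<longleftrightarrow> R * m dvd R * i" unfolding assms[symmetric] by (simp add: cong_0_iff)
  also have "\<dots> \<longleftrightarrow> m dvd i" using R by simp
  finally show ?thesis by simp
qed

text \<open>Stepanov's bound with order of vanishing \<open>M = (J - 1) * n\<close>. After division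
  by \<open>J - 1\<close> it says that \<open>n * card X\<close> is at most \<open>p\<close> plus
  \<open>(A + p + p * k * d0) / (J - 1)\<close>: the leading \<open>p\<close> comes from the powers
  \<open>x^(p j)\<close>, and \<open>p * k * d0\<close> bounds the degree of the powers of
  \<open>F\<close>.\<close>

lemma class_card_bound:
  fixes lam :: "'b \<Rightarrow> nat \<Rightarrow> int"
  assumes R: "R * m = p - 1" and H: "finite H" "card H = k" "\<And>h. h \<in> H \<Longrightarrow> e h \<le> d0"
    and X: "finite X" "\<And>x y. x \<in> X \<Longrightarrow> y \<in> X \<Longrightarrow> [x = y] (mod int p) \<Longrightarrow> x = y"
      "\<And>x h. x \<in> X \<Longrightarrow> h \<in> H \<Longrightarrow> \<not> int p dvd x + h"
      "\<And>x. x \<in> X \<Longrightarrow> [lgsum H e x = a] (mod m)"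
    and B: "finite B" "card B = n" "1 \<le> n" "n \<le> m"
    and J: "J \<ge> 2" "(J - 1) * n \<le> p" and A: "(k + 1) * J ^ 2 * m \<le> A"
    and nv: "\<And>c. (\<And>j b. j < J \<Longrightarrow> b \<in> B \<Longrightarrow> degree (c j b) < A) \<Longrightarrow>
        [:int p:] dvd auxpoly p (fpoly H e R) J B m lam c \<Longrightarrow> (\<forall>j<J. \<forall>b\<in>B. [:int p:] dvd c j b)"
  shows "(J - 1) * n * card X \<le> A + p * J + p * k * d0"
proof -
  define W where "W = (\<Prod>h\<in>H. [:h, 1:])"
  obtain V where V: "degree V \<le> card H" "W * pderiv (fpoly H e R) = V * fpoly H e R"
    using linear_product_log_derivative[OF H(1), of "\<lambda>h. R * e h"] unfolding W_def fpoly_def by auto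
  have degW: "degree W \<le> k"
    using degree_prod_sum_le[OF H(1), of "\<lambda>h. [:h, 1:]"] H(2) by (simp add: W_def)
  have "m \<ge> 1" using B by simp
  have "degree (fpoly H e R) \<le> (\<Sum>h\<in>H. degree ([:h, 1:] ^ (R * e h)))"
    unfolding fpoly_def using degree_prod_sum_le[OF H(1), of "\<lambda>h. [:h, 1:] ^ (R * e h)"] by (simp add: o_def)
  also have "\<dots> \<le> (\<Sum>h\<in>H. R * d0)"
  proof (rule sum_mono)
    fix h assume "h \<in> H"
    have "degree ([:h, 1:] ^ (R * e h)) \<le> R * e h" using degree_power_le[of "[:h, 1:]" "R * e h"] by simp
    also have "\<dots> \<le> R * d0" using H(3)[OF \<open>h \<in> H\<close>] by simp
    finally show "degree ([:h, 1:] ^ (R * e h)) \<le> R * d0" .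
  qed
  finally have "m * degree (fpoly H e R) \<le> m * (k * (R * d0))" using H(2) by simp
  also have "\<dots> = (R * m) * k * d0" by simp
  also have "\<dots> \<le> p * k * d0" unfolding R by simp
  finally have deg: "m * degree (fpoly H e R) \<le> p * k * d0" .
  have "(J - 1) * n * card X \<le> A + p * J + m * degree (fpoly H e R)"
  proof (rule stepanov_bound[OF prime B(1) X(1) X(2) V(2) degW, where lam = lam])
    show "\<forall>j<J. \<forall>b\<in>B. [:int p:] dvd c j b"
      if "\<And>j b. j < J \<Longrightarrow> b \<in> B \<Longrightarrow> degree (c j b) < A"
        "[:int p:] dvd auxpoly p (fpoly H e R) J B m lam c" for c
      using nv[OF that] .
    show "degree V \<le> k" using V H(2) by simp
    show "\<not> int p dvd poly W x" if "x \<in> X" for x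
    proof
      assume "int p dvd poly W x"
      then have "int p dvd (\<Prod>h\<in>H. h + x)" by (simp add: W_def poly_prod)
      then obtain h where "h \<in> H" "int p dvd h + x"
        using prime_dvd_prod_iff[OF H(1) prime_int, of "\<lambda>h. h + x"] by auto
      then show False using X(3)[OF that] by (simp add: add.commute)
    qed
    show "[poly (fpoly H e R) x = (int g ^ R) ^ a] (mod int p)" if "x \<in> X" for x
      using poly_fpoly_cong[OF X(3)[OF that]] root_power_cong[OF R X(4)[OF that]] by (rule cong_trans)
    show "(J - 1) * n \<le> p" by fact
    have "0 < (k + 1) * J ^ 2 * m" using J \<open>m \<ge> 1\<close> by (intro mult_pos_pos) auto
    then show "1 \<le> A" using A by linarith
    show "1 \<le> J" using J by simp
    \<comment> \<open>In the leading terms the unknowns exceed the conditions by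
      \<open>n * A\<close>; the other conditions number at most
      \<open>n * (J - 1) * (k + 1) * J * m\<close>, which explains the lower bound on
      \<open>A\<close>.\<close>
    show "(J - 1) * n * (A + k * ((J - 1) * n) + J) < J * card B * A"
    proof -
      obtain i where i: "J = Suc i" using J by (cases J) auto
      have "i \<le> J" using i by simp
      moreover have "J * 1 \<le> J * m" using \<open>m \<ge> 1\<close> by (intro mult_le_mono) auto
      ultimately have "i * (k * (i * n) + J) \<le> i * (k * (J * m) + J * m)"
        using B(4) by (intro mult_le_mono add_le_mono) auto
      also have "\<dots> = (k + 1) * m * J * i" by (simp add: algebra_simps)
      also have "\<dots> < (k + 1) * m * J * J" using i \<open>m \<ge> 1\<close> by (intro mult_strict_left_mono) auto
      finally have "i * (k * (i * n) + J) < A"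
        using A by (simp add: power2_eq_square algebra_simps)
      then have "n * (i * (k * (i * n) + J) + i * A) < n * (A + i * A)" using B by simp
      then show ?thesis by (simp add: i B(2) algebra_simps)
    qed
  qed auto
  with deg show ?thesis by simp
qed

text \<open>With the identity matrix for \<open>lam\<close> the powers of \<open>F\<close> below
  \<open>q\<close> appear singly, kept independent by their orders of vanishing at 0. The bound is
  the one for \<open>n = q\<close>, about \<open>p / q\<close> per class, and presupposes nothing
  about the size of any class.\<close>

lemma ramified_class_card_bound_0:
  assumes q: "prime q" "R * q = p - 1" and H: "finite H" "card H = k" "\<And>h. h \<in> H \<Longrightarrow> e h \<le> d0"
    and h0: "0 \<in> H" "\<not> q dvd e 0" "\<And>h. h \<in> H \<Longrightarrow> int p dvd h \<Longrightarrow> h = 0"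
    and X: "finite X" "\<And>x y. x \<in> X \<Longrightarrow> y \<in> X \<Longrightarrow> [x = y] (mod int p) \<Longrightarrow> x = y"
      "\<And>x h. x \<in> X \<Longrightarrow> h \<in> H \<Longrightarrow> \<not> int p dvd x + h"
      "\<And>x. x \<in> X \<Longrightarrow> [lgsum H e x = a] (mod q)"
    and J: "J \<ge> 2" "(J - 1) * q \<le> p" and A: "(k + 1) * J ^ 2 * q \<le> A" "A + J \<le> R"
  shows "(J - 1) * q * card X \<le> A + p * J + p * k * d0"
proof (rule class_card_bound[OF q(2) H X, where B = "{..<q}" and lam = "\<lambda>b s. if b = s then 1 else 0"])
  fix c :: "nat \<Rightarrow> nat \<Rightarrow> int poly"
  assume c: "\<And>j b. j < J \<Longrightarrow> b \<in> {..<q} \<Longrightarrow> degree (c j b) < A"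
    "[:int p:] dvd auxpoly p (fpoly H e R) J {..<q} q (\<lambda>b s. if b = s then 1 else 0) c"
  define U where "U = (\<Prod>h\<in>H - {0}. [:h, 1:] ^ (R * e h))"
  show "\<forall>j<J. \<forall>b\<in>{..<q}. [:int p:] dvd c j b"
  proof (rule auxpoly_nonvanishing_ramified[OF prime q(1) _ h0(2) A(2) _ _ c])
    show "p = R * q + 1" using q p_gt_1 by simp
    have "[:0, 1::int:] = monom 1 1" by (simp add: monom_altdef)
    then show "fpoly H e R = monom 1 (R * e 0) * U"
      unfolding fpoly_def U_def using h0(1) H(1) by (subst prod.remove[of H 0]) (auto simp: monom_power)
    show "\<not> int p dvd coeff U 0"
    proof
      assume "int p dvd coeff U 0"
      then have "int p dvd (\<Prod>h\<in>H - {0}. h ^ (R * e h))"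
        by (simp add: U_def poly_prod flip: poly_0_coeff_0)
      then obtain h where "h \<in> H - {0}" "int p dvd h ^ (R * e h)"
        using prime_dvd_prod_iff[OF _ prime_int, of "H - {0}" "\<lambda>h. h ^ (R * e h)"] H(1) by auto
      then show False using h0(3) prime_dvd_power[OF prime_int] by blast
    qed
  qed
qed (use q J A prime_gt_0_nat[OF q(1)] in auto)

text \<open>Translation by \<open>h0\<close> moves the ramification point \<open>- h0\<close> to 0
  and preserves \<open>lgsum\<close>.\<close>

lemma ramified_class_card_bound:
  assumes q: "prime q" "R * q = p - 1" and H: "finite H" "card H = k" "\<And>h. h \<in> H \<Longrightarrow> e h \<le> d0"
    and h0: "h0 \<in> H" "\<not> q dvd e h0" and H': "\<And>h h'. h \<in> H \<Longrightarrow> h' \<in> H \<Longrightarrow> [h = h'] (mod int p) \<Longrightarrow> h = h'"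
    and J: "J \<ge> 2" "(J - 1) * q \<le> p" and A: "(k + 1) * J ^ 2 * q \<le> A" "A + J \<le> R"
  shows "(J - 1) * q * card (cls H e q a) \<le> A + p * J + p * k * d0"
proof -
  define X where "X = (\<lambda>x. x + h0) ` cls H e q a"
  define H1 where "H1 = (\<lambda>h. h - h0) ` H"
  define e1 where "e1 h = e (h + h0)" for h
  have lg: "lgsum H1 e1 (x + h0) = lgsum H e x" for x
    unfolding lgsum_def H1_def e1_def by (subst sum.reindex) (auto simp: inj_on_def algebra_simps)
  have "finite X" by (simp add: X_def finite_cls)
  have "(J - 1) * q * card X \<le> A + p * J + p * k * d0"
  proof (rule ramified_class_card_bound_0[OF q _ _ _ _ _ _ \<open>finite X\<close> _ _ _ J A, where H = H1 and e = e1])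
    show "finite H1" using H by (simp add: H1_def)
    show "card H1 = k" unfolding H1_def using H by (subst card_image) (auto simp: inj_on_def)
    show "h = 0" if "h \<in> H1" "int p dvd h" for h
      using that H'[OF _ h0(1)] unfolding H1_def by (auto simp: cong_iff_dvd_diff)
    show "x = y" if "x \<in> X" "y \<in> X" "[x = y] (mod int p)" for x y
      using that unfolding X_def cls_def goodpts_def
      by (auto simp: cong_mod_def mod_eq_dvd_iff)
         (metis mod_eq_dvd_iff mod_pos_pos_trivial)
    show "\<not> int p dvd x + h" if "x \<in> X" "h \<in> H1" for x h
      using that unfolding X_def H1_def cls_def goodpts_def by auto
    show "[lgsum H1 e1 x = a] (mod q)" if "x \<in> X" for x
      using that lg unfolding X_def cls_def by auto
  qed (use H h0 in \<open>auto simp: H1_def e1_def\<close>)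
  then show ?thesis unfolding X_def by (subst (asm) card_image) auto
qed

text \<open>Here \<open>lam\<close> is an inverse Fourier matrix, \<open>\<beta> ^ (m - b)\<close>
  standing for the inverse of \<open>\<beta> ^ b\<close>: the resulting combination of powers of
  \<open>F\<close> is \<open>m\<close> on class \<open>b\<close> and 0 on the other classes. So
  \<open>n\<close> becomes the number of large classes, and \<open>A + J\<close> points are what is
  needed to test a relation class by class.\<close>

lemma large_class_card_bound:
  assumes R: "R * m = p - 1" and H: "finite H" "card H = k" "\<And>h. h \<in> H \<Longrightarrow> e h \<le> d0"
    and J: "J \<ge> 2" "(J - 1) * m \<le> p" and A: "(k + 1) * J ^ 2 * m \<le> A"
    and B: "B = {b. b < m \<and> card (cls H e m b) \<ge> A + J}" "B \<noteq> {}"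
  shows "(J - 1) * card B * card (cls H e m a) \<le> A + p * J + p * k * d0"
proof -
  define \<beta> where "\<beta> = int g ^ R"
  define lam where "lam b s = \<beta> ^ ((m - b) * s)" for b s
  have m: "m > 0" "m < p" using R p_gt_1 by (cases m; cases R; simp)+
  have finB: "finite B" "card B \<le> m"
    using card_mono[of "{..<m}" B] unfolding B(1) by auto
  have inj: "x = y" if "x \<in> cls H e m b" "y \<in> cls H e m b" "[x = y] (mod int p)" for x y b
    using that unfolding cls_def goodpts_def by (auto simp: cong_mod_def)
  show ?thesis
  proof (rule class_card_bound[OF R H finite_cls inj _ _ finB(1) refl _ finB(2) J(1) _ A, where lam = lam and a = a])
    show "1 \<le> card B" using finB B(2) by (simp add: Suc_leI card_gt_0_iff)
    show "(J - 1) * card B \<le> p" using finB J(2) by (meson le_trans mult_le_mono2)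
    fix c :: "nat \<Rightarrow> nat \<Rightarrow> int poly"
    assume c: "\<And>j b. j < J \<Longrightarrow> b \<in> B \<Longrightarrow> degree (c j b) < A"
      "[:int p:] dvd auxpoly p (fpoly H e R) J B m lam c"
    define \<delta> where "\<delta> b = (\<Sum>s<m. smult (lam b s) (fpoly H e R ^ s))" for b
    show "\<forall>j<J. \<forall>b\<in>B. [:int p:] dvd c j b"
    proof (rule relation_trivial_of_large_classes[OF prime finB(1) finite_cls _ inj])
      show "A + J \<le> card (cls H e m a)" if "a \<in> B" for a using that unfolding B(1) by simp
      show "[poly (\<delta> b) x = (if a = b then int m else 0)] (mod int p)"
        if ab: "a \<in> B" "b \<in> B" "x \<in> cls H e m a" for a b x
      proof -
        have ab': "a < m" "b < m" using ab unfolding B(1) by auto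
        define \<gamma> where "\<gamma> = \<beta> ^ (m - b + a)"
        have F: "[poly (fpoly H e R) x = \<beta> ^ a] (mod int p)"
        proof -
          have x: "x \<in> goodpts H" "[lgsum H e x = a] (mod m)" using ab by (auto simp: cls_def)
          have "[poly (fpoly H e R) x = \<beta> ^ lgsum H e x] (mod int p)"
            unfolding \<beta>_def using x by (intro poly_fpoly_cong) (auto simp: goodpts_def)
          also have "[\<beta> ^ lgsum H e x = \<beta> ^ a] (mod int p)"
            unfolding \<beta>_def by (rule root_power_cong[OF R x(2)])
          finally show ?thesis .
        qed
        have "[poly (\<delta> b) x = (\<Sum>s<m. lam b s * (\<beta> ^ a) ^ s)] (mod int p)"
          unfolding \<delta>_def poly_sum poly_smult poly_power
          by (intro cong_sum cong_mult cong_refl cong_pow F)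
        also have "(\<Sum>s<m. lam b s * (\<beta> ^ a) ^ s) = (\<Sum>s<m. \<gamma> ^ s)"
          by (simp add: lam_def \<gamma>_def power_mult power_add power_mult_distrib)
        finally have eq: "[poly (\<delta> b) x = (\<Sum>s<m. \<gamma> ^ s)] (mod int p)" .
        show ?thesis
        proof (cases "a = b")
          case True
          then have "\<gamma> = \<beta> ^ m" using ab' by (simp add: \<gamma>_def)
          then have "[\<gamma> = 1] (mod int p)" using root_power_cong_1_iff[OF R, of m] by (simp add: \<beta>_def)
          then have "[(\<Sum>s<m. \<gamma> ^ s) = (\<Sum>s<m. 1 ^ s)] (mod int p)" by (intro cong_sum cong_pow)
          then show ?thesis using eq True by (auto intro: cong_trans)
        next
          case False
          have "\<not> m dvd m - b + a"
          proof
            assume "m dvd m - b + a"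
            then have "int m dvd int (m - b + a)" by (simp only: int_dvd_int_iff)
            also have "int (m - b + a) = int m + (int a - int b)" using ab' by (simp add: of_nat_diff)
            finally have "int m dvd int m + (int a - int b)" .
            then have "int m dvd int a - int b" by (simp only: dvd_add_right_iff[OF dvd_refl])
            then have "[int a = int b] (mod int m)" by (simp add: cong_iff_dvd_diff)
            then have "[a = b] (mod m)" by (simp add: cong_int_iff)
            then show False using False ab' by (simp add: cong_less_modulus_unique_nat)
          qed
          then have n1: "\<not> int p dvd \<gamma> - 1"
            using root_power_cong_1_iff[OF R, of "m - b + a"]
            by (simp add: \<gamma>_def \<beta>_def cong_iff_dvd_diff)
          have "[(\<beta> ^ m) ^ (m - b + a) = 1 ^ (m - b + a)] (mod int p)"
            using root_power_cong_1_iff[OF R, of m] by (intro cong_pow) (simp add: \<beta>_def)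
          then have "int p dvd \<gamma> ^ m - 1"
            by (simp add: \<gamma>_def cong_iff_dvd_diff mult.commute flip: power_mult)
          also have "\<gamma> ^ m - 1 = (\<gamma> - 1) * (\<Sum>s<m. \<gamma> ^ s)" by (rule power_diff_1_eq)
          finally have "int p dvd (\<Sum>s<m. \<gamma> ^ s)"
            using n1 prime by (metis prime_dvd_mult_iff prime_nat_int_transfer)
          then have "[(\<Sum>s<m. \<gamma> ^ s) = 0] (mod int p)" by (simp add: cong_0_iff)
          then show ?thesis using eq False by (auto intro: cong_trans)
        qed
      qed
      show "\<not> int p dvd int m" using m by (simp add: nat_dvd_not_less)
      show "degree (c j b) + j < A + J" if "j < J" "b \<in> B" for j b using c(1)[OF that] that by simp
      have "auxpoly p (fpoly H e R) J B m lam c = (\<Sum>j<J. \<Sum>b\<in>B. c j b * monom 1 (p * j) * \<delta> b)"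
        by (simp add: auxpoly_def \<delta>_def sum_distrib_left)
      then show "[:int p:] dvd (\<Sum>j<J. \<Sum>b\<in>B. c j b * monom 1 (p * j) * \<delta> b)" using c(2) by simp
    qed
  qed (auto simp: cls_def goodpts_def)
qed

end

section \<open>From upper bounds to equidistribution\<close>

lemma squarefree_dvdI:
  fixes m n :: nat
  assumes "squarefree m" "\<And>q. prime q \<Longrightarrow> q dvd m \<Longrightarrow> q dvd n"
  shows "m dvd n"
proof (cases "n = 0")
  case False
  show ?thesis
  proof (rule multiplicity_le_imp_dvd)
    show "m \<noteq> 0" using assms(1) by (metis not_squarefree_0)
    fix q :: nat assume q: "prime q"
    show "multiplicity q m \<le> multiplicity q n"
    proof (cases "q dvd m")
      case True
      then have "multiplicity q n \<ge> 1"
        using assms(2)[OF q] q False by (intro multiplicity_geI) auto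
      moreover have "multiplicity q m \<le> 1"
        using assms(1) q squarefree_factorial_semiring''[of m] by (metis not_squarefree_0)
      ultimately show ?thesis by simp
    qed (simp add: not_dvd_imp_multiplicity_0)
  qed
qed simp

context prime_root
begin

lemma card_goodpts:
  assumes "finite H" "card H = k"
  shows "card (goodpts H) \<le> p" "p \<le> card (goodpts H) + k"
proof -
  let ?I = "{0..<int p}"
  have sub: "goodpts H \<subseteq> ?I" by (auto simp: goodpts_def)
  then show "card (goodpts H) \<le> p" using card_mono[of ?I "goodpts H"] by simp
  have "?I - goodpts H \<subseteq> (\<lambda>h. (- h) mod int p) ` H"
  proof
    fix x assume x: "x \<in> ?I - goodpts H"
    then obtain h where h: "h \<in> H" "int p dvd x + h" by (auto simp: goodpts_def)
    then have "x mod int p = (- h) mod int p" by (simp add: mod_eq_dvd_iff)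
    then show "x \<in> (\<lambda>h. (- h) mod int p) ` H" using x h by (metis DiffE atLeastLessThan_iff image_eqI mod_pos_pos_trivial)
  qed
  then have "card (?I - goodpts H) \<le> k"
    using assms by (meson card_image_le card_mono finite_imageI le_trans)
  moreover have "card (?I - goodpts H) = p - card (goodpts H)"
    using sub by (subst card_Diff_subset) auto
  ultimately show "p \<le> card (goodpts H) + k" by simp
qed

lemma cls_decomp:
  assumes "q dvd m" "m > 0"
  shows "card (cls H e q r) = (\<Sum>a\<in>{a. a < m \<and> [a = r] (mod q)}. card (cls H e m a))"
proof -
  have "cls H e q r = (\<Union>a\<in>{a. a < m \<and> [a = r] (mod q)}. cls H e m a)"
  proof (intro equalityI subsetI)
    fix x assume x: "x \<in> cls H e q r"
    have "[lgsum H e x mod m = lgsum H e x] (mod m)" by (simp add: cong_mod_def)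
    then have "[lgsum H e x mod m = lgsum H e x] (mod q)" using assms(1) by (rule cong_dvd_modulus_nat)
    with x have "[lgsum H e x mod m = r] (mod q)" unfolding cls_def by (auto intro: cong_trans)
    moreover have "x \<in> cls H e m (lgsum H e x mod m)"
      using x by (simp add: cls_def cong_mod_def)
    ultimately show "x \<in> (\<Union>a\<in>{a. a < m \<and> [a = r] (mod q)}. cls H e m a)"
      using assms by (intro UN_I[of "lgsum H e x mod m"]) auto
  next
    fix x assume "x \<in> (\<Union>a\<in>{a. a < m \<and> [a = r] (mod q)}. cls H e m a)"
    then obtain a where "[a = r] (mod q)" "x \<in> goodpts H" "[lgsum H e x = a] (mod m)"
      by (auto simp: cls_def)
    then show "x \<in> cls H e q r"
      using cong_dvd_modulus_nat[OF _ assms(1)] by (auto simp: cls_def intro: cong_trans)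
  qed
  moreover have "cls H e m a \<inter> cls H e m b = {}" if "a < m" "b < m" "a \<noteq> b" for a b
    using that by (auto simp: cls_def) (metis cong_less_modulus_unique_nat cong_sym cong_trans)
  ultimately show ?thesis by (simp add: card_UN_disjoint)
qed

lemma sum_card_cls:
  assumes "m > 0"
  shows "(\<Sum>a<m. card (cls H e m a)) = card (goodpts H)"
proof -
  have "cls H e 1 0 = goodpts H" by (auto simp: cls_def)
  then show ?thesis using cls_decomp[of 1 m H e 0] assms by (simp add: lessThan_def)
qed

text \<open>\<open>E\<close> is the excess in the upper bounds, \<open>E2\<close> the final error.
  For a prime \<open>q\<close> dividing \<open>m\<close> the class of 0 modulo \<open>q\<close> is
  evaluated twice: it has about \<open>p / q\<close> points by ramification, and about
  \<open>r * p / n\<close> points if it contains \<open>r\<close> of the \<open>n\<close> large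
  classes modulo \<open>m\<close>. By \<open>small\<close> the integers \<open>q * r\<close> and
  \<open>n\<close> differ by less than 1, so \<open>q\<close> divides \<open>n\<close>; as
  \<open>m\<close> is squarefree and \<open>n <= m\<close>, all classes are large.\<close>

lemma equidistribution:
  fixes E E2 :: real
  assumes R: "R * m = p - 1" and m: "squarefree m"
    and H: "finite H" "card H = k" "k \<ge> 1" "\<And>h. h \<in> H \<Longrightarrow> e h \<le> d0"
    and H': "\<And>h h'. h \<in> H \<Longrightarrow> h' \<in> H \<Longrightarrow> [h = h'] (mod int p) \<Longrightarrow> h = h'"
    and ram: "\<And>q. prime q \<Longrightarrow> q dvd m \<Longrightarrow> \<exists>h\<in>H. \<not> q dvd e h"
    and J: "J \<ge> 2" "(J - 1) * m \<le> p" and A: "(k + 1) * J ^ 2 * m \<le> A" "A + J \<le> R"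
    and E: "E = (A + p + p * k * d0) / (J - 1)" and E2: "real m * (real k + real m * (real A + real J) + E) \<le> E2"
    and small: "3 * real m ^ 2 * E2 < p" and a: "a < m"
  shows "\<bar>m * real (card (cls H e m a)) - p\<bar> \<le> E2"
proof -
  have m0: "m > 0" using m by (metis gr0I not_squarefree_0)
  have E0: "E \<ge> 0" unfolding E using J(1) by (intro divide_nonneg_nonneg) auto
  define G where "G = real (card (goodpts H))"
  have G: "G \<le> p" "G \<ge> real p - k"
    using card_goodpts[OF H(1,2)] by (simp_all add: G_def)
  have to_E: "real n * real c \<le> real p + E" if "(J - 1) * n * c \<le> A + p * J + p * k * d0" for n c
  proof -
    obtain i where i: "J = Suc i" "i > 0" using J(1) by (cases J) auto
    have "real i * (real n * real c) \<le> real (A + p * J + p * k * d0)"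
      using that unfolding i(1) by (simp flip: of_nat_mult of_nat_add add: mult.assoc)
    also have "\<dots> = real i * (real p + E)" using i by (simp add: E field_simps)
    finally show ?thesis using i by simp
  qed
  \<comment> \<open>The \<open>q\<close> upper bounds together nearly exhaust the total, so none of
    them can be far from equality.\<close>
  have prime_case: "\<bar>real q * card (cls H e q 0) - p\<bar> \<le> q * (k + E)" if q: "prime q" "q dvd m" for q
  proof -
    obtain t where t: "m = q * t" using q by blast
    have q0: "q \<ge> 2" using q(1) prime_ge_2_nat by blast
    have t0: "t \<ge> 1" using t m0 by (cases t) auto
    obtain h0 where h0: "h0 \<in> H" "\<not> q dvd e h0" using ram q by blast
    have up: "real q * card (cls H e q r) \<le> p + E" for r
    proof (rule to_E)
      show "(J - 1) * q * card (cls H e q r) \<le> A + p * J + p * k * d0"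
      proof (rule ramified_class_card_bound[where q = q and R = "R * t" and H = H and e = e and ?h0.0 = h0])
        show "R * t * q = p - 1" using R t by (simp add: mult_ac)
        have "q \<le> m" unfolding t using t0 by simp
        then have "(J - 1) * q \<le> (J - 1) * m" "(k + 1) * J ^ 2 * q \<le> (k + 1) * J ^ 2 * m"
          by (simp_all only: mult_le_mono2)
        then show "(J - 1) * q \<le> p" "(k + 1) * J ^ 2 * q \<le> A" using J(2) A(1) by (blast intro: order_trans)+
        have "R \<le> R * t" using t0 by simp
        then show "A + J \<le> R * t" using A(2) by linarith
      qed (use q H H' h0 J in auto)
    qed
    have "real q * (real p - real k) \<le> real q * G" using G(2) by (intro mult_left_mono) auto
    also have "G = (\<Sum>r<q. real (card (cls H e q r)))"
      unfolding G_def using sum_card_cls[of q H e] q0 by (simp flip: of_nat_sum)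
    also have "real q * \<dots> = real q * card (cls H e q 0) + (\<Sum>r\<in>{..<q} - {0}. real q * card (cls H e q r))"
      using q0 by (subst sum.remove[of "{..<q}" 0]) (auto simp: sum_distrib_left distrib_left)
    also have "(\<Sum>r\<in>{..<q} - {0}. real q * card (cls H e q r)) \<le> (\<Sum>r\<in>{..<q} - {0}. p + E)"
      by (intro sum_mono up)
    also have "\<dots> = (real q - 1) * (p + E)" using q0 by (simp add: of_nat_diff)
    finally have "real q * card (cls H e q 0) - p \<ge> - (q * (k + E)) + E" by (simp add: algebra_simps)
    moreover have "E \<le> q * (k + E)"
      using q0 E0 mult_mono[of 1 "real q" E "k + E"] by simp
    ultimately show ?thesis using up[of 0] E0 by (simp add: abs_le_iff)
  qed
  define c where "c b = real (card (cls H e m b))" for b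
  define B where "B = {b. b < m \<and> card (cls H e m b) \<ge> A + J}"
  define n where "n = card B"
  have BI: "B \<subseteq> {..<m}" by (auto simp: B_def)
  then have finB: "finite B" by (rule finite_subset) auto
  have nm: "n \<le> m" using card_mono[OF _ BI] by (simp add: n_def)
  have mE2: "E2 \<ge> real m * (real A + real J)" "E2 \<ge> k + E" "E2 \<ge> m * (real k + real m * (real A + real J) + E)"
  proof -
    have m1: "real m \<ge> 1" using m0 by simp
    have 1: "1 * (real k + real m * (real A + real J) + E) \<le> E2"
      using m1 E0 by (intro order_trans[OF _ E2] mult_right_mono) auto
    define t where "t = real m * (real A + real J)"
    have t: "t \<ge> 0" "real k + t + E \<le> E2" using 1 by (simp_all add: t_def)
    have "t \<le> E2" using t E0 of_nat_0_le_iff[of k] by linarith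
    then show "E2 \<ge> real m * (real A + real J)" by (simp only: t_def)
    show "E2 \<ge> k + E" using t by linarith
    show "E2 \<ge> m * (real k + real m * (real A + real J) + E)" by (rule E2)
  qed
  have sumc: "(\<Sum>b<m. c b) = G"
    unfolding c_def G_def using sum_card_cls[OF m0, of H e] by (simp flip: of_nat_sum)
  have csmall: "c b \<le> A + J" if "b < m" "b \<notin> B" for b using that by (simp add: B_def c_def)
  have "B \<noteq> {}"
  proof
    assume "B = {}"
    then have "G \<le> (\<Sum>b<m. real (A + J))"
      unfolding sumc[symmetric] by (intro sum_mono csmall) auto
    then have "G \<le> real m * (real A + real J)" by simp
    then have "real p \<le> real k + real m * (real A + real J)" using G by simp
    also have "\<dots> \<le> real k + real m * (real A + real J) + E" using E0 by simp
    also have "\<dots> = 1 * \<dots>" by simp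
    also have "\<dots> \<le> E2" using m0 E0 by (intro order_trans[OF _ E2] mult_right_mono) auto
    also have "\<dots> = 1 * E2" by simp
    also have "\<dots> \<le> 3 * real m ^ 2 * E2"
    proof (rule mult_right_mono)
      have "1 \<le> real m ^ 2" using m0 by simp
      then show "1 \<le> 3 * real m ^ 2" by simp
      show "0 \<le> E2" using mE2 E0 by linarith
    qed
    finally show False using small by simp
  qed
  then have n1: "n \<ge> 1" using finB by (simp add: n_def Suc_leI card_gt_0_iff)
  have up: "real n * c b \<le> p + E" for b
    unfolding c_def n_def
    by (rule to_E, rule large_class_card_bound[where e = e, OF R H(1,2,4) J A(1) B_def \<open>B \<noteq> {}\<close>])
  \<comment> \<open>The same squeeze over the \<open>n\<close> large classes; the small ones
    together hold at most \<open>m * (A + J)\<close> points.\<close>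
  have inB: "\<bar>n * c b - p\<bar> \<le> E2" if b: "b \<in> B" for b
  proof -
    have "real n * (real p - real k) \<le> real n * G" using G(2) by (intro mult_left_mono) auto
    also have "G = (\<Sum>b'\<in>B. c b') + (\<Sum>b'\<in>{..<m} - B. c b')"
      unfolding sumc[symmetric] using BI by (simp add: sum.subset_diff[of B "{..<m}"] add.commute)
    also have "(\<Sum>b'\<in>B. c b') = c b + (\<Sum>b'\<in>B - {b}. c b')"
      using b finB by (rule sum.remove[rotated])
    also have "real n * (c b + (\<Sum>b'\<in>B - {b}. c b') + (\<Sum>b'\<in>{..<m} - B. c b')) =
       n * c b + (\<Sum>b'\<in>B - {b}. n * c b') + n * (\<Sum>b'\<in>{..<m} - B. c b')"
      by (simp add: algebra_simps sum_distrib_left)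
    also have "\<dots> \<le> n * c b + (\<Sum>b'\<in>B - {b}. p + E) + n * (\<Sum>b'<m. real (A + J))"
    proof (intro add_mono sum_mono up order_refl mult_left_mono)
      have "(\<Sum>b'\<in>{..<m} - B. c b') \<le> (\<Sum>b'\<in>{..<m} - B. real (A + J))"
        by (intro sum_mono csmall) auto
      also have "\<dots> \<le> (\<Sum>b'<m. real (A + J))" by (intro sum_mono2) auto
      finally show "(\<Sum>b'\<in>{..<m} - B. c b') \<le> (\<Sum>b'<m. real (A + J))" .
    qed auto
    also have "(\<Sum>b'\<in>B - {b}. p + E) = (real n - 1) * (p + E)"
      using b finB n1 by (simp add: n_def of_nat_diff)
    finally have "n * c b \<ge> p - n * (real k + real m * (real A + real J) + E) + E" by (simp add: algebra_simps)
    moreover have "n * (real k + real m * (real A + real J) + E) \<le> E2"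
      using nm E0 order_trans[OF _ mE2(3)] by (intro order_trans[OF _ mE2(3)] mult_right_mono) auto
    ultimately show ?thesis using up[of b] mE2 E0 by (simp add: abs_le_iff)
  qed
  have "q dvd n" if q: "prime q" "q dvd m" for q
  proof -
    let ?S = "{b. b < m \<and> [b = 0] (mod q)}"
    define r where "r = card (B \<inter> ?S)"
    define Y where "Y = real (card (cls H e q 0))"
    have finS: "finite ?S" by simp
    have q1: "q \<le> m" using q m0 by (simp add: dvd_imp_le)
    have rn: "r \<le> n" unfolding r_def n_def using finB by (intro card_mono) auto
    have cardS: "card ?S \<le> m" using card_mono[of "{..<m}" ?S] by auto
    have "Y = (\<Sum>b\<in>?S. c b)" unfolding Y_def c_def using cls_decomp[OF q(2) m0, of H e 0] by simp
    also have "\<dots> = (\<Sum>b\<in>B \<inter> ?S. c b) + (\<Sum>b\<in>?S - B. c b)"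
      using sum.Int_Diff[OF finS, of c B] by (simp add: Int_commute)
    finally have Y: "Y = (\<Sum>b\<in>B \<inter> ?S. c b) + (\<Sum>b\<in>?S - B. c b)" .
    have Y1: "\<bar>n * (\<Sum>b\<in>B \<inter> ?S. c b) - r * p\<bar> \<le> m * E2"
    proof -
      have "n * (\<Sum>b\<in>B \<inter> ?S. c b) - r * p = (\<Sum>b\<in>B \<inter> ?S. n * c b - p)"
        by (simp add: sum_subtractf sum_distrib_left r_def)
      also have "\<bar>\<dots>\<bar> \<le> (\<Sum>b\<in>B \<inter> ?S. E2)"
        by (rule order_trans[OF sum_abs]) (intro sum_mono inB, auto)
      also have "\<dots> = r * E2" by (simp add: r_def)
      also have "\<dots> \<le> m * E2" using rn nm mE2 E0 by (intro mult_right_mono) auto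
      finally show ?thesis .
    qed
    have Y2: "0 \<le> (\<Sum>b\<in>?S - B. c b)" "(\<Sum>b\<in>?S - B. c b) \<le> E2"
    proof -
      show "0 \<le> (\<Sum>b\<in>?S - B. c b)" by (intro sum_nonneg) (auto simp: c_def)
      have "(\<Sum>b\<in>?S - B. c b) \<le> (\<Sum>b\<in>?S - B. real (A + J))" by (intro sum_mono csmall) auto
      also have "\<dots> = card (?S - B) * real (A + J)" by simp
      also have "\<dots> \<le> m * real (A + J)"
        using cardS card_mono[OF finS, of "?S - B"] by (intro mult_right_mono) auto
      finally show "(\<Sum>b\<in>?S - B. c b) \<le> E2" using mE2 by simp
    qed
    have Y3: "\<bar>q * Y - p\<bar> \<le> m * E2"
    proof -
      have "\<bar>q * Y - p\<bar> \<le> q * (k + E)" using prime_case[OF q] by (simp add: Y_def)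
      also have "\<dots> \<le> m * E2" using q1 mE2 E0 by (intro mult_mono) auto
      finally show ?thesis .
    qed
    have mm: "real q * (m * E2) \<le> real m ^ 2 * E2" "real n * (m * E2) \<le> real m ^ 2 * E2" "real q * (real n * E2) \<le> real m ^ 2 * E2"
    proof -
      have E20: "E2 \<ge> 0" using mE2(2) E0 of_nat_0_le_iff[of k] by linarith
      have "real q * (m * E2) \<le> real m * (m * E2)" "real n * (m * E2) \<le> real m * (m * E2)"
        using q1 nm E20 by (auto intro!: mult_right_mono)
      moreover have "real q * (real n * E2) \<le> real m * (real m * E2)"
        using q1 nm E20 by (intro mult_mono mult_right_mono) auto
      ultimately show "real q * (m * E2) \<le> real m ^ 2 * E2" "real n * (m * E2) \<le> real m ^ 2 * E2"
        "real q * (real n * E2) \<le> real m ^ 2 * E2"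
        by (simp_all add: power2_eq_square mult.assoc)
    qed
    \<comment> \<open>An exact identity that isolates the integer \<open>q * r - n\<close>; its
      three terms are controlled by \<open>Y3\<close>, \<open>Y1\<close> and
      \<open>Y2\<close>.\<close>
    have "(real q * r - n) * p = n * (q * Y - p) - q * (n * (\<Sum>b\<in>B \<inter> ?S. c b) - r * p) - q * (n * (\<Sum>b\<in>?S - B. c b))"
      unfolding Y by (simp add: algebra_simps)
    also have "\<bar>\<dots>\<bar> \<le> n * (m * E2) + q * (m * E2) + q * (n * E2)"
    proof -
      have "\<bar>n * (q * Y - p)\<bar> \<le> n * (m * E2)" using Y3 by (simp add: abs_mult mult_left_mono)
      moreover have "\<bar>q * (n * (\<Sum>b\<in>B \<inter> ?S. c b) - r * p)\<bar> \<le> q * (m * E2)"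
        using Y1 unfolding abs_mult by (intro mult_mono) auto
      moreover have "\<bar>q * (n * (\<Sum>b\<in>?S - B. c b))\<bar> \<le> q * (n * E2)"
        using Y2 by (simp add: abs_mult mult_left_mono)
      ultimately show ?thesis by linarith
    qed
    also have "\<dots> < p" using mm small by linarith
    finally have "\<bar>real q * r - n\<bar> < 1" using p_gt_1 by (simp add: abs_mult)
    then have "real_of_int \<bar>int q * int r - int n\<bar> < real_of_int 1" by simp
    then have "\<bar>int q * int r - int n\<bar> < 1" by (simp only: of_int_less_iff)
    then have "int n = int q * int r" by linarith
    then have "int n = int (q * r)" by simp
    then have "n = q * r" by (simp only: of_nat_eq_iff)
    then show "q dvd n" by simp
  qed
  then have "m dvd n" by (rule squarefree_dvdI[OF m])
  then have "n = m" using nm n1 by (simp add: dvd_imp_le le_antisym)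
  then have "B = {..<m}" using BI by (intro card_subset_eq) (auto simp: n_def)
  then show ?thesis using inB[of a] a \<open>n = m\<close> by (simp add: c_def)
qed

end

section \<open>Correlations by Fourier inversion\<close>

definition unity_root :: "nat \<Rightarrow> complex" where
  "unity_root m = cis (2 * pi / real m)"

lemma norm_unity_root [simp]: "norm (unity_root m) = 1"
  by (simp add: unity_root_def)

lemma unity_root_nonzero [simp]: "unity_root m \<noteq> 0"
  by (simp add: unity_root_def)

lemma unity_root_power_self: "m > 0 \<Longrightarrow> unity_root m ^ m = 1"
  by (simp add: unity_root_def DeMoivre)

lemma unity_root_power_mod: "m > 0 \<Longrightarrow> unity_root m ^ (n mod m) = unity_root m ^ n"
  by (metis div_mult_mod_eq mult_1 power_add power_mult power_one unity_root_power_self mult.commute)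

lemma unity_root_power_eq_iff:
  assumes "m > 0"
  shows "unity_root m ^ i = unity_root m ^ j \<longleftrightarrow> i mod m = j mod m"
proof
  assume "unity_root m ^ i = unity_root m ^ j"
  then have "unity_root m ^ (i mod m) = unity_root m ^ (j mod m)"
    using assms by (simp add: unity_root_power_mod)
  moreover have "unity_root m ^ n = cis (2 * pi * real n / real m)" for n
    by (simp add: unity_root_def DeMoivre mult_ac)
  ultimately show "i mod m = j mod m"
    using bij_betw_imp_inj_on[OF bij_betw_roots_unity[OF assms]] assms
    by (auto simp: inj_on_def)
qed (metis assms unity_root_power_mod)

lemma unity_root_mult: "d > 0 \<Longrightarrow> g > 0 \<Longrightarrow> unity_root (d * g) ^ g = unity_root d"
  by (simp add: unity_root_def DeMoivre)

lemma sum_unity_root_powers: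
  assumes "m > 0"
  shows "(\<Sum>s<m. (unity_root m ^ i * inverse (unity_root m ^ j)) ^ s) =
    (if i mod m = j mod m then of_nat m else 0)"
proof (cases "i mod m = j mod m")
  case True
  then have "unity_root m ^ i = unity_root m ^ j" by (simp add: unity_root_power_eq_iff[OF assms])
  then show ?thesis using True by simp
next
  case False
  let ?z = "unity_root m ^ i * inverse (unity_root m ^ j)"
  have "?z \<noteq> 1"
    using False unity_root_power_eq_iff[OF assms, of i j] by (simp add: field_simps)
  moreover have "?z ^ m = (unity_root m ^ m) ^ i * inverse ((unity_root m ^ m) ^ j)"
    by (simp add: power_mult_distrib power_inverse mult.commute flip: power_mult)
  then have "?z ^ m = 1" using assms by (simp add: unity_root_power_self)
  moreover have "(?z - 1) * (\<Sum>s<m. ?z ^ s) = ?z ^ m - 1" by (rule power_diff_1_eq[symmetric])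
  ultimately show ?thesis using False by simp
qed

context prime_root
begin

definition charsum :: "nat \<Rightarrow> int set \<Rightarrow> (int \<Rightarrow> nat) \<Rightarrow> complex" where
  "charsum d H e = (\<Sum>x\<in>goodpts H. unity_root d ^ lgsum H e x)"

lemma charsum_classes:
  assumes "m > 0"
  shows "charsum m H e = (\<Sum>a<m. of_nat (card (cls H e m a)) * unity_root m ^ a)"
proof -
  have "charsum m H e = (\<Sum>a<m. \<Sum>x\<in>{x \<in> goodpts H. lgsum H e x mod m = a}. unity_root m ^ lgsum H e x)"
    unfolding charsum_def using assms by (intro sum.group[symmetric]) auto
  also have "\<dots> = (\<Sum>a<m. \<Sum>x\<in>cls H e m a. unity_root m ^ a)"
  proof (intro sum.cong refl)
    fix a assume "a \<in> {..<m}"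
    then show "{x \<in> goodpts H. lgsum H e x mod m = a} = cls H e m a"
      by (auto simp: cls_def cong_mod_def)
    fix x assume "x \<in> cls H e m a"
    then show "unity_root m ^ lgsum H e x = unity_root m ^ a"
      using assms by (simp add: cls_def unity_root_power_eq_iff cong_mod_def)
  qed
  finally show ?thesis by simp
qed

text \<open>All classes have size \<open>p / m\<close> up to \<open>E2 / m\<close>, and the constant
  part is cancelled because the \<open>m\<close>-th roots of unity sum to 0 for
  \<open>m > 1\<close>.\<close>

lemma charsum_bound_ramified:
  fixes E E2 :: real
  assumes R: "R * m = p - 1" and m: "squarefree m" "m > 1"
    and H: "finite H" "card H = k" "k \<ge> 1" "\<And>h. h \<in> H \<Longrightarrow> e h \<le> d0"
    and H': "\<And>h h'. h \<in> H \<Longrightarrow> h' \<in> H \<Longrightarrow> [h = h'] (mod int p) \<Longrightarrow> h = h'"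
    and ram: "\<And>q. prime q \<Longrightarrow> q dvd m \<Longrightarrow> \<exists>h\<in>H. \<not> q dvd e h"
    and J: "J \<ge> 2" "(J - 1) * m \<le> p" and A: "(k + 1) * J ^ 2 * m \<le> A" "A + J \<le> R"
    and E: "E = (A + p + p * k * d0) / (J - 1)" and E2: "real m * (real k + real m * (real A + real J) + E) \<le> E2"
    and small: "3 * real m ^ 2 * E2 < p"
  shows "norm (charsum m H e) \<le> E2"
proof -
  have "norm (of_nat (card (cls H e m a)) - of_real (p / m) :: complex) \<le> E2 / m" if "a < m" for a
  proof -
    have "\<bar>m * real (card (cls H e m a)) - p\<bar> \<le> E2"
      by (rule equidistribution[where e = e, OF R m(1) H H' ram J A E E2 small that])
    moreover have "m * real (card (cls H e m a)) - p = m * (real (card (cls H e m a)) - p / m)"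
      using m by (simp add: field_simps)
    ultimately have "m * \<bar>real (card (cls H e m a)) - p / m\<bar> \<le> E2" by (simp add: abs_mult)
    then have "\<bar>real (card (cls H e m a)) - p / m\<bar> \<le> E2 / m" using m by (simp add: field_simps)
    then show ?thesis by (metis norm_of_real of_real_diff of_real_of_nat_eq)
  qed
  note dev = this
  have "(\<Sum>a<m. unity_root m ^ a) = 0"
    using sum_unity_root_powers[of m 1 0] m by simp
  then have "charsum m H e = (\<Sum>a<m. of_nat (card (cls H e m a)) * unity_root m ^ a) - of_real (p / m) * (\<Sum>a<m. unity_root m ^ a)"
    using m charsum_classes by simp
  also have "\<dots> = (\<Sum>a<m. (of_nat (card (cls H e m a)) - of_real (p / m)) * unity_root m ^ a)"
    by (simp only: sum_distrib_left left_diff_distrib sum_subtractf)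
  also have "norm \<dots> \<le> (\<Sum>a<m. E2 / m)"
    by (intro sum_norm_le) (use dev in \<open>simp add: norm_mult norm_power del: of_real_divide\<close>)
  also have "\<dots> = E2" using m by simp
  finally show ?thesis .
qed

text \<open>The common factor \<open>G\<close> of \<open>d\<close> and the exponents is divided out.
  The new modulus \<open>m\<close> exceeds 1 because some \<open>e h\<close> lies strictly between 0
  and \<open>d\<close>, and no prime factor of \<open>m\<close> divides all new exponents: this is
  the ramification needed by \<open>charsum_bound_ramified\<close>.\<close>

lemma charsum_bound:
  fixes E E2 :: real
  assumes R: "R * d = p - 1" and d: "squarefree d"
    and H: "finite H" "card H = k" "k \<ge> 1" "\<And>h. h \<in> H \<Longrightarrow> e h < d" "\<exists>h\<in>H. e h \<noteq> 0"
    and H': "\<And>h h'. h \<in> H \<Longrightarrow> h' \<in> H \<Longrightarrow> [h = h'] (mod int p) \<Longrightarrow> h = h'"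
    and J: "J \<ge> 2" "(J - 1) * d \<le> p" and A: "A = (k + 1) * J ^ 2 * d" "A + J \<le> R"
    and E: "E = (A + p + p * k * d) / (J - 1)" and E2: "E2 = real d * (real k + real d * (real A + real J) + E)"
    and small: "3 * real d ^ 2 * E2 < p"
  shows "norm (charsum d H e) \<le> E2"
proof -
  have d0: "d > 0" using d by (metis gr0I not_squarefree_0)
  define G where "G = gcd d (Gcd (e ` H))"
  define m where "m = d div G"
  define e' where "e' h = e h div G" for h
  have G0: "G > 0" using d0 by (simp add: G_def)
  have Gd: "G dvd d" "\<And>h. h \<in> H \<Longrightarrow> G dvd e h" unfolding G_def by (auto intro: dvd_trans)
  have dm: "d = m * G" using Gd by (simp add: m_def)
  have ee: "e h = G * e' h" if "h \<in> H" for h using Gd(2)[OF that] by (simp add: e'_def)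
  have m1: "m > 1"
  proof (rule ccontr)
    assume "\<not> m > 1"
    then have "G = d" using dm d0 by (cases "m = 0") (simp_all add: not_less)
    moreover obtain h where h: "h \<in> H" "e h \<noteq> 0" using H by blast
    ultimately have "d \<le> e h" using Gd(2)[of h] by (auto intro: dvd_imp_le)
    then show False using H(4)[OF h(1)] by simp
  qed
  have md: "m \<le> d" using dm G0 by simp
  have charsum: "charsum d H e = charsum m H e'"
  proof -
    have "lgsum H e x = G * lgsum H e' x" for x
      unfolding lgsum_def sum_distrib_left by (intro sum.cong refl) (simp add: ee)
    then show ?thesis
      unfolding charsum_def dm using m1 G0 by (simp add: power_mult unity_root_mult)
  qed
  have E0: "E \<ge> 0" unfolding E using J by (intro divide_nonneg_nonneg) auto
  have E20: "E2 \<ge> 0" unfolding E2 using E0 by simp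
  have "norm (charsum m H e') \<le> E2"
  proof (rule charsum_bound_ramified[where J = J and ?d0.0 = d and H = H and e = e' and k = k and A = A and E = E])
    show "real m * (real k + real m * (real A + real J) + E) \<le> E2"
      unfolding E2 using md E0 by (intro mult_mono add_mono) auto
    show "(k + 1) * J ^ 2 * m \<le> A" unfolding A using md by simp
    show "R * G * m = p - 1" using R dm by (simp add: mult_ac)
    show "squarefree m" using d dm by (metis dvd_triv_left squarefree_mono)
    show "(J - 1) * m \<le> p"
    proof -
      have "(J - 1) * m \<le> (J - 1) * d" using md by (intro mult_le_mono) auto
      then show ?thesis using J(2) by (rule order_trans)
    qed
    show "A + J \<le> R * G"
    proof -
      have "R * 1 \<le> R * G" using G0 by (intro mult_le_mono) auto
      then show ?thesis using A(2) by linarith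
    qed
    show "e' h \<le> d" if "h \<in> H" for h
      using H(4)[OF that] unfolding e'_def by (meson div_le_dividend le_trans less_imp_le)
    show "\<exists>h\<in>H. \<not> q dvd e' h" if q: "prime q" "q dvd m" for q
    proof (rule ccontr)
      assume "\<not> (\<exists>h\<in>H. \<not> q dvd e' h)"
      then have "G * q dvd e h" if "h \<in> H" for h using that ee by auto
      then have "G * q dvd Gcd (e ` H)" by (auto intro: Gcd_greatest)
      moreover have "G * q dvd d" using dm q by (simp add: mult.commute)
      ultimately have "G * q dvd G" unfolding G_def by (simp add: gcd_greatest_iff)
      then have "G * q \<le> G * 1" using G0 by (auto dest: dvd_imp_le)
      then show False using G0 prime_gt_1_nat[OF q(1)] by simp
    qed
    have "3 * real m ^ 2 * E2 \<le> 3 * real d ^ 2 * E2"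
      using md E20 by (intro mult_right_mono mult_left_mono power_mono) auto
    then show "3 * real m ^ 2 * E2 < p" using small by linarith
  qed (use H H' m1 J E in auto)
  then show ?thesis using charsum by simp
qed

text \<open>Fourier expansion modulo \<open>d\<close> of the indicator of being coprime to
  \<open>d\<close>. The coefficient at 0 is \<open>totient d / d\<close> and yields the main term;
  all coefficients are bounded by 1, and each of at most \<open>d ^ k\<close> nonzero tuples of
  frequencies costs \<open>E2\<close>. The summand \<open>k\<close> accounts for the points missing
  from \<open>goodpts H\<close>.\<close>

lemma correlation:
  fixes E E2 :: real
  assumes R: "R * d = p - 1" and d: "squarefree d"
    and H: "finite H" "card H = k" "k \<ge> 1"
    and H': "\<And>h h'. h \<in> H \<Longrightarrow> h' \<in> H \<Longrightarrow> [h = h'] (mod int p) \<Longrightarrow> h = h'"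
    and J: "J \<ge> 2" "(J - 1) * d \<le> p" and A: "A = (k + 1) * J ^ 2 * d" "A + J \<le> R"
    and E: "E = (A + p + p * k * d) / (J - 1)" and E2: "E2 = real d * (real k + real d * (real A + real J) + E)"
    and small: "3 * real d ^ 2 * E2 < p"
  shows "\<bar>real (card {x\<in>goodpts H. \<forall>h\<in>H. coprime (dlog (x + h)) d}) - (totient d / d) ^ k * p\<bar>
      \<le> real d ^ k * E2 + k"
proof -
  let ?t = "(totient d / d) ^ k"
  let ?g = "real (card (goodpts H))"
  have d0: "d > 0" using d by (metis gr0I not_squarefree_0)
  define u :: "nat \<Rightarrow> complex" where "u n = (if coprime n d then 1 else 0)" for n
  define w where "w = unity_root d"
  define c where "c j = (\<Sum>n<d. u n * inverse (w ^ n) ^ j) / of_nat d" for j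
  have u_mod: "u (n mod d) = u n" for n unfolding u_def by (simp add: coprime_mod_left_iff d0)
  have inversion: "u n = (\<Sum>j<d. c j * w ^ (j * n))" for n
  proof -
    have "(\<Sum>j<d. c j * w ^ (j * n)) = (\<Sum>j<d. \<Sum>n'<d. u n' * (w ^ n * inverse (w ^ n')) ^ j / of_nat d)"
      unfolding c_def sum_divide_distrib sum_distrib_right
      by (intro sum.cong refl) (simp add: power_mult_distrib mult.commute[of _ n] power_mult)
    also have "\<dots> = (\<Sum>n'<d. u n' * (\<Sum>j<d. (w ^ n * inverse (w ^ n')) ^ j) / of_nat d)"
      by (subst sum.swap) (simp add: sum_distrib_left sum_divide_distrib)
    also have "\<dots> = (\<Sum>n'<d. if n mod d = n' then u n' else 0)"
      unfolding w_def using d0 by (intro sum.cong refl) (auto simp: sum_unity_root_powers)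
    also have "\<dots> = u n" using d0 by (simp add: sum.delta' u_mod)
    finally show ?thesis ..
  qed
  have norm_c: "norm (c j) \<le> 1" for j
  proof -
    have "norm (\<Sum>n<d. u n * inverse (w ^ n) ^ j) \<le> (\<Sum>n<d. 1)"
      by (intro sum_norm_le) (simp add: norm_mult norm_power norm_inverse u_def w_def)
    then show ?thesis using d0 by (simp add: c_def norm_divide)
  qed
  have c0: "c 0 = of_real (totient d / d)"
  proof -
    have "(\<Sum>n<d. u n) = of_nat (card {n\<in>{..<d}. coprime n d})"
      unfolding u_def by (subst sum.inter_filter[symmetric]) auto
    \<comment> \<open>\<open>totatives 1\<close> is \<open>{1}\<close>, whereas the residue below 1
      is 0; this is why \<open>d = 1\<close> is separated.\<close>
    also have "{n\<in>{..<d}. coprime n d} = (if d = 1 then {0} else totatives d)"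
      using d0 by (auto simp: totatives_def intro!: Nat.gr0I)
         (metis One_nat_def coprime_self le_neq_implies_less nat_dvd_1_iff_1)
    finally show ?thesis by (cases "d = 1") (simp_all add: c_def totient_def)
  qed
  let ?S = "{x\<in>goodpts H. \<forall>h\<in>H. coprime (dlog (x + h)) d}"
  let ?P = "PiE H (\<lambda>_. {..<d})"
  let ?z = "\<lambda>h\<in>H. 0 :: nat"
  let ?err = "(\<Sum>e\<in>?P - {?z}. (\<Prod>h\<in>H. c (e h)) * charsum d H e)"
  have "of_nat (card ?S) = (\<Sum>x\<in>goodpts H. \<Prod>h\<in>H. u (dlog (x + h)))"
  proof -
    have "(\<Prod>h\<in>H. u (dlog (x + h))) = (if \<forall>h\<in>H. coprime (dlog (x + h)) d then 1 else 0)" for x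
      unfolding u_def using H(1) by (auto simp: prod_zero_iff)
    then show ?thesis by (simp add: sum.inter_filter[symmetric])
  qed
  also have "\<dots> = (\<Sum>x\<in>goodpts H. \<Sum>e\<in>?P. \<Prod>h\<in>H. c (e h) * w ^ (e h * dlog (x + h)))"
    unfolding inversion by (intro sum.cong refl prod_sum_PiE H) auto
  also have "\<dots> = (\<Sum>e\<in>?P. (\<Prod>h\<in>H. c (e h)) * charsum d H e)"
    unfolding charsum_def lgsum_def w_def
    by (subst sum.swap) (simp add: prod.distrib power_sum sum_distrib_left)
  also have "\<dots> = (\<Prod>h\<in>H. c (?z h)) * charsum d H ?z + ?err"
    using d0 H(1) by (intro sum.remove finite_PiE) auto
  also have "(\<Prod>h\<in>H. c (?z h)) = of_real (?t)"
    using H by (simp add: c0)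
  also have "charsum d H ?z = of_nat (card (goodpts H))"
    by (simp add: charsum_def lgsum_def)
  finally have main: "of_nat (card ?S) = of_real (?t) * of_nat (card (goodpts H)) +
     ?err" .
  have "norm ?err \<le> (\<Sum>e\<in>?P - {?z}. E2)"
  proof (rule sum_norm_le)
    fix e assume e: "e \<in> ?P - {?z}"
    have "norm (\<Prod>h\<in>H. c (e h)) \<le> 1"
      unfolding prod_norm[symmetric] by (intro prod_le_1) (auto simp: norm_c)
    moreover have "norm (charsum d H e) \<le> E2"
    proof (rule charsum_bound[where e = e, OF R d H _ _ H' J A E E2 small])
      show "e h < d" if "h \<in> H" for h using e that by (auto simp: PiE_iff)
      show "\<exists>h\<in>H. e h \<noteq> 0"
      proof (rule ccontr)
        assume "\<not> (\<exists>h\<in>H. e h \<noteq> 0)"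
        then have "e = ?z" using e by (intro PiE_ext[of e H _ ?z]) (auto simp: d0)
        then show False using e by simp
      qed
    qed
    ultimately show "norm ((\<Prod>h\<in>H. c (e h)) * charsum d H e) \<le> E2"
      unfolding norm_mult using mult_mono[of "norm (\<Prod>h\<in>H. c (e h))" 1 "norm (charsum d H e)" E2] by simp
  qed
  also have "\<dots> = card (?P - {?z}) * E2" by simp
  also have "\<dots> \<le> real d ^ k * E2"
  proof (rule mult_right_mono)
    have "card (?P - {?z}) \<le> card ?P" using H by (intro card_mono finite_PiE) auto
    also have "card ?P = d ^ k" using H by (simp add: card_PiE)
    finally show "real (card (?P - {?z})) \<le> real d ^ k" by (metis of_nat_le_iff of_nat_power)
    show "E2 \<ge> 0" unfolding E2 E using J by (intro mult_nonneg_nonneg add_nonneg_nonneg divide_nonneg_nonneg) auto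
  qed
  finally have err: "norm ?err \<le> real d ^ k * E2" .
  have "complex_of_real (real (card ?S) - ?t * ?g) =
      ?err"
    using main by simp
  then have "norm (complex_of_real (real (card ?S) - ?t * ?g)) \<le> real d ^ k * E2"
    using err by (simp only:)
  then have "\<bar>real (card ?S) - ?t * ?g\<bar> \<le> real d ^ k * E2"
    unfolding norm_of_real .
  moreover have "\<bar>?t * ?g - ?t * p\<bar> \<le> k"
  proof -
    have t1: "0 \<le> (totient d / d :: real) ^ k" "(totient d / d :: real) ^ k \<le> 1"
      using d0 totient_le[of d] by (auto intro!: power_le_one)
    have "\<bar>?t * ?g - ?t * p\<bar>
        = ?t * \<bar>?g - p\<bar>"
      using t1 by (simp add: abs_mult flip: right_diff_distrib)
    also have "\<dots> \<le> 1 * \<bar>?g - p\<bar>" using t1 by (intro mult_right_mono) auto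
    also have "\<dots> \<le> k" using card_goodpts[OF H(1,2)] by simp
    finally show ?thesis .
  qed
  ultimately show ?thesis by linarith
qed

end

section \<open>Bookkeeping in powers of y\<close>

lemma mult_le_powers: "a * b \<le> y ^ n" if "a \<le> y ^ i" "b \<le> y ^ j" "i + j \<le> n" "0 \<le> b" "1 \<le> y"
  for a b y :: real
proof -
  have "a * b \<le> y ^ i * y ^ j" using that by (intro mult_mono) auto
  also have "\<dots> \<le> y ^ n" using that by (simp add: power_increasing flip: power_add)
  finally show ?thesis .
qed

lemma add_le_powers: "a + b \<le> y ^ n" if "a \<le> y ^ i" "b \<le> y ^ i" "i < n" "2 \<le> y"
  for a b y :: real
proof -
  have "a + b \<le> 2 * y ^ i" using that by simp
  also have "\<dots> \<le> y * y ^ i" using that by (intro mult_right_mono) auto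
  also have "\<dots> = y ^ Suc i" by simp
  also have "\<dots> \<le> y ^ n" using that by (intro power_increasing) auto
  finally show ?thesis .
qed

lemma le_power_mono: "a \<le> y ^ n" if "a \<le> y ^ i" "i \<le> n" "1 \<le> y" for a y :: real
  using that power_increasing[of i n y] by linarith

context prime_root
begin

text \<open>With \<open>J\<close> about \<open>y ^ 80\<close> the term \<open>p * k * d / J\<close>
  in \<open>E\<close> stays below \<open>y ^ 328\<close>, while
  \<open>A = (k + 1) * J ^ 2 * d\<close> stays below \<open>y ^ 168\<close> and so well below
  \<open>p / d\<close>. The factors \<open>d\<close> in \<open>E2\<close> and
  \<open>d ^ k <= y ^ 20\<close> in \<open>correlation\<close> still leave a saving of a fixed power
  of \<open>p\<close>.\<close>

lemma correlation_small:
  fixes y :: real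
  assumes y: "y ^ 400 = p" "y \<ge> real k + 3"
    and d: "squarefree d" "d dvd p - 1" "d \<le> y ^ 5" "real d ^ k \<le> y ^ 20"
    and H: "finite H" "card H = k" "k \<ge> 1"
    and H': "\<And>h h'. h \<in> H \<Longrightarrow> h' \<in> H \<Longrightarrow> [h = h'] (mod int p) \<Longrightarrow> h = h'"
  shows "\<bar>real (card {x\<in>goodpts H. \<forall>h\<in>H. coprime (dlog (x + h)) d}) - (totient d / d) ^ k * p\<bar> \<le> y ^ 360"
proof -
  have y3: "y \<ge> 3" "y \<ge> 2" "y \<ge> 1" "y > 1" using y(2) by auto
  have y1: "y \<le> y ^ 1" by simp
  have d0: "d > 0" using d(1) by (metis gr0I not_squarefree_0)
  obtain R where R: "R * d = p - 1" using d(2) by (metis dvd_def mult.commute)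
  define J where "J = nat \<lceil>y ^ 80\<rceil> + 1"
  have y80: "y ^ 80 \<ge> 1" "y ^ 80 \<ge> 0" using y3 by simp_all
  have J: "real J - 1 \<ge> y ^ 80" unfolding J_def using y80 by linarith
  have J81: "real J \<le> y ^ 81"
  proof -
    have "real J \<le> y ^ 80 + 2" unfolding J_def using y80 by linarith
    also have "\<dots> \<le> 3 * y ^ 80" using y80 by simp
    also have "\<dots> \<le> y * y ^ 80" using y3 by (intro mult_right_mono) auto
    also have "\<dots> = y ^ 81" by (simp flip: power_Suc)
    finally show ?thesis .
  qed
  have J2: "J \<ge> 2" using J y80 by linarith
  define A where "A = (k + 1) * J ^ 2 * d"
  define E where "E = (real A + real p + real (p * k * d)) / (real J - 1)"
  define E2 where "E2 = real d * (real k + real d * (real A + real J) + E)"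
  have A: "real A \<le> y ^ 168"
  proof -
    have "real A = (real k + 1) * (real J * real J) * real d"
      by (simp add: A_def power2_eq_square algebra_simps)
    also have "\<dots> \<le> y ^ 168"
      using y y3 d(3) J81
      by (intro mult_le_powers[of _ y 163 _ 5] mult_le_powers[of _ y 1 _ 162] mult_le_powers[of _ y 81 _ 81]) auto
    finally show ?thesis .
  qed
  have AJ: "real A + real J \<le> y ^ 169"
    using A le_power_mono[OF J81, of 168] y3 by (intro add_le_powers[of _ y 168]) auto
  have k1: "real k \<le> y ^ 1" using y by simp
  have num: "real A + real p + real (p * k * d) \<le> y ^ 408"
  proof (rule add_le_powers[of _ y 407])
    show "real A + real p \<le> y ^ 407"
    proof (rule add_le_powers[of _ y 406])
      show "real A \<le> y ^ 406" by (rule le_power_mono[OF A]) (use y3 in auto)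
      show "real p \<le> y ^ 406" unfolding y(1)[symmetric] using y3 by (intro power_increasing) auto
    qed (use y3 in auto)
    have "real (p * k * d) = y ^ 400 * real k * real d" using y by simp
    also have "\<dots> \<le> y ^ 407"
      using k1 d(3) y3 by (intro mult_le_powers[of _ y 401 _ 5] mult_le_powers[of _ y 400 _ 1]) auto
    finally show "real (p * k * d) \<le> y ^ 407" .
  qed (use y3 in auto)
  have "E \<le> y ^ 408 / y ^ 80"
    unfolding E_def using num J y80 y3 by (intro frac_le) auto
  also have "\<dots> = y ^ 328" using y3 by (simp add: field_simps flip: power_add)
  finally have E: "E \<le> y ^ 328" .
  have E0: "E \<ge> 0" unfolding E_def using J2 by (intro divide_nonneg_nonneg) auto
  have E2: "E2 \<le> y ^ 335"
  proof -
    have "real k + real d * (real A + real J) \<le> y ^ 329"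
    proof (rule add_le_powers[of _ y 328])
      show "real k \<le> y ^ 328" by (rule le_power_mono[OF k1]) (use y3 in auto)
      show "real d * (real A + real J) \<le> y ^ 328"
        using d(3) AJ y3 by (intro mult_le_powers[of _ y 5 _ 169]) auto
    qed (use y3 in auto)
    moreover have "E \<le> y ^ 329" by (rule le_power_mono[OF E]) (use y3 in auto)
    ultimately have "real k + real d * (real A + real J) + E \<le> y ^ 330"
      by (rule add_le_powers[of _ y 329]) (use y3 in auto)
    then show ?thesis
      unfolding E2_def using d(3) y3 E0 by (intro mult_le_powers[of _ y 5 _ 330]) auto
  qed
  have E20: "E2 \<ge> 0" unfolding E2_def using E0 by simp
  have Jd: "(J - 1) * d \<le> p"
  proof -
    have "(J - 1) * d \<le> J * d" by (intro mult_le_mono) auto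
    then have "real ((J - 1) * d) \<le> real (J * d)" by (simp only: of_nat_le_iff)
    also have "real (J * d) = real J * real d" by simp
    also have "\<dots> \<le> y ^ 400" using J81 d(3) y3 by (intro mult_le_powers[of _ y 81 _ 5]) auto
    finally have "real ((J - 1) * d) \<le> real p" using y by simp
    then show ?thesis by (simp only: of_nat_le_iff)
  qed
  have AR: "A + J \<le> R"
  proof (rule ccontr)
    assume "\<not> A + J \<le> R"
    then have "real R \<le> y ^ 169" using AJ by linarith
    then have "real R * real d \<le> y ^ 174" using d(3) y3 by (intro mult_le_powers[of _ y 169 _ 5]) auto
    moreover have "real R * real d = real p - 1" using R p_gt_1 by (simp flip: of_nat_mult add: of_nat_diff)
    ultimately have "real p \<le> y ^ 174 + 1" by simp
    also have "\<dots> \<le> y ^ 175" using y3 by (intro add_le_powers[of _ y 174]) auto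
    also have "\<dots> < y ^ 400" using y3 by (intro power_strict_increasing) auto
    finally show False using y by simp
  qed
  have small: "3 * real d ^ 2 * E2 < p"
  proof -
    have "3 * (real d * real d) * E2 \<le> y ^ 346"
      using y3 d(3) E2 E20
      by (intro mult_le_powers[of _ y 11 _ 335] mult_le_powers[of _ y 1 _ 10] mult_le_powers[of _ y 5 _ 5]) auto
    also have "\<dots> < y ^ 400" using y3 by (intro power_strict_increasing) auto
    finally show ?thesis using y by (simp add: power2_eq_square)
  qed
  have "\<bar>real (card {x\<in>goodpts H. \<forall>h\<in>H. coprime (dlog (x + h)) d}) - (totient d / d) ^ k * p\<bar> \<le> real d ^ k * E2 + k"
    by (rule correlation[OF R d(1) H H' J2 Jd A_def AR _ E2_def small]) (auto simp: E_def)
  also have "\<dots> \<le> y ^ 360"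
  proof (rule add_le_powers[of _ y 355])
    show "real d ^ k * E2 \<le> y ^ 355" using d(4) E2 E20 y3 by (intro mult_le_powers[of _ y 20 _ 335]) auto
    show "real k \<le> y ^ 355" by (rule le_power_mono[OF k1]) (use y3 in auto)
  qed (use y3 in auto)
  finally show ?thesis .
qed

end

section \<open>Comparison with independent trials\<close>

text \<open>The correlation function of a weighted family of sets; summed over all \<open>T\<close>
  of size \<open>r\<close> it gives the weighted \<open>r\<close>-th binomial moment of the
  \<open>card (Y i)\<close>.\<close>

definition upcount :: "'i set \<Rightarrow> ('i \<Rightarrow> real) \<Rightarrow> ('i \<Rightarrow> 'a set) \<Rightarrow> 'a set \<Rightarrow> real" where
  "upcount I w Y T = (\<Sum>i\<in>I. w i * of_bool (T \<subseteq> Y i))"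

lemma sum_small_subsets:
  assumes "finite S"
  shows "(\<Sum>T\<in>{T. T \<subseteq> S \<and> card T < r}. (2::real) ^ card T) = (\<Sum>j<r. real (card S choose j) * 2 ^ j)"
proof -
  have fin: "finite {T. T \<subseteq> S \<and> card T < r}" using assms by auto
  have "(\<Sum>T\<in>{T. T \<subseteq> S \<and> card T < r}. (2::real) ^ card T) =
     (\<Sum>j<r. \<Sum>T\<in>{T\<in>{T. T \<subseteq> S \<and> card T < r}. card T = j}. 2 ^ card T)"
    using fin by (intro sum.group[symmetric]) auto
  also have "\<dots> = (\<Sum>j<r. \<Sum>T\<in>{T. T \<subseteq> S \<and> card T = j}. 2 ^ j)"
    by (intro sum.cong) auto
  also have "\<dots> = (\<Sum>j<r. real (card S choose j) * 2 ^ j)"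
    using n_subsets[OF assms] by simp
  finally show ?thesis .
qed

text \<open>A function on subsets is its full Moebius expansion; truncating the expansion at sets of
  size less than \<open>r\<close> only matters on sets with at least \<open>r\<close> elements.\<close>

lemma truncated_expansion:
  fixes f :: "'a set \<Rightarrow> real"
  assumes f: "\<And>S. \<bar>f S\<bar> \<le> 1" and r: "r \<ge> 1"
  obtains \<mu> where "\<And>T. finite T \<Longrightarrow> \<bar>\<mu> T\<bar> \<le> 2 ^ card T"
    "\<And>S. finite S \<Longrightarrow> \<bar>f S - (\<Sum>T\<in>{T. T \<subseteq> S \<and> card T < r}. \<mu> T)\<bar> \<le> 4 ^ r * real (card S choose r)"
proof -
  define g where "g S = (\<Sum>T\<in>Pow S. (-1) ^ card T * f T)" for S
  define \<mu> where "\<mu> S = (-1) ^ card S * g S" for S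
  have bound: "\<bar>\<mu> T\<bar> \<le> 2 ^ card T" if "finite T" for T
  proof -
    have "\<bar>g T\<bar> \<le> (\<Sum>T\<in>Pow T. 1)"
      unfolding g_def by (intro order_trans[OF sum_abs] sum_mono) (simp add: abs_mult power_abs f)
    then show ?thesis using that by (simp add: \<mu>_def abs_mult power_abs card_Pow)
  qed
  have inv: "f S = (\<Sum>T\<in>Pow S. \<mu> T)" if "finite S" for S
    unfolding \<mu>_def by (rule inclusion_exclusion_symmetric[OF _ that]) (simp add: g_def)
  have "\<bar>f S - (\<Sum>T\<in>{T. T \<subseteq> S \<and> card T < r}. \<mu> T)\<bar> \<le> 4 ^ r * real (card S choose r)" if S: "finite S" for S
  proof (cases "card S < r")
    case True
    have "T \<subseteq> S \<Longrightarrow> card T < r" for T using card_mono[OF S, of T] True by linarith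
    then have "{T. T \<subseteq> S \<and> card T < r} = Pow S" by auto
    then show ?thesis using inv[OF S] by simp
  next
    case False
    have "\<bar>\<Sum>T\<in>{T. T \<subseteq> S \<and> card T < r}. \<mu> T\<bar> \<le> (\<Sum>T\<in>{T. T \<subseteq> S \<and> card T < r}. 2 ^ card T)"
      using S by (intro order_trans[OF sum_abs] sum_mono bound) (auto dest: finite_subset)
    also have "\<dots> = (\<Sum>j<r. real (card S choose j) * 2 ^ j)" by (rule sum_small_subsets[OF S])
    \<comment> \<open>With \<open>s = card S\<close>, the identity \<open>(s choose j) * (s - j
      choose (r - j)) = (s choose r) * (r choose j)\<close> trades each lower binomial for the one
      at \<open>r\<close>. What remains is at most \<open>3 ^ r\<close>, and
      \<open>1 + 3 ^ r <= 4 ^ r\<close> absorbs \<open>f S\<close> itself.\<close>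
    also have "\<dots> \<le> (\<Sum>j<r. real (card S choose r) * (real (r choose j) * 2 ^ j))"
    proof (rule sum_mono)
      fix j assume j: "j \<in> {..<r}"
      have "(card S choose j) * 1 \<le> (card S choose j) * (card S - j choose (r - j))"
        using j False by (intro mult_le_mono) (auto simp: Suc_le_eq zero_less_binomial_iff)
      also have "\<dots> = (card S choose r) * (r choose j)"
        using choose_mult[of j r "card S"] j False by simp
      finally have "real (card S choose j) \<le> real (card S choose r) * real (r choose j)"
        by (simp flip: of_nat_mult)
      then show "real (card S choose j) * 2 ^ j \<le> real (card S choose r) * (real (r choose j) * 2 ^ j)"
        by (simp flip: mult.assoc)
    qed
    also have "\<dots> = real (card S choose r) * (\<Sum>j<r. real (r choose j) * 2 ^ j)"
      by (simp add: sum_distrib_left)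
    also have "\<dots> \<le> real (card S choose r) * 3 ^ r"
    proof (rule mult_left_mono)
      have "(\<Sum>j<r. real (r choose j) * 2 ^ j) \<le> (\<Sum>j\<le>r. real (r choose j) * 2 ^ j)"
        by (intro sum_mono2) auto
      also have "\<dots> = (2 + 1) ^ r" by (subst binomial_ring) simp
      finally show "(\<Sum>j<r. real (r choose j) * 2 ^ j) \<le> 3 ^ r" by simp
    qed simp
    finally have F: "\<bar>\<Sum>T\<in>{T. T \<subseteq> S \<and> card T < r}. \<mu> T\<bar> \<le> real (card S choose r) * 3 ^ r" .
    have c1: "1 \<le> real (card S choose r)"
      using False by (simp add: Suc_le_eq zero_less_binomial_iff)
    have "(1::real) + 3 ^ r \<le> 4 ^ r"
    proof -
      have "(3::real) ^ r + 1 \<le> 3 ^ r + (\<Sum>i<r. 3 ^ (r - Suc i) * 4 ^ i)"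
      proof -
        have "(1::real) \<le> 3 ^ (r - Suc 0) * 4 ^ 0" by simp
        also have "\<dots> \<le> (\<Sum>i<r. 3 ^ (r - Suc i) * 4 ^ i)"
          using r by (intro member_le_sum[of 0]) auto
        finally show ?thesis by simp
      qed
      also have "\<dots> = 4 ^ r" using power_diff_sumr2[of "4::real" r 3] by simp
      finally show ?thesis by simp
    qed
    then have "real (card S choose r) * (1 + 3 ^ r) \<le> real (card S choose r) * 4 ^ r"
      by (intro mult_left_mono) auto
    moreover have "\<bar>f S\<bar> \<le> 1" by (rule f)
    ultimately show ?thesis using F c1 by (simp add: algebra_simps abs_le_iff)
  qed
  with bound show ?thesis by (rule that)
qed

text \<open>Averaging the pointwise error turns \<open>card (Y i) choose r\<close> into the sum of
  the correlations over all sets of size \<open>r\<close>.\<close>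

lemma sum_truncation:
  fixes f :: "'a set \<Rightarrow> real" and V :: "'a set"
  defines "L r \<equiv> {T. T \<subseteq> V \<and> card T < r}" and "R r \<equiv> {T. T \<subseteq> V \<and> card T = r}"
  assumes V: "finite V"
    and \<mu>: "\<And>S. finite S \<Longrightarrow> \<bar>f S - (\<Sum>T\<in>{T. T \<subseteq> S \<and> card T < r}. \<mu> T)\<bar> \<le> 4 ^ r * real (card S choose r)"
    and I: "finite I" "\<And>i. i \<in> I \<Longrightarrow> w i \<ge> 0" "\<And>i. i \<in> I \<Longrightarrow> Y i \<subseteq> V"
  shows "\<bar>(\<Sum>i\<in>I. w i * f (Y i)) - (\<Sum>T\<in>L r. \<mu> T * upcount I w Y T)\<bar> \<le> 4 ^ r * (\<Sum>T\<in>R r. upcount I w Y T)"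
proof -
  let ?L = "{T. T \<subseteq> V \<and> card T < r}" and ?R = "{T. T \<subseteq> V \<and> card T = r}"
  have fin: "finite ?L" "finite ?R" using V by auto
  have "(\<Sum>T\<in>?L. \<mu> T * upcount I w Y T) = (\<Sum>i\<in>I. w i * (\<Sum>T\<in>?L. \<mu> T * of_bool (T \<subseteq> Y i)))"
    unfolding upcount_def sum_distrib_left by (subst sum.swap) (simp add: mult_ac)
  also have "\<dots> = (\<Sum>i\<in>I. w i * (\<Sum>T\<in>{T. T \<subseteq> Y i \<and> card T < r}. \<mu> T))"
  proof (rule sum.cong[OF refl])
    fix i assume "i \<in> I"
    then have "{T \<in> ?L. T \<subseteq> Y i} = {T. T \<subseteq> Y i \<and> card T < r}" using I(3) by blast
    then have "(\<Sum>T\<in>?L. \<mu> T * of_bool (T \<subseteq> Y i)) = (\<Sum>T\<in>{T. T \<subseteq> Y i \<and> card T < r}. \<mu> T)"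
      using sum.inter_filter[OF fin(1), of \<mu> "\<lambda>T. T \<subseteq> Y i"]
      by (simp add: of_bool_def if_distrib cong: if_cong)
    then show "w i * (\<Sum>T\<in>?L. \<mu> T * of_bool (T \<subseteq> Y i)) = w i * (\<Sum>T\<in>{T. T \<subseteq> Y i \<and> card T < r}. \<mu> T)"
      by simp
  qed
  finally have "(\<Sum>i\<in>I. w i * f (Y i)) - (\<Sum>T\<in>?L. \<mu> T * upcount I w Y T) =
     (\<Sum>i\<in>I. w i * (f (Y i) - (\<Sum>T\<in>{T. T \<subseteq> Y i \<and> card T < r}. \<mu> T)))"
    by (simp add: right_diff_distrib sum_subtractf)
  also have "\<bar>\<dots>\<bar> \<le> (\<Sum>i\<in>I. w i * (4 ^ r * real (card (Y i) choose r)))"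
  proof (intro order_trans[OF sum_abs] sum_mono)
    fix i assume i: "i \<in> I"
    then have "finite (Y i)" using I(3) V finite_subset by blast
    then show "\<bar>w i * (f (Y i) - (\<Sum>T\<in>{T. T \<subseteq> Y i \<and> card T < r}. \<mu> T))\<bar>
        \<le> w i * (4 ^ r * real (card (Y i) choose r))"
      using \<mu>[of "Y i"] I(2)[OF i] by (simp add: abs_mult mult_left_mono)
  qed
  also have "\<dots> = (\<Sum>i\<in>I. w i * (4 ^ r * (\<Sum>T\<in>?R. of_bool (T \<subseteq> Y i))))"
  proof (rule sum.cong[OF refl])
    fix i assume i: "i \<in> I"
    then have "finite (Y i)" "{T \<in> ?R. T \<subseteq> Y i} = {T. T \<subseteq> Y i \<and> card T = r}"
      using I(3)[OF i] V finite_subset by blast+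
    then have "real (card (Y i) choose r) = (\<Sum>T\<in>?R. of_bool (T \<subseteq> Y i))"
      using sum.inter_filter[OF fin(2), of "\<lambda>_. 1 :: real" "\<lambda>T. T \<subseteq> Y i"] n_subsets[of "Y i" r]
      by (simp add: of_bool_def)
    then show "w i * (4 ^ r * real (card (Y i) choose r)) = w i * (4 ^ r * (\<Sum>T\<in>?R. of_bool (T \<subseteq> Y i)))"
      by simp
  qed
  also have "\<dots> = 4 ^ r * (\<Sum>T\<in>?R. upcount I w Y T)"
    unfolding upcount_def sum_distrib_left by (subst (2) sum.swap) (simp add: mult_ac)
  finally show ?thesis unfolding L_def R_def .
qed

text \<open>Correlations of size below \<open>r\<close> determine the average of \<open>f\<close> up
  to the truncation error, which the correlations of size exactly \<open>r\<close> control. It will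
  be applied to the windows of smooth roots against independent trials.\<close>

lemma moment_comparison:
  fixes f :: "'a set \<Rightarrow> real"
  assumes V: "finite V" and r: "r \<ge> 1" and f: "\<And>S. \<bar>f S\<bar> \<le> 1"
    and I1: "finite I1" "\<And>i. i \<in> I1 \<Longrightarrow> w1 i \<ge> 0" "\<And>i. i \<in> I1 \<Longrightarrow> Y1 i \<subseteq> V"
    and I2: "finite I2" "\<And>i. i \<in> I2 \<Longrightarrow> w2 i \<ge> 0" "\<And>i. i \<in> I2 \<Longrightarrow> Y2 i \<subseteq> V"
    and close: "\<And>T. T \<subseteq> V \<Longrightarrow> card T < r \<Longrightarrow> \<bar>upcount I1 w1 Y1 T - upcount I2 w2 Y2 T\<bar> \<le> \<kappa>"
    and top: "\<And>T. T \<subseteq> V \<Longrightarrow> card T = r \<Longrightarrow> upcount I1 w1 Y1 T + upcount I2 w2 Y2 T \<le> \<tau>"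
  shows "\<bar>(\<Sum>i\<in>I1. w1 i * f (Y1 i)) - (\<Sum>i\<in>I2. w2 i * f (Y2 i))\<bar> \<le>
     (\<Sum>j<r. real (card V choose j) * 2 ^ j) * \<kappa> + 4 ^ r * real (card V choose r) * \<tau>"
proof -
  let ?u1 = "upcount I1 w1 Y1"
  let ?u2 = "upcount I2 w2 Y2"
  obtain \<mu> where \<mu>: "\<And>T. finite T \<Longrightarrow> \<bar>\<mu> T\<bar> \<le> 2 ^ card T"
    "\<And>S. finite S \<Longrightarrow> \<bar>f S - (\<Sum>T\<in>{T. T \<subseteq> S \<and> card T < r}. \<mu> T)\<bar> \<le> 4 ^ r * real (card S choose r)"
    using truncated_expansion[of f r] f r by blast
  let ?L = "{T. T \<subseteq> V \<and> card T < r}" and ?R = "{T. T \<subseteq> V \<and> card T = r}"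
  have fin: "finite ?L" "finite ?R" using V by auto
  have "\<bar>(\<Sum>T\<in>?L. \<mu> T * ?u1 T) - (\<Sum>T\<in>?L. \<mu> T * ?u2 T)\<bar> \<le> (\<Sum>T\<in>?L. 2 ^ card T * \<kappa>)"
    unfolding sum_subtractf[symmetric] right_diff_distrib[symmetric]
  proof (intro order_trans[OF sum_abs] sum_mono)
    fix T assume T: "T \<in> ?L"
    then have "finite T" using V finite_subset by blast
    then show "\<bar>\<mu> T * (?u1 T - ?u2 T)\<bar> \<le> 2 ^ card T * \<kappa>"
      unfolding abs_mult using T by (intro mult_mono \<mu>(1) close) auto
  qed
  also have "\<dots> = (\<Sum>j<r. real (card V choose j) * 2 ^ j) * \<kappa>"
    by (simp only: sum_small_subsets[OF V] flip: sum_distrib_right)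
  finally have mid: "\<bar>(\<Sum>T\<in>?L. \<mu> T * ?u1 T) - (\<Sum>T\<in>?L. \<mu> T * ?u2 T)\<bar> \<le>
    (\<Sum>j<r. real (card V choose j) * 2 ^ j) * \<kappa>" .
  have "(\<Sum>T\<in>?R. ?u1 T) + (\<Sum>T\<in>?R. ?u2 T) \<le> (\<Sum>T\<in>?R. \<tau>)"
    unfolding sum.distrib[symmetric] by (intro sum_mono top) auto
  also have "\<dots> = real (card V choose r) * \<tau>" using n_subsets[OF V] by simp
  finally have "4 ^ r * ((\<Sum>T\<in>?R. ?u1 T) + (\<Sum>T\<in>?R. ?u2 T)) \<le> 4 ^ r * (real (card V choose r) * \<tau>)"
    by (intro mult_left_mono) auto
  then have "4 ^ r * (\<Sum>T\<in>?R. ?u1 T) + 4 ^ r * (\<Sum>T\<in>?R. ?u2 T) \<le> 4 ^ r * real (card V choose r) * \<tau>"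
    by (simp only: distrib_left mult.assoc)
  moreover have "\<bar>(\<Sum>i\<in>I1. w1 i * f (Y1 i)) - (\<Sum>T\<in>?L. \<mu> T * ?u1 T)\<bar> \<le> 4 ^ r * (\<Sum>T\<in>?R. ?u1 T)"
    by (rule sum_truncation[OF V \<mu>(2) I1]) simp
  moreover have "\<bar>(\<Sum>i\<in>I2. w2 i * f (Y2 i)) - (\<Sum>T\<in>?L. \<mu> T * ?u2 T)\<bar> \<le> 4 ^ r * (\<Sum>T\<in>?R. ?u2 T)"
    by (rule sum_truncation[OF V \<mu>(2) I2]) simp
  ultimately show ?thesis using mid by linarith
qed

text \<open>\<open>scan v as c n h S\<close> reads the positions \<open>h, \<dots>, h + n - 1\<close> and compares the parities of the
  gaps of \<open>S\<close> with \<open>as\<close> (\<open>True\<close> meaning odd); \<open>c\<close> is the parity of the distance of \<open>h\<close> to the last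
  element read, and \<open>v\<close> is the verdict if the window ends too early.\<close>

fun scan :: "bool \<Rightarrow> bool list \<Rightarrow> bool \<Rightarrow> nat \<Rightarrow> nat \<Rightarrow> nat set \<Rightarrow> bool" where
  "scan v [] c n h S = True"
| "scan v (a # as) c 0 h S = v"
| "scan v (a # as) c (Suc n) h S =
    (if h \<in> S then a = c \<and> scan v as True n (Suc h) S else scan v (a # as) (\<not> c) n (Suc h) S)"

lemma scan_cong: "(\<And>j. j \<ge> h \<Longrightarrow> j < h + n \<Longrightarrow> j \<in> S \<longleftrightarrow> j \<in> S') \<Longrightarrow> scan v as c n h S = scan v as c n h S'"
  by (induction v as c n h S rule: scan.induct) auto

section \<open>Independent trials and the probability of a successful scan\<close>

definition bernoulli_weight :: "real \<Rightarrow> 'a set \<Rightarrow> 'a set \<Rightarrow> real" where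
  "bernoulli_weight \<theta> V S = \<theta> ^ card S * (1 - \<theta>) ^ card (V - S)"

lemma sum_bernoulli_insert:
  assumes "finite V" "x \<notin> V"
  shows "(\<Sum>S\<in>Pow (insert x V). bernoulli_weight \<theta> (insert x V) S * f S) =
    \<theta> * (\<Sum>S\<in>Pow V. bernoulli_weight \<theta> V S * f (insert x S)) +
    (1 - \<theta>) * (\<Sum>S\<in>Pow V. bernoulli_weight \<theta> V S * f S)"
proof -
  have "(\<Sum>S\<in>Pow (insert x V). bernoulli_weight \<theta> (insert x V) S * f S) =
      (\<Sum>S\<in>Pow V. bernoulli_weight \<theta> (insert x V) S * f S) +
      (\<Sum>S\<in>insert x ` Pow V. bernoulli_weight \<theta> (insert x V) S * f S)"
    unfolding Pow_insert using assms by (intro sum.union_disjoint) auto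
  also have "(\<Sum>S\<in>Pow V. bernoulli_weight \<theta> (insert x V) S * f S) =
      (1 - \<theta>) * (\<Sum>S\<in>Pow V. bernoulli_weight \<theta> V S * f S)"
    unfolding sum_distrib_left
  proof (intro sum.cong refl)
    fix S assume "S \<in> Pow V"
    then have "insert x V - S = insert x (V - S)" using assms by auto
    then show "bernoulli_weight \<theta> (insert x V) S * f S = (1 - \<theta>) * (bernoulli_weight \<theta> V S * f S)"
      using assms by (simp add: bernoulli_weight_def mult_ac)
  qed
  also have "(\<Sum>S\<in>insert x ` Pow V. bernoulli_weight \<theta> (insert x V) S * f S) =
      (\<Sum>S\<in>Pow V. bernoulli_weight \<theta> (insert x V) (insert x S) * f (insert x S))"
    using assms by (subst sum.reindex) (auto simp: inj_on_def)
  also have "\<dots> = \<theta> * (\<Sum>S\<in>Pow V. bernoulli_weight \<theta> V S * f (insert x S))"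
    unfolding sum_distrib_left
  proof (intro sum.cong refl)
    fix S assume S: "S \<in> Pow V"
    then have "insert x V - insert x S = V - S" "finite S" "x \<notin> S" using assms by (auto dest: finite_subset)
    then show "bernoulli_weight \<theta> (insert x V) (insert x S) * f (insert x S) = \<theta> * (bernoulli_weight \<theta> V S * f (insert x S))"
      by (simp add: bernoulli_weight_def mult_ac)
  qed
  finally show ?thesis by simp
qed

lemma sum_bernoulli_superset:
  assumes "finite V" "T \<subseteq> V"
  shows "(\<Sum>S\<in>Pow V. bernoulli_weight \<theta> V S * of_bool (T \<subseteq> S)) = \<theta> ^ card T"
  using assms
proof (induction V arbitrary: T rule: finite_induct)
  case empty
  then show ?case by (simp add: bernoulli_weight_def)
next
  case (insert x V)
  show ?case
  proof (cases "x \<in> T")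
    case True
    have *: "T \<subseteq> insert x S \<longleftrightarrow> T - {x} \<subseteq> S" for S by auto
    have 0: "(\<Sum>S\<in>Pow V. bernoulli_weight \<theta> V S * of_bool (T \<subseteq> S)) = 0"
      using True insert by (intro sum.neutral) auto
    have 1: "card T = Suc (card (T - {x}))"
      using True insert by (metis card_Suc_Diff1 finite_insert finite_subset)
    have 2: "(\<Sum>S\<in>Pow V. bernoulli_weight \<theta> V S * of_bool (T - {x} \<subseteq> S)) = \<theta> ^ card (T - {x})"
      using insert.prems by (intro insert.IH) auto
    show ?thesis
      unfolding sum_bernoulli_insert[OF insert(1,2)] * 0 1 2 by simp
  next
    case False
    then have *: "T \<subseteq> insert x S \<longleftrightarrow> T \<subseteq> S" for S by auto
    have 2: "(\<Sum>S\<in>Pow V. bernoulli_weight \<theta> V S * of_bool (T \<subseteq> S)) = \<theta> ^ card T"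
      using insert.prems False by (intro insert.IH) auto
    show ?thesis
      unfolding sum_bernoulli_insert[OF insert(1,2)] * 2 by (simp add: algebra_simps)
  qed
qed

definition scan_prob :: "real \<Rightarrow> bool \<Rightarrow> bool list \<Rightarrow> bool \<Rightarrow> nat \<Rightarrow> nat \<Rightarrow> real" where
  "scan_prob \<theta> v as c n h =
     (\<Sum>S\<in>Pow {h..<h + n}. bernoulli_weight \<theta> {h..<h + n} S * of_bool (scan v as c n h S))"

lemma scan_prob_Nil: "scan_prob \<theta> v [] c n h = 1"
  using sum_bernoulli_superset[of "{h..<h + n}" "{}" \<theta>] by (simp add: scan_prob_def)

lemma scan_prob_0: "scan_prob \<theta> v (a # as) c 0 h = of_bool v"
  by (simp add: scan_prob_def bernoulli_weight_def)

text \<open>Conditioning on position \<open>h\<close>: a success closes a gap of parity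
  \<open>c\<close> and restarts at distance 1, hence with \<open>True\<close>; a failure flips the
  parity.\<close>

lemma scan_prob_Suc:
  "scan_prob \<theta> v (a # as) c (Suc n) h =
     \<theta> * (of_bool (a = c) * scan_prob \<theta> v as True n (Suc h)) + (1 - \<theta>) * scan_prob \<theta> v (a # as) (\<not> c) n (Suc h)"
proof -
  let ?V = "{Suc h..<Suc h + n}"
  have V: "{h..<h + Suc n} = insert h ?V" by auto
  have 1: "scan v (a # as) c (Suc n) h (insert h S) \<longleftrightarrow> a = c \<and> scan v as True n (Suc h) S" for S
    using scan_cong[of "Suc h" n "insert h S" S v as True] by auto
  have 2: "scan v (a # as) c (Suc n) h S \<longleftrightarrow> scan v (a # as) (\<not> c) n (Suc h) S" if "S \<in> Pow ?V" for S
    using that by auto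
  have "scan_prob \<theta> v (a # as) c (Suc n) h =
     \<theta> * (\<Sum>S\<in>Pow ?V. bernoulli_weight \<theta> ?V S * of_bool (scan v (a # as) c (Suc n) h (insert h S))) +
     (1 - \<theta>) * (\<Sum>S\<in>Pow ?V. bernoulli_weight \<theta> ?V S * of_bool (scan v (a # as) c (Suc n) h S))"
    unfolding scan_prob_def V by (rule sum_bernoulli_insert) auto
  also have "(\<Sum>S\<in>Pow ?V. bernoulli_weight \<theta> ?V S * of_bool (scan v (a # as) c (Suc n) h (insert h S))) =
      of_bool (a = c) * scan_prob \<theta> v as True n (Suc h)"
    unfolding 1 scan_prob_def sum_distrib_left by (intro sum.cong) auto
  also have "(\<Sum>S\<in>Pow ?V. bernoulli_weight \<theta> ?V S * of_bool (scan v (a # as) c (Suc n) h S)) =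
      scan_prob \<theta> v (a # as) (\<not> c) n (Suc h)"
    unfolding scan_prob_def by (intro sum.cong refl) (simp only: 2)
  finally show ?thesis .
qed

text \<open>For \<open>\<theta> > 0\<close> this is the success probability in an infinite window.
  The number of failures before the next success is even with probability
  \<open>\<theta> / (1 - (1 - \<theta>)^2) = 1 / (2 - \<theta>)\<close>, and exactly then the gap in
  progress ends with the present parity \<open>c\<close>.\<close>

fun limit_prob :: "real \<Rightarrow> bool list \<Rightarrow> bool \<Rightarrow> real" where
  "limit_prob \<theta> [] c = 1"
| "limit_prob \<theta> (a # as) c = (if a = c then 1 / (2 - \<theta>) else (1 - \<theta>) / (2 - \<theta>)) * limit_prob \<theta> as True"

lemma limit_prob_bounds:
  assumes "0 \<le> \<theta>" "\<theta> \<le> 1"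
  shows "0 \<le> limit_prob \<theta> as c \<and> limit_prob \<theta> as c \<le> 1"
proof -
  have f: "0 \<le> 1 / (2 - \<theta>)" "1 / (2 - \<theta>) \<le> 1" "0 \<le> (1 - \<theta>) / (2 - \<theta>)" "(1 - \<theta>) / (2 - \<theta>) \<le> 1"
    using assms by (simp_all add: divide_le_eq)
  show ?thesis
  proof (induction as arbitrary: c)
    case (Cons a as)
    then show ?case using f by (auto intro!: mult_nonneg_nonneg mult_le_one simp del: times_divide_eq_left)
  qed simp
qed

lemma limit_prob_rec:
  assumes "0 \<le> \<theta>" "\<theta> \<le> 1"
  shows "limit_prob \<theta> (a # as) c = \<theta> * (of_bool (a = c) * limit_prob \<theta> as True) + (1 - \<theta>) * limit_prob \<theta> (a # as) (\<not> c)"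
proof -
  define t where "t = limit_prob \<theta> as True"
  define u where "u = 1 / (2 - \<theta>)"
  have "2 - \<theta> \<noteq> 0" using assms by simp
  then have u: "u * (2 - \<theta>) = 1" and "(1 - \<theta>) / (2 - \<theta>) = 1 - u"
    by (simp_all add: u_def field_simps)
  then have lim: "limit_prob \<theta> (a # as) c = (if a = c then u else 1 - u) * t" for c
    by (simp add: t_def u_def)
  have eq: "u = \<theta> + (1 - \<theta>) * (1 - u)" "1 - u = (1 - \<theta>) * u"
    using u by (simp_all add: algebra_simps)
  show ?thesis
  proof (cases "a = c")
    case True
    have "u * t = (\<theta> + (1 - \<theta>) * (1 - u)) * t" using eq(1) by simp
    then show ?thesis using True unfolding lim t_def[symmetric] by (simp add: algebra_simps)
  next
    case False
    have "(1 - u) * t = ((1 - \<theta>) * u) * t" using eq(2) by simp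
    moreover have "a = (\<not> c)" using False by auto
    ultimately show ?thesis using False unfolding lim t_def[symmetric] by (simp add: mult.assoc)
  qed
qed

text \<open>Both quantities obey the same recursion, so the error \<open>x(l, n)\<close> for
  patterns of length \<open>l\<close> satisfies
  \<open>x(l, n + 1) <= \<theta> x(l - 1, n) + (1 - \<theta>) x(l, n)\<close>. The bound
  \<open>2^l (1 - \<theta>/2)^n\<close> solves this with equality and replaces a tail estimate for
  sums of geometric variables.\<close>

lemma scan_prob_limit:
  assumes "0 \<le> \<theta>" "\<theta> \<le> 1"
  shows "\<bar>scan_prob \<theta> v as c n h - limit_prob \<theta> as c\<bar> \<le> 2 ^ length as * (1 - \<theta> / 2) ^ n"
proof (induction n arbitrary: as c h)
  case 0
  show ?case
  proof (cases as)
    case (Cons a as')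
    have "\<bar>of_bool v - limit_prob \<theta> as c\<bar> \<le> 1" using limit_prob_bounds[OF assms, of as c] by (cases v) auto
    also have "1 \<le> (2::real) ^ length as" by simp
    finally show ?thesis unfolding Cons scan_prob_0 by simp
  qed (simp add: scan_prob_Nil)
next
  case (Suc n)
  show ?case
  proof (cases as)
    case (Cons a as')
    let ?q = "(1 - \<theta> / 2) ^ n" and ?L = "(2::real) ^ length as'"
    define X where "X = scan_prob \<theta> v as' True n (Suc h) - limit_prob \<theta> as' True"
    define Y where "Y = scan_prob \<theta> v as (\<not> c) n (Suc h) - limit_prob \<theta> as (\<not> c)"
    have "scan_prob \<theta> v as c (Suc n) h - limit_prob \<theta> as c = \<theta> * (of_bool (a = c) * X) + (1 - \<theta>) * Y"
      unfolding X_def Y_def Cons scan_prob_Suc limit_prob_rec[OF assms, of a as' c]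
      by (simp add: algebra_simps)
    also have "\<bar>\<dots>\<bar> \<le> \<bar>\<theta> * (of_bool (a = c) * X)\<bar> + \<bar>(1 - \<theta>) * Y\<bar>" by (rule abs_triangle_ineq)
    also have "\<bar>\<theta> * (of_bool (a = c) * X)\<bar> \<le> \<theta> * (?L * ?q)"
    proof -
      have "\<bar>of_bool (a = c) * X\<bar> \<le> \<bar>X\<bar>" by simp
      also have "\<dots> \<le> ?L * ?q" unfolding X_def by (rule Suc.IH)
      finally show ?thesis unfolding abs_mult[of \<theta>] using assms by (intro mult_mono) auto
    qed
    also have "\<bar>(1 - \<theta>) * Y\<bar> \<le> (1 - \<theta>) * (2 * ?L * ?q)"
    proof -
      have "\<bar>Y\<bar> \<le> 2 * ?L * ?q" unfolding Y_def using Suc.IH[of as "\<not> c" "Suc h"] by (simp add: Cons)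
      then show ?thesis unfolding abs_mult[of "1 - \<theta>"] using assms by (intro mult_mono) auto
    qed
    also have "\<theta> * (?L * ?q) + (1 - \<theta>) * (2 * ?L * ?q) = 2 ^ length as * (1 - \<theta> / 2) ^ Suc n"
      by (simp add: Cons algebra_simps)
    finally show ?thesis by simp
  qed (use assms in \<open>simp add: scan_prob_Nil\<close>)
qed

section \<open>Gap patterns in finite sets\<close>

fun gapmatch :: "bool list \<Rightarrow> nat \<Rightarrow> nat list \<Rightarrow> bool" where
  "gapmatch [] x ys = True"
| "gapmatch (a # as) x [] = False"
| "gapmatch (a # as) x (y # ys) = ((a \<longleftrightarrow> odd (x + y)) \<and> gapmatch as y ys)"

fun gapcount :: "bool list \<Rightarrow> nat list \<Rightarrow> nat" where
  "gapcount as [] = 0"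
| "gapcount as (x # ys) = of_bool (gapmatch as x ys) + gapcount as ys"

lemma gapmatch_append_cong:
  "length as \<le> length zs \<Longrightarrow> gapmatch as x (zs @ ys) = gapmatch as x (zs @ ys')"
proof (induction as arbitrary: x zs)
  case (Cons a as)
  then show ?case by (cases zs) auto
qed simp

text \<open>Only matches that start at \<open>y\<close> or at one of the last
  \<open>length as\<close> entries before it can see \<open>y\<close>.\<close>

lemma gapcount_remove:
  "\<bar>int (gapcount as (pre @ y # post)) - int (gapcount as (pre @ post))\<bar> \<le> int (min (length pre) (length as)) + 1"
proof (induction pre)
  case (Cons x pre)
  show ?case
  proof (cases "length as \<le> length pre")
    case True
    then have "gapmatch as x (pre @ y # post) = gapmatch as x (pre @ post)" by (rule gapmatch_append_cong)
    then show ?thesis using Cons True by simp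
  next
    case False
    then show ?thesis using Cons by (auto simp: of_bool_def)
  qed
qed simp

lemma gapcount_insert:
  assumes "finite W" "y \<notin> W"
  shows "\<bar>int (gapcount as (sorted_list_of_set (insert y W))) - int (gapcount as (sorted_list_of_set W))\<bar> \<le> int (length as) + 1"
proof -
  let ?xs = "sorted_list_of_set (insert y W)"
  have "set ?xs = insert y W" using assms by (simp only: set_sorted_list_of_set finite_insert)
  then have "y \<in> set ?xs" by simp
  then obtain pre post where pp: "?xs = pre @ y # post" "y \<notin> set pre" by (meson split_list_first)
  have "sorted_list_of_set W = sorted_list_of_set (insert y W - {y})" using assms by simp
  also have "\<dots> = remove1 y ?xs" using assms by (simp only: sorted_list_of_set_remove finite_insert)
  also have "\<dots> = pre @ post" unfolding pp(1) using pp(2) by (simp add: remove1_append)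
  finally have e: "sorted_list_of_set W = pre @ post" .
  have "int (min (length pre) (length as)) \<le> int (length as)" by simp
  then show ?thesis
    unfolding pp(1) e using gapcount_remove[of as pre y post] by linarith
qed

text \<open>This carries the count from the smooth roots over to the primitive roots at a cost
  proportional to the number of deleted elements.\<close>

lemma gapcount_subset:
  assumes "finite V'" "V \<subseteq> V'"
  shows "\<bar>int (gapcount as (sorted_list_of_set V')) - int (gapcount as (sorted_list_of_set V))\<bar>
    \<le> (int (length as) + 1) * int (card (V' - V))"
proof -
  have "\<bar>int (gapcount as (sorted_list_of_set (V \<union> D))) - int (gapcount as (sorted_list_of_set V))\<bar>
    \<le> (int (length as) + 1) * int (card D)" if "finite D" "D \<inter> V = {}" for D
    using that
  proof (induction D rule: finite_induct)
    case (insert y D)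
    have "finite (V \<union> D)" using assms insert finite_subset by auto
    then have "\<bar>int (gapcount as (sorted_list_of_set (insert y (V \<union> D)))) - int (gapcount as (sorted_list_of_set (V \<union> D)))\<bar> \<le> int (length as) + 1"
      using insert by (intro gapcount_insert) auto
    moreover have "\<bar>int (gapcount as (sorted_list_of_set (V \<union> D))) - int (gapcount as (sorted_list_of_set V))\<bar>
      \<le> (int (length as) + 1) * int (card D)" using insert by auto
    moreover have "(int (length as) + 1) * int (card (insert y D)) = (int (length as) + 1) * int (card D) + (int (length as) + 1)"
      using insert by (simp add: algebra_simps)
    ultimately show ?case by (simp only: Un_insert_right)
  qed simp
  from this[of "V' - V"] show ?thesis using assms by (simp add: Un_absorb1 Int_commute)
qed

text \<open>Describes a match through the elements above \<open>x\<close>, which is how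
  \<open>scan\<close> meets them; the index form \<open>gapcount_index\<close> serves the binary
  sequence.\<close>

lemma gapcount_card:
  assumes "sorted_wrt (<) xs"
  shows "gapcount as xs = card {x \<in> set xs. gapmatch as x (filter (\<lambda>y. x < y) xs)}"
  using assms
proof (induction xs)
  case (Cons x xs)
  have f: "filter (\<lambda>y. x < y) (x # xs) = xs" using Cons.prems by (simp add: filter_id_conv)
  have g: "filter (\<lambda>y. x' < y) (x # xs) = filter (\<lambda>y. x' < y) xs" if "x' \<in> set xs" for x'
    using Cons.prems that by auto
  have "{x' \<in> set (x # xs). gapmatch as x' (filter (\<lambda>y. x' < y) (x # xs))} =
     (if gapmatch as x xs then {x} else {}) \<union> {x' \<in> set xs. gapmatch as x' (filter (\<lambda>y. x' < y) xs)}"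
    using f g by (auto simp del: filter.simps)
  also have "card \<dots> = of_bool (gapmatch as x xs) + gapcount as xs"
    using Cons by (subst card_Un_disjoint) auto
  finally show ?case by simp
qed simp

lemma gapcount_index:
  "gapcount as xs = card {n. n < length xs \<and> gapmatch as (xs ! n) (drop (Suc n) xs)}"
proof (induction xs)
  case (Cons x xs)
  let ?S = "{n. n < length xs \<and> gapmatch as (xs ! n) (drop (Suc n) xs)}"
  have "{n. n < length (x # xs) \<and> gapmatch as ((x # xs) ! n) (drop (Suc n) (x # xs))} =
     (if gapmatch as x xs then {0} else {}) \<union> Suc ` ?S" (is "?A = ?B")
  proof -
    have "n \<in> ?A \<longleftrightarrow> n \<in> ?B" for n by (cases n) auto
    then show ?thesis by blast
  qed
  also have "card \<dots> = of_bool (gapmatch as x xs) + card ?S"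
    by (subst card_Un_disjoint) (auto simp: card_image)
  finally show ?case using Cons by simp
qed simp

lemma gapmatch_iff:
  "gapmatch as x ys \<longleftrightarrow> length as \<le> length ys \<and>
    (\<forall>i<length as. as ! i = odd ((x # ys) ! i + (x # ys) ! Suc i))"
proof (induction as x ys rule: gapmatch.induct)
  case (3 a as x y ys)
  have "(\<forall>i<length (a # as). (a # as) ! i = odd ((x # y # ys) ! i + (x # y # ys) ! Suc i)) \<longleftrightarrow>
     a = odd (x + y) \<and> (\<forall>i<length as. as ! i = odd ((y # ys) ! i + (y # ys) ! Suc i))"
    by (simp add: All_less_Suc2)
  then show ?case using 3 by auto
qed auto

lemma filter_ge_sorted:
  "sorted_wrt (<) xs \<Longrightarrow> z \<in> set xs \<Longrightarrow> filter (\<lambda>y. z \<le> y) xs = z # filter (\<lambda>y. Suc z \<le> y) xs"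
  for z :: nat
proof (induction xs)
  case (Cons x xs)
  show ?case
  proof (cases "z = x")
    case True
    have "filter (\<lambda>y. x \<le> y) xs = xs" "filter (\<lambda>y. Suc x \<le> y) xs = xs"
      using Cons.prems(1) by (auto simp: filter_id_conv)
    then show ?thesis using True by simp
  next
    case False
    then have "z \<in> set xs" "x < z" using Cons.prems by auto
    then show ?thesis using Cons by auto
  qed
qed simp

text \<open>The two default verdicts bracket the truth: a successful \<open>scan False\<close>
  certifies a match, and a successful \<open>scan True\<close> is necessary for one.
  \<open>c\<close> is the parity of \<open>x + h - x0\<close>, where \<open>x0\<close> is the last
  element read; the sum avoids subtraction of natural numbers.\<close>

lemma scan_gapmatch:
  assumes "sorted_wrt (<) xs" "c = odd (x0 + x + h)"
  shows "(scan False as c n h {j. x + j \<in> set xs} \<longrightarrow> gapmatch as x0 (filter (\<lambda>y. x + h \<le> y) xs)) \<and>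
    (gapmatch as x0 (filter (\<lambda>y. x + h \<le> y) xs) \<longrightarrow> scan True as c n h {j. x + j \<in> set xs})"
  using assms(2)
proof (induction n arbitrary: as c h x0)
  case 0
  then show ?case by (cases as) auto
next
  case (Suc n)
  show ?case
  proof (cases as)
    case (Cons a as')
    show ?thesis
    proof (cases "x + h \<in> set xs")
      case True
      have "filter (\<lambda>y. x + h \<le> y) xs = (x + h) # filter (\<lambda>y. x + Suc h \<le> y) xs"
        using filter_ge_sorted[OF assms(1) True] by simp
      moreover have "True = odd (x + h + x + Suc h)" by presburger
      ultimately show ?thesis
        using Suc.IH[of True "x + h" "Suc h" as'] True Suc.prems by (auto simp: Cons add.assoc)
    next
      case False
      have "filter (\<lambda>y. x + h \<le> y) xs = filter (\<lambda>y. x + Suc h \<le> y) xs"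
        using False by (intro filter_cong refl) (metis add_Suc_right le_SucI le_antisym not_less_eq_eq)
      moreover have "(\<not> c) = odd (x0 + x + Suc h)" using Suc.prems by simp
      ultimately show ?thesis
        using Suc.IH[of "\<not> c" x0 "Suc h" as] False Suc.prems by (simp add: Cons)
    qed
  qed simp
qed

section \<open>From the binary sequence to parities of gaps\<close>

lemma of_nat_bit_eq: "(of_nat n :: bit) = b \<longleftrightarrow> (b = 1) = odd n"
proof -
  have "(of_nat n :: bit) = (if even n then 0 else 1)"
    by (induction n) auto
  then show ?thesis by (cases b) auto
qed

text \<open>A pattern that fits into one period never wraps, which disposes of the index reduction;
  fitting means that at least \<open>length a\<close> elements follow the one at index
  \<open>n\<close>, as \<open>gapmatch\<close> demands. Sum and difference have the same parity, so
  bit 1 means an odd gap.\<close>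

lemma pattern_count_eq_gapcount:
  assumes "card (primroots p) = totient (p - 1)" "length a \<ge> 1"
  shows "pattern_count p a = gapcount (map (\<lambda>b. b = 1) a) (sorted_list_of_set (primroots p))"
proof -
  let ?xs = "sorted_list_of_set (primroots p)"
  have "finite (primroots p)" unfolding primroots_def by auto
  then have len: "length ?xs = totient (p - 1)" using assms by simp
  have "n + length a \<le> seq_period p \<and> (\<forall>i<length a. primroot_seq p (n + i) = a ! i) \<longleftrightarrow>
    n < length ?xs \<and> gapmatch (map (\<lambda>b. b = 1) a) (?xs ! n) (drop (Suc n) ?xs)" for n
  proof (cases "n < length ?xs \<and> n + length a \<le> seq_period p")
    case True
    have "primroot_seq p (n + i) = a ! i \<longleftrightarrow> (a ! i = 1) = odd (?xs ! (n + i) + ?xs ! Suc (n + i))"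
      if "i < length a" for i
    proof -
      have "(n + i) mod seq_period p = n + i" using True that by simp
      then have "primroot_seq p (n + i) = of_nat (?xs ! (n + i) + ?xs ! Suc (n + i))"
        by (simp add: primroot_seq_def Let_def nth_primroot_def)
      then show ?thesis using of_nat_bit_eq[of "?xs ! (n + i) + ?xs ! Suc (n + i)" "a ! i"] by simp
    qed
    moreover have "gapmatch (map (\<lambda>b. b = 1) a) (?xs ! n) (drop (Suc n) ?xs) \<longleftrightarrow>
      (\<forall>i<length a. (a ! i = 1) = odd (?xs ! (n + i) + ?xs ! Suc (n + i)))"
      unfolding gapmatch_iff using True len
      by (auto simp: Cons_nth_drop_Suc seq_period_def)
    ultimately show ?thesis using True by simp
  next
    case False
    then show ?thesis using len assms(2) by (auto simp: gapmatch_iff seq_period_def)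
  qed
  then show ?thesis unfolding pattern_count_def gapcount_index by simp
qed

section \<open>Sieving by small primes\<close>

lemma prod_primes_dvd:
  fixes N :: nat
  assumes "finite P" "\<And>q. q \<in> P \<Longrightarrow> prime q" "\<And>q. q \<in> P \<Longrightarrow> q dvd N"
  shows "(\<Prod>q\<in>P. q) dvd N"
  using assms
proof (induction P rule: finite_induct)
  case (insert x P)
  have "coprime x (\<Prod>q\<in>P. q)"
  proof (rule prod_coprime_right)
    fix q assume "q \<in> P"
    then show "coprime x q" using insert by (intro primes_coprime) auto
  qed
  then show ?case using insert by (simp add: divides_mult)
qed simp

lemma central_binomial_le: "(2 * m + 1) choose m \<le> 4 ^ m"
proof -
  have "2 * ((2 * m + 1) choose m) = ((2 * m + 1) choose m) + ((2 * m + 1) choose (m + 1))"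
    using binomial_symmetric[of m "2 * m + 1"] by simp
  also have "\<dots> = (\<Sum>k\<in>{m, m + 1}. (2 * m + 1) choose k)" by simp
  also have "\<dots> \<le> (\<Sum>k\<le>2 * m + 1. (2 * m + 1) choose k)" by (intro sum_mono2) auto
  also have "\<dots> = 2 ^ (2 * m + 1)" by (rule choose_row_sum)
  also have "\<dots> = 2 * 4 ^ m" by (simp add: power_mult)
  finally show ?thesis by simp
qed

text \<open>Erdos's argument: for \<open>n = 2 * m + 1\<close> the primes from \<open>m + 2\<close>
  to \<open>n\<close> all divide \<open>n choose m\<close>, which is at most
  \<open>4 ^ m\<close>.\<close>

lemma primorial_le: "(\<Prod>q\<in>{q. prime q \<and> q \<le> n}. q) \<le> (4::nat) ^ n"
proof (induction n rule: less_induct)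
  case (less n)
  consider "n \<le> 1" | "n = 2" | "n > 2" "even n" | m where "n = 2 * m + 1" "m \<ge> 1"
    by (cases "n \<le> 1"; cases "n = 2"; cases "even n") (auto elim!: oddE)
  then show ?case
  proof cases
    case 1
    have "\<not> (prime q \<and> q \<le> n)" for q :: nat using 1 prime_ge_2_nat[of q] by auto
    then have e: "{q. prime q \<and> q \<le> n} = {}" by auto
    show ?thesis unfolding e by simp
  next
    case 2
    have "prime q \<and> q \<le> n \<longleftrightarrow> q = 2" for q :: nat
      using 2 prime_ge_2_nat[of q] two_is_prime_nat by auto
    then have e: "{q. prime q \<and> q \<le> n} = {2}" by auto
    show ?thesis unfolding e using 2 by simp
  next
    case 3
    then have "\<not> prime n" using prime_odd_nat by blast
    then have "q \<le> n \<longleftrightarrow> q \<le> n - 1" if "prime q" for q using that by (cases "q = n") auto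
    then have "{q. prime q \<and> q \<le> n} = {q. prime q \<and> q \<le> n - 1}" by auto
    then have "(\<Prod>q\<in>{q. prime q \<and> q \<le> n}. q) \<le> 4 ^ (n - 1)" using less[of "n - 1"] 3 by simp
    also have "\<dots> \<le> (4::nat) ^ n" by (intro power_increasing) auto
    finally show ?thesis .
  next
    case (4 m)
    let ?A = "{q. prime q \<and> q \<le> m + 1}" and ?B = "{q. prime q \<and> m + 1 < q \<and> q \<le> n}"
    have fin: "finite ?A" "finite ?B" by (auto intro: finite_subset[of _ "{..n}"] finite_subset[of _ "{..m + 1}"])
    have "{q. prime q \<and> q \<le> n} = ?A \<union> ?B" using 4 by auto
    then have "(\<Prod>q\<in>{q. prime q \<and> q \<le> n}. q) = (\<Prod>q\<in>?A. q) * (\<Prod>q\<in>?B. q)"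
      using fin by (simp only:) (rule prod.union_disjoint, auto)
    also have "\<dots> \<le> 4 ^ (m + 1) * 4 ^ m"
    proof (rule mult_le_mono)
      show "(\<Prod>q\<in>?A. q) \<le> 4 ^ (m + 1)" using less[of "m + 1"] 4 by simp
      have "(\<Prod>q\<in>?B. q) dvd (n choose m)"
      proof (rule prod_primes_dvd[OF fin(2)])
        fix q assume q: "q \<in> ?B"
        have "fact m * fact (n - m) * (n choose m) = fact n" using 4 by (intro binomial_fact_lemma) auto
        moreover have "q dvd fact n" using q by (simp add: prime_dvd_fact_iff)
        moreover have "\<not> q dvd fact m" "\<not> q dvd fact (n - m)"
          using q 4 prime_dvd_fact_iff[of q m] prime_dvd_fact_iff[of q "n - m"] by auto
        ultimately show "q dvd (n choose m)" using q by (metis (no_types, lifting) mem_Collect_eq prime_dvd_mult_iff)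
      qed auto
      then have "(\<Prod>q\<in>?B. q) \<le> n choose m" using 4 by (intro dvd_imp_le) (auto simp: zero_less_binomial_iff)
      also have "\<dots> \<le> 4 ^ m" using central_binomial_le 4 by simp
      finally show "(\<Prod>q\<in>?B. q) \<le> 4 ^ m" .
    qed
    also have "\<dots> = 4 ^ n" using 4 by (simp add: power_add power_mult flip: power_mult_distrib)
    finally show ?thesis .
  qed
qed

lemma prod_one_minus_ge:
  fixes a :: "'b \<Rightarrow> real"
  assumes "finite I" "\<And>i. i \<in> I \<Longrightarrow> 0 \<le> a i \<and> a i \<le> 1"
  shows "(\<Prod>i\<in>I. 1 - a i) \<ge> 1 - (\<Sum>i\<in>I. a i)"
  using assms
proof (induction I rule: finite_induct)
  case (insert x I)
  have "0 \<le> (\<Prod>i\<in>I. 1 - a i)" "(\<Prod>i\<in>I. 1 - a i) \<le> 1"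
    using insert by (auto intro!: prod_nonneg prod_le_1)
  then have "a x * (\<Prod>i\<in>I. 1 - a i) \<le> a x * 1" using insert by (intro mult_left_mono) auto
  then show ?case using insert by (simp add: algebra_simps)
qed simp

text \<open>\<open>d\<close> collects the prime factors up to \<open>Y\<close>. At most
  \<open>ln n / ln Y\<close> further primes divide \<open>n\<close>, and each multiplies the totient
  ratio by at least \<open>1 - 1 / Y\<close>; for \<open>Y\<close> of order \<open>ln n\<close> the
  total loss is of order \<open>1 / ln Y\<close>.\<close>

lemma small_radical_exists:
  fixes n Y :: nat
  assumes n: "n > 0" and Y: "Y \<ge> 2"
  obtains d where "squarefree d" "d dvd n" "real d \<le> 4 ^ Y"
    "real (totient n) / n \<ge> real (totient d) / d * (1 - ln n / (Y * ln Y))"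
proof -
  define P where "P = {q \<in> prime_factors n. q \<le> Y}"
  define Q where "Q = {q \<in> prime_factors n. q > Y}"
  define d where "d = (\<Prod>q\<in>P. q)"
  have fin: "finite P" "finite Q" by (auto simp: P_def Q_def)
  have prP: "prime q" "q dvd n" "q \<le> Y" if "q \<in> P" for q using that by (auto simp: P_def)
  have prQ: "prime q" "q dvd n" "Y < q" if "q \<in> Q" for q using that by (auto simp: Q_def)
  have d0: "d > 0" unfolding d_def using prP by (auto intro!: prod_pos simp: prime_gt_0_nat)
  have pfd: "prime_factors d = P"
  proof (intro equalityI subsetI)
    fix q assume "q \<in> prime_factors d"
    then have q: "prime q" "q dvd d" by auto
    then obtain q' where "q' \<in> P" "q dvd q'"
      unfolding d_def using prime_dvd_prod_iff[OF fin(1) q(1), of "\<lambda>q. q"] by auto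
    then show "q \<in> P" using q prP primes_dvd_imp_eq by metis
  next
    fix q assume q: "q \<in> P"
    then have "q dvd d" unfolding d_def using fin by (intro dvd_prodI) auto
    then show "q \<in> prime_factors d" using prP[OF q] d0 by (auto simp: prime_factors_dvd)
  qed
  have ratio: "real (totient m) / m = (\<Prod>q\<in>prime_factors m. 1 - 1 / real q)" if "m > 0" for m
    using totient_formula2[of m] that by simp
  have "prime_factors n = P \<union> Q" by (auto simp: P_def Q_def)
  then have "real (totient n) / n = (\<Prod>q\<in>P. 1 - 1 / real q) * (\<Prod>q\<in>Q. 1 - 1 / real q)"
    unfolding ratio[OF n] using fin by (simp only:) (rule prod.union_disjoint, auto simp: P_def Q_def)
  also have "(\<Prod>q\<in>P. 1 - 1 / real q) = real (totient d) / d" using ratio[OF d0] pfd by simp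
  finally have eq: "real (totient n) / n = real (totient d) / d * (\<Prod>q\<in>Q. 1 - 1 / real q)" .
  have lnY: "ln (real Y) > 0" using Y by simp
  have "real (card Q) * ln Y \<le> ln n"
  proof -
    have "Y ^ card Q = (\<Prod>q\<in>Q. Y)" by simp
    also have "\<dots> \<le> (\<Prod>q\<in>Q. q)" using prQ by (intro prod_mono) (auto intro: less_imp_le)
    also have "\<dots> \<le> n" using prQ fin n by (intro dvd_imp_le prod_primes_dvd) auto
    finally have "ln (real (Y ^ card Q)) \<le> ln (real n)" using Y n by (subst ln_le_cancel_iff) auto
    then show ?thesis using Y by (simp add: ln_realpow)
  qed
  then have cQ: "real (card Q) \<le> ln n / ln Y" using lnY by (simp add: field_simps)
  have "(\<Sum>q\<in>Q. 1 / real q) \<le> (\<Sum>q\<in>Q. 1 / real Y)"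
    using prQ Y by (intro sum_mono frac_le) (auto intro: less_imp_le)
  also have "\<dots> = real (card Q) / Y" by simp
  also have "\<dots> \<le> (ln n / ln Y) / Y" using cQ by (intro divide_right_mono) auto
  also have "\<dots> = ln n / (Y * ln Y)" by simp
  finally have sQ: "(\<Sum>q\<in>Q. 1 / real q) \<le> ln n / (Y * ln Y)" .
  have "1 - (\<Sum>q\<in>Q. 1 / real q) \<le> (\<Prod>q\<in>Q. 1 - 1 / real q)"
    using prQ prime_ge_1_nat by (intro prod_one_minus_ge[OF fin(2)]) (auto simp: divide_le_eq)
  with sQ have "1 - ln n / (Y * ln Y) \<le> (\<Prod>q\<in>Q. 1 - 1 / real q)" by linarith
  then have bound: "real (totient n) / n \<ge> real (totient d) / d * (1 - ln n / (Y * ln Y))"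
    unfolding eq by (intro mult_left_mono) auto
  have "d \<le> (\<Prod>q\<in>{q. prime q \<and> q \<le> Y}. q)"
    unfolding d_def using prP
    by (intro dvd_imp_le prod_dvd_prod_subset prod_pos) (auto simp: prime_gt_0_nat intro: finite_subset[of _ "{..Y}"])
  also have "\<dots> \<le> 4 ^ Y" by (rule primorial_le)
  finally have "real d \<le> 4 ^ Y" by (metis of_nat_le_iff of_nat_numeral of_nat_power)
  moreover have "squarefree d"
    unfolding d_def using prP by (intro squarefree_prod_coprime) (auto intro: primes_coprime squarefree_prime)
  moreover have "d dvd n" unfolding d_def using fin prP by (intro prod_primes_dvd) auto
  ultimately show ?thesis using that bound by blast
qed

section \<open>Primitive roots among the numbers with logarithm prime to d\<close>

lemma card_primroots:
  assumes "prime p"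
  shows "card (primroots p) = totient (p - 1)"
proof -
  have "primroots p = {x \<in> totatives p. ord p x = p - 1}"
    unfolding primroots_def residue_primroot_def using assms prime_gt_1_nat[OF assms]
    by (auto simp: totatives_prime totient_prime prime_imp_coprime nat_dvd_not_less)
  then show ?thesis using prime_card_primitive_roots[OF prime_gt_1_nat[OF assms] assms] by simp
qed

context prime_root
begin

text \<open>The set U of the overview; the name refers to the small primes that make up
  \<open>d\<close>.\<close>

definition smooth_roots :: "nat \<Rightarrow> nat set" where
  "smooth_roots d = {x \<in> {1..<p}. coprime (dlog (int x)) d}"

lemma finite_smooth_roots [simp]: "finite (smooth_roots d)"
  by (simp add: smooth_roots_def)

text \<open>If a prime \<open>q\<close> divided both \<open>p - 1\<close> and the logarithm of
  \<open>x\<close>, the power of \<open>x\<close> with exponent \<open>(p - 1) / q\<close> would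
  already be 1.\<close>

lemma primroots_subset_smooth_roots:
  assumes "d dvd p - 1"
  shows "primroots p \<subseteq> smooth_roots d"
proof
  fix x assume "x \<in> primroots p"
  then have x: "1 \<le> x" "x < p" "ord p x = p - 1"
    using p_gt_1 by (auto simp: primroots_def residue_primroot_def totient_prime[OF prime])
  have "\<not> int p dvd int x" using x by (simp add: nat_dvd_not_less)
  then have lg: "[int g ^ dlog (int x) = int x] (mod int p)" by (rule dlog)
  have "coprime (dlog (int x)) (p - 1)"
  proof (rule ccontr)
    assume "\<not> coprime (dlog (int x)) (p - 1)"
    then have "gcd (dlog (int x)) (p - 1) \<noteq> 1" by (metis coprime_iff_gcd_eq_1)
    then obtain q where "prime q" "q dvd gcd (dlog (int x)) (p - 1)"
      using prime_factor_nat[of "gcd (dlog (int x)) (p - 1)"] by auto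
    then have q: "prime q" "q dvd dlog (int x)" "q dvd p - 1" by simp_all
    obtain s t where st: "dlog (int x) = q * s" "p - 1 = q * t" using q by (auto simp: dvd_def)
    have "[int x ^ t = (int g ^ dlog (int x)) ^ t] (mod int p)" by (intro cong_pow cong_sym[OF lg])
    also have "dlog (int x) * t = (p - 1) * s" unfolding st by (simp only: mult_ac)
    then have "(int g ^ dlog (int x)) ^ t = int g ^ ((p - 1) * s)" by (simp only: power_mult[symmetric])
    also have "[int g ^ ((p - 1) * s) = int g ^ 0] (mod int p)"
      unfolding g_power_cong by (simp add: cong_0_iff)
    finally have "[int (x ^ t) = int 1] (mod int p)" by simp
    then have "[x ^ t = 1] (mod p)" by (simp only: cong_int_iff)
    then have "p - 1 dvd t" unfolding ord_divides x(3) .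
    moreover have "t > 0" using st p_gt_1 by (cases t) auto
    ultimately have "q * t \<le> 1 * t" using st by (simp add: dvd_imp_le)
    then show False using \<open>t > 0\<close> prime_gt_1_nat[OF q(1)] by simp
  qed
  then have "coprime (dlog (int x)) d" using assms by (meson coprime_divisors dvd_refl)
  then show "x \<in> smooth_roots d" using x by (simp add: smooth_roots_def)
qed

end

section \<open>Windows behind a base point\<close>

context prime_root
begin

definition base_points :: "nat \<Rightarrow> int set" where
  "base_points d = {x \<in> goodpts {0}. coprime (dlog x) d}"

text \<open>Windows are read cyclically modulo \<open>p\<close>: one that passes \<open>p\<close>
  continues at 1, unlike the sorted list of roots.\<close>

definition window :: "nat \<Rightarrow> nat \<Rightarrow> int \<Rightarrow> nat set" where
  "window d n x = {h \<in> {1..<1 + n}. \<not> int p dvd x + int h \<and> coprime (dlog (x + int h)) d}"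

lemma base_points_eq: "base_points d = int ` smooth_roots d"
proof (intro equalityI subsetI)
  fix x assume "x \<in> base_points d"
  then have x: "0 \<le> x" "x < int p" "\<not> int p dvd x" "coprime (dlog x) d"
    by (auto simp: base_points_def goodpts_def)
  then have "x \<noteq> 0" by auto
  then have "nat x \<in> smooth_roots d" "x = int (nat x)"
    using x by (auto simp: smooth_roots_def)
  then show "x \<in> int ` smooth_roots d" by blast
next
  fix x assume "x \<in> int ` smooth_roots d"
  then show "x \<in> base_points d"
    by (auto simp: base_points_def goodpts_def smooth_roots_def nat_dvd_not_less)
qed

lemma finite_base_points [simp]: "finite (base_points d)"
  by (simp add: base_points_eq)

lemma card_base_points: "card (base_points d) = card (smooth_roots d)"
  unfolding base_points_eq by (intro card_image) auto

text \<open>The base point supplies the offset 0, hence the exponent \<open>card T + 1\<close>. All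
  offsets lie below \<open>p\<close>, so they are distinct modulo \<open>p\<close>.\<close>

lemma window_correlation:
  fixes y :: real
  assumes y: "y ^ 400 = p" "y \<ge> real r + 4" and d: "squarefree d" "d dvd p - 1" "real d ^ (r + 1) \<le> y"
    and n: "n < p" and T: "T \<subseteq> {1..<1 + n}" "card T \<le> r"
  shows "\<bar>real (card {x \<in> base_points d. T \<subseteq> window d n x}) - (totient d / d) ^ (card T + 1) * p\<bar> \<le> y ^ 360"
proof -
  define H where "H = insert 0 (int ` T)"
  have finT: "finite T" using T(1) finite_subset by blast
  have y1: "y \<ge> 1" using y by simp
  have d1: "real d \<ge> 1" using d(1) by (cases d) auto
  have cardH: "card H = card T + 1"
  proof -
    have "0 \<notin> int ` T" using T(1) by auto
    then show ?thesis using finT by (simp add: H_def card_image)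
  qed
  have dk: "real d ^ k \<le> y" if "k \<le> r + 1" for k
    using d(3) power_increasing[OF that d1] by linarith
  have yy: "y \<le> y ^ j" if "j \<ge> 1" for j using y1 self_le_power[of y j] that by simp
  have "{x \<in> base_points d. T \<subseteq> window d n x} = {x \<in> goodpts H. \<forall>h\<in>H. coprime (dlog (x + h)) d}"
    using T(1) by (auto simp: base_points_def window_def goodpts_def H_def)
  moreover have "\<bar>real (card {x \<in> goodpts H. \<forall>h\<in>H. coprime (dlog (x + h)) d}) - (totient d / d) ^ (card T + 1) * p\<bar> \<le> y ^ 360"
  proof (rule correlation_small[OF y(1) _ d(1,2)])
    show "real (card T + 1) + 3 \<le> y" using y(2) T(2) by simp
    show "real d \<le> y ^ 5" using dk[of 1] yy[of 5] by simp
    show "real d ^ (card T + 1) \<le> y ^ 20" using dk[of "card T + 1"] yy[of 20] T(2) by simp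
    show "finite H" using finT by (simp add: H_def)
    show "h = h'" if "h \<in> H" "h' \<in> H" "[h = h'] (mod int p)" for h h'
    proof -
      have "0 \<le> h" "h < int p" "0 \<le> h'" "h' < int p" using that T(1) n p_gt_1 by (auto simp: H_def)
      then show ?thesis using that(3) by (simp add: cong_mod_def)
    qed
  qed (auto simp: cardH)
  ultimately show ?thesis by simp
qed

text \<open>Independent trials of density \<open>\<theta>\<close> with total mass
  \<open>\<theta> * p\<close> have the correlations \<open>\<theta> ^ (card T + 1) * p\<close>,
  exactly the main terms found for the smooth roots.\<close>

lemma window_sum_estimate:
  fixes y \<theta> :: real and f :: "nat set \<Rightarrow> real"
  assumes y: "y ^ 400 = p" "y \<ge> real r + 4" and d: "squarefree d" "d dvd p - 1" "real d ^ (r + 1) \<le> y"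
    and n: "n < p" and r: "r \<ge> 1" and f: "\<And>S. \<bar>f S\<bar> \<le> 1"
  defines "\<theta> \<equiv> real (totient d) / real d" and "V \<equiv> {1..<1 + n}"
  shows "\<bar>(\<Sum>x\<in>base_points d. f (window d n x)) - \<theta> * p * (\<Sum>S\<in>Pow V. bernoulli_weight \<theta> V S * f S)\<bar>
    \<le> (\<Sum>j<r. real (n choose j) * 2 ^ j) * y ^ 360 + 4 ^ r * real (n choose r) * (2 * \<theta> ^ (r + 1) * p + y ^ 360)"
proof -
  have d0: "d > 0" using d(1) by (cases d) auto
  have \<theta>: "0 \<le> \<theta>" "\<theta> \<le> 1" unfolding \<theta>_def using d0 totient_le[of d] by auto
  define Y2 where "Y2 S = S" for S :: "nat set"
  define w2 where "w2 S = \<theta> * p * bernoulli_weight \<theta> V S" for S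
  have up1: "upcount (base_points d) (\<lambda>_. 1) (window d n) T = real (card {x \<in> base_points d. T \<subseteq> window d n x})" for T
    by (simp add: upcount_def of_bool_def sum.inter_filter[symmetric])
  have up2: "upcount (Pow V) w2 Y2 T = \<theta> ^ (card T + 1) * p" if "T \<subseteq> V" for T
  proof -
    have "upcount (Pow V) w2 Y2 T = \<theta> * p * (\<Sum>S\<in>Pow V. bernoulli_weight \<theta> V S * of_bool (T \<subseteq> S))"
      unfolding upcount_def w2_def Y2_def sum_distrib_left by (simp only: mult.assoc)
    also have "(\<Sum>S\<in>Pow V. bernoulli_weight \<theta> V S * of_bool (T \<subseteq> S)) = \<theta> ^ card T"
      using that by (intro sum_bernoulli_superset) (simp add: V_def)
    finally show ?thesis by simp
  qed
  have close: "\<bar>real (card {x \<in> base_points d. T \<subseteq> window d n x}) - \<theta> ^ (card T + 1) * p\<bar> \<le> y ^ 360"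
    if "T \<subseteq> V" "card T \<le> r" for T
    unfolding \<theta>_def using that by (intro window_correlation[OF y d n]) (auto simp: V_def)
  have "\<bar>(\<Sum>x\<in>base_points d. 1 * f (window d n x)) - (\<Sum>S\<in>Pow V. w2 S * f (Y2 S))\<bar>
    \<le> (\<Sum>j<r. real (card V choose j) * 2 ^ j) * y ^ 360 + 4 ^ r * real (card V choose r) * (2 * \<theta> ^ (r + 1) * p + y ^ 360)"
  proof (rule moment_comparison[OF _ r f])
    show "finite V" "finite (Pow V)" by (auto simp: V_def)
    show "w2 S \<ge> 0" for S
      unfolding w2_def bernoulli_weight_def using \<theta> by (intro mult_nonneg_nonneg zero_le_power) auto
    show "window d n x \<subseteq> V" for x by (auto simp: window_def V_def)
    show "Y2 S \<subseteq> V" if "S \<in> Pow V" for S using that by (simp add: Y2_def)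
    fix T assume T: "T \<subseteq> V"
    show "\<bar>upcount (base_points d) (\<lambda>_. 1) (window d n) T - upcount (Pow V) w2 Y2 T\<bar> \<le> y ^ 360" if "card T < r"
      unfolding up1 up2[OF T] using close[OF T] that by simp
    show "upcount (base_points d) (\<lambda>_. 1) (window d n) T + upcount (Pow V) w2 Y2 T \<le> 2 * \<theta> ^ (r + 1) * p + y ^ 360"
      if "card T = r"
      unfolding up1 up2[OF T] using close[OF T] that by (simp add: abs_le_iff mult_ac)
  qed auto
  also have "(\<Sum>S\<in>Pow V. w2 S * f (Y2 S)) = \<theta> * p * (\<Sum>S\<in>Pow V. bernoulli_weight \<theta> V S * f S)"
    unfolding w2_def Y2_def sum_distrib_left by (simp only: mult.assoc)
  finally show ?thesis by (simp add: V_def)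
qed

text \<open>Only the last \<open>n\<close> integers below \<open>p\<close> have windows that wrap
  around; for all other base points \<open>scan_gapmatch\<close> applies.\<close>

lemma gapcount_smooth_roots_bounds:
  assumes "n < p"
  shows "card {x \<in> base_points d. scan False as True n 1 (window d n x)} \<le> gapcount as (sorted_list_of_set (smooth_roots d)) + n"
    "gapcount as (sorted_list_of_set (smooth_roots d)) \<le> card {x \<in> base_points d. scan True as True n 1 (window d n x)} + n"
proof -
  let ?xs = "sorted_list_of_set (smooth_roots d)"
  let ?m = "\<lambda>x. gapmatch as x (filter (\<lambda>y. x < y) ?xs)"
  have cnt: "gapcount as ?xs = card {x \<in> smooth_roots d. ?m x}"
    using gapcount_card[of ?xs as] by simp
  have agree: "scan v as True n 1 (window d n (int x)) = scan v as True n 1 {j. x + j \<in> set ?xs}"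
    if "x + n < p" "x \<ge> 1" for x v
  proof (rule scan_cong)
    fix j :: nat assume j: "1 \<le> j" "j < 1 + n"
    then have "x + j < p" "0 < x + j" using that by auto
    then have "\<not> int p dvd int (x + j)" by (simp add: nat_dvd_not_less del: of_nat_add)
    then show "j \<in> window d n (int x) \<longleftrightarrow> j \<in> {j. x + j \<in> set ?xs}"
      using j \<open>x + j < p\<close> \<open>0 < x + j\<close> by (auto simp: window_def smooth_roots_def)
  qed
  have sm: "(scan False as True n 1 {j. x + j \<in> set ?xs} \<longrightarrow> ?m x) \<and> (?m x \<longrightarrow> scan True as True n 1 {j. x + j \<in> set ?xs})" for x
    using scan_gapmatch[of ?xs True x x 1 as n] by (simp add: Suc_le_eq)
  define B where "B = {p - n..<p}"
  have B: "finite B" "card B = n" unfolding B_def using assms by auto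
  define S where "S P = {x \<in> smooth_roots d. P x}" for P :: "nat \<Rightarrow> bool"
  let ?s = "\<lambda>v x. scan v as True n 1 (window d n (int x))"
  have "finite (S P)" for P by (simp add: S_def)
  then have le: "card (S P) \<le> card (S P') + n" if "S P \<subseteq> S P' \<union> B" for P P'
    using card_mono[OF _ that] card_Un_le[of "S P'" B] B by simp
  have "{x \<in> base_points d. scan v as True n 1 (window d n x)} = int ` S (?s v)" for v
    by (auto simp: base_points_eq S_def)
  then have base: "card {x \<in> base_points d. scan v as True n 1 (window d n x)} = card (S (?s v))" for v
    by (simp add: card_image)
  have near: "x \<in> B \<or> (?s False x \<longrightarrow> ?m x) \<and> (?m x \<longrightarrow> ?s True x)" if "x \<in> smooth_roots d" for x
  proof (cases "x + n < p")
    case True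
    moreover have "x \<ge> 1" using that by (simp add: smooth_roots_def)
    ultimately show ?thesis using agree sm[of x] by simp
  next
    case False
    then show ?thesis using that by (auto simp: B_def smooth_roots_def)
  qed
  have "S (?s False) \<subseteq> S ?m \<union> B" "S ?m \<subseteq> S (?s True) \<union> B" using near by (auto simp: S_def)
  then show "card {x \<in> base_points d. scan False as True n 1 (window d n x)} \<le> gapcount as ?xs + n"
    "gapcount as ?xs \<le> card {x \<in> base_points d. scan True as True n 1 (window d n x)} + n"
    unfolding base cnt S_def[symmetric] by (simp_all add: le)
qed

text \<open>Three errors are added: patterns unfinished within the window cost
  \<open>exp (- C / 2)\<close>; in the truncation \<open>n choose r\<close> meets
  \<open>\<theta> ^ r\<close> and leaves \<open>(C + 1) ^ r / fact r\<close>; the errors of the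
  correlations and the wrapping windows involve powers of \<open>n <= (C + 1) * d\<close>, hence
  only one more factor \<open>y\<close>.\<close>

lemma gapcount_smooth_roots_estimate:
  fixes y C \<theta> :: real
  assumes y: "y ^ 400 = p" "y \<ge> real r + 4" "y \<ge> C + 1"
    and d: "squarefree d" "d dvd p - 1" "real d ^ (r + 1) \<le> y" and r: "r \<ge> 1" and C: "C \<ge> 1"
  defines "\<theta> \<equiv> real (totient d) / real d"
  shows "\<bar>real (gapcount as (sorted_list_of_set (smooth_roots d))) - \<theta> * p * limit_prob \<theta> as True\<bar>
    \<le> \<theta> * p * (2 ^ length as * exp (- C / 2) + 2 * (4 * (C + 1)) ^ r / fact r) +
      ((C + 1) + (real r + 1) * (4 * (C + 1)) ^ r) * y ^ 361"
proof -
  have d0: "d > 0" using d(1) by (cases d) auto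
  have y1: "y \<ge> 1" "y \<ge> 2" using y(2) by auto
  have td: "totient d > 0" using d0 by simp
  have \<theta>: "0 < \<theta>" "\<theta> \<le> 1" "1 / \<theta> \<le> d"
  proof -
    show "0 < \<theta>" unfolding \<theta>_def using d0 td by simp
    show "\<theta> \<le> 1" unfolding \<theta>_def using d0 totient_le[of d] by simp
    have "real d / real (totient d) \<le> real d / 1" using td by (intro divide_left_mono) (auto simp: Suc_le_eq)
    then show "1 / \<theta> \<le> d" by (simp add: \<theta>_def)
  qed
  \<comment> \<open>The expected number of successes \<open>n * \<theta>\<close> then lies between
    \<open>C\<close> and \<open>C + 1\<close>.\<close>
  define n where "n = nat \<lceil>C / \<theta>\<rceil>"
  have C\<theta>: "C / \<theta> \<ge> 1" using \<theta> C by (simp add: field_simps)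
  have n_ge: "real n \<ge> C / \<theta>" unfolding n_def using C\<theta> by linarith
  have n1: "n \<ge> 1" using n_ge C\<theta> by linarith
  have "real n \<le> C / \<theta> + 1" unfolding n_def using C\<theta> by linarith
  also have "\<dots> \<le> (C + 1) / \<theta>" using \<theta> by (simp add: add_divide_distrib)
  finally have n_le: "real n \<le> (C + 1) / \<theta>" .
  then have n\<theta>: "real n * \<theta> \<le> C + 1" using \<theta> by (simp add: field_simps)
  have "(C + 1) * (1 / \<theta>) \<le> (C + 1) * d" using \<theta> C by (intro mult_left_mono) auto
  then have nd: "real n \<le> (C + 1) * d" using n_le by simp
  have d1: "real d \<ge> 1" using d0 by simp
  have dy: "real d ^ j \<le> y" if "j \<le> r + 1" for j
    using d(3) power_increasing[OF that d1] by linarith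
  have nr: "real n ^ r \<le> (C + 1) ^ r * y"
  proof -
    have "real n ^ r \<le> ((C + 1) * d) ^ r" using nd by (intro power_mono) auto
    also have "\<dots> = (C + 1) ^ r * real d ^ r" by (simp add: power_mult_distrib)
    also have "\<dots> \<le> (C + 1) ^ r * y" using dy[of r] C by (intro mult_left_mono) auto
    finally show ?thesis .
  qed
  have ny: "real n \<le> (C + 1) * y"
  proof -
    have "(C + 1) * real d \<le> (C + 1) * y" using dy[of 1] C by (intro mult_left_mono) auto
    then show ?thesis using nd by linarith
  qed
  have np: "n < p"
  proof -
    have "real n \<le> y * y" using ny y(3) y1 mult_right_mono[of "C + 1" y y] by linarith
    also have "\<dots> = y ^ 2" by (simp add: power2_eq_square)
    also have "\<dots> < y ^ 400" using y1 by (intro power_strict_increasing) auto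
    finally show ?thesis using y by simp
  qed
  define K where "K = (\<Sum>j<r. real (n choose j) * 2 ^ j) * y ^ 360 + 4 ^ r * real (n choose r) * (2 * \<theta> ^ (r + 1) * p + y ^ 360)"
  define G where "G = real (gapcount as (sorted_list_of_set (smooth_roots d)))"
  define X where "X v = real (card {x \<in> base_points d. scan v as True n 1 (window d n x)})" for v
  define L where "L = limit_prob \<theta> as True"
  have X: "\<bar>X v - \<theta> * p * scan_prob \<theta> v as True n 1\<bar> \<le> K" for v
  proof -
    have "X v = (\<Sum>x\<in>base_points d. of_bool (scan v as True n 1 (window d n x)))"
      by (simp add: X_def of_bool_def sum.inter_filter[symmetric])
    then show ?thesis
      unfolding scan_prob_def K_def \<theta>_def
      using window_sum_estimate[OF y(1,2) d np r, of "\<lambda>S. of_bool (scan v as True n 1 S)"] by simp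
  qed
  have decay: "(1 - \<theta> / 2) ^ n \<le> exp (- C / 2)"
  proof -
    have "(1 - \<theta> / 2) ^ n \<le> exp (- \<theta> / 2) ^ n"
      using \<theta> exp_ge_add_one_self[of "- \<theta> / 2"] by (intro power_mono) auto
    also have "\<dots> = exp (- (real n * \<theta>) / 2)" by (simp add: exp_of_nat_mult[symmetric])
    also have "\<dots> \<le> exp (- C / 2)" using n_ge \<theta> by (simp add: field_simps)
    finally show ?thesis .
  qed
  have lim: "\<bar>scan_prob \<theta> v as True n 1 - L\<bar> \<le> 2 ^ length as * exp (- C / 2)" for v
  proof -
    have "\<bar>scan_prob \<theta> v as True n 1 - L\<bar> \<le> 2 ^ length as * (1 - \<theta> / 2) ^ n"
      unfolding L_def using \<theta> by (intro scan_prob_limit) auto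
    also have "\<dots> \<le> 2 ^ length as * exp (- C / 2)" using decay by (intro mult_left_mono) auto
    finally show ?thesis .
  qed
  have X2: "\<bar>X v - \<theta> * p * L\<bar> \<le> \<theta> * p * (2 ^ length as * exp (- C / 2)) + K" for v
  proof -
    have "\<bar>\<theta> * p * (scan_prob \<theta> v as True n 1 - L)\<bar> \<le> \<theta> * p * (2 ^ length as * exp (- C / 2))"
      unfolding abs_mult[of "\<theta> * p"] using \<theta> lim[of v] by (intro mult_mono) auto
    moreover have "X v - \<theta> * p * L = (X v - \<theta> * p * scan_prob \<theta> v as True n 1) + \<theta> * p * (scan_prob \<theta> v as True n 1 - L)"
      by (simp add: algebra_simps)
    ultimately show ?thesis using X[of v] by linarith
  qed
  have "X False \<le> G + n" "G \<le> X True + n"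
    unfolding X_def G_def using gapcount_smooth_roots_bounds[OF np, where d = d and as = as] by linarith+
  then have G: "\<bar>G - \<theta> * p * L\<bar> \<le> \<theta> * p * (2 ^ length as * exp (- C / 2)) + K + n"
    using X2[of True] X2[of False] by linarith
  have y360: "y * y ^ 360 = y ^ 361" by (simp flip: power_Suc)
  have "(\<Sum>j<r. real (n choose j) * 2 ^ j) \<le> (\<Sum>j<r. (C + 1) ^ r * y * 4 ^ r)"
  proof (rule sum_mono)
    fix j assume j: "j \<in> {..<r}"
    have "(n choose j) * 1 \<le> (n choose j) * fact j" by (intro mult_le_mono) auto
    also have "\<dots> \<le> n ^ j" by (rule binomial_fact_pow)
    also have "\<dots> \<le> n ^ r" using j n1 by (intro power_increasing) auto
    finally have "real (n choose j) \<le> real n ^ r" by (simp flip: of_nat_power)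
    then have "real (n choose j) \<le> (C + 1) ^ r * y" using nr by linarith
    moreover have "(2::real) ^ j \<le> 4 ^ r"
    proof -
      have "(2::real) ^ j \<le> 4 ^ j" by (intro power_mono) auto
      also have "\<dots> \<le> 4 ^ r" using j by (intro power_increasing) auto
      finally show ?thesis .
    qed
    ultimately show "real (n choose j) * 2 ^ j \<le> (C + 1) ^ r * y * 4 ^ r"
      using C y1 by (intro mult_mono) auto
  qed
  also have "\<dots> = r * (4 * (C + 1)) ^ r * y" unfolding power_mult_distrib by (simp add: mult_ac)
  finally have "(\<Sum>j<r. real (n choose j) * 2 ^ j) * y ^ 360 \<le> r * (4 * (C + 1)) ^ r * y * y ^ 360"
    using y1 by (intro mult_right_mono) auto
  also have "\<dots> = r * (4 * (C + 1)) ^ r * (y * y ^ 360)" by (simp only: mult.assoc)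
  finally have K1: "(\<Sum>j<r. real (n choose j) * 2 ^ j) * y ^ 360 \<le> r * (4 * (C + 1)) ^ r * y ^ 361"
    unfolding y360 .
  have nchr: "real (n choose r) * fact r \<le> real n ^ r"
    using binomial_fact_pow[of n r] by (metis of_nat_fact of_nat_le_iff of_nat_mult of_nat_power)
  have K2: "4 ^ r * real (n choose r) * (2 * \<theta> ^ (r + 1) * p) \<le> \<theta> * p * (2 * (4 * (C + 1)) ^ r / fact r)"
  proof -
    have "real (n choose r) * \<theta> ^ r \<le> (real n ^ r / fact r) * \<theta> ^ r"
      using nchr \<theta> by (intro mult_right_mono) (auto simp: field_simps)
    also have "\<dots> = (real n * \<theta>) ^ r / fact r" by (simp add: power_mult_distrib)
    also have "\<dots> \<le> (C + 1) ^ r / fact r"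
      using n\<theta> \<theta> by (intro divide_right_mono power_mono) auto
    finally have "real (n choose r) * \<theta> ^ r \<le> (C + 1) ^ r / fact r" .
    then have "(2 * 4 ^ r * \<theta> * p) * (real (n choose r) * \<theta> ^ r) \<le> (2 * 4 ^ r * \<theta> * p) * ((C + 1) ^ r / fact r)"
      using \<theta> by (intro mult_left_mono) auto
    then show ?thesis unfolding power_mult_distrib by (simp add: mult_ac)
  qed
  have K3: "4 ^ r * real (n choose r) * y ^ 360 \<le> (4 * (C + 1)) ^ r * y ^ 361"
  proof -
    have "real (n choose r) * 1 \<le> real (n choose r) * fact r" by (intro mult_left_mono) (auto simp: fact_ge_1)
    then have "real (n choose r) \<le> (C + 1) ^ r * y" using nchr nr by linarith
    then have "4 ^ r * real (n choose r) * y ^ 360 \<le> 4 ^ r * ((C + 1) ^ r * y) * y ^ 360"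
      using y1 by (intro mult_right_mono mult_left_mono) auto
    also have "\<dots> = (4 * (C + 1)) ^ r * (y * y ^ 360)" unfolding power_mult_distrib by (simp only: mult.assoc)
    finally show ?thesis unfolding y360 .
  qed
  have n3: "real n \<le> (C + 1) * y ^ 361"
  proof -
    have "y \<le> y ^ 361" using y1 self_le_power[of y 361] by simp
    then have "(C + 1) * y \<le> (C + 1) * y ^ 361" using C by (intro mult_left_mono) auto
    then show ?thesis using ny by linarith
  qed
  have "K = (\<Sum>j<r. real (n choose j) * 2 ^ j) * y ^ 360 + 4 ^ r * real (n choose r) * (2 * \<theta> ^ (r + 1) * p) + 4 ^ r * real (n choose r) * y ^ 360"
    unfolding K_def by (simp add: distrib_left)
  then have "K \<le> r * (4 * (C + 1)) ^ r * y ^ 361 + \<theta> * p * (2 * (4 * (C + 1)) ^ r / fact r) + (4 * (C + 1)) ^ r * y ^ 361"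
    using K1 K2 K3 by linarith
  then have "\<bar>G - \<theta> * p * L\<bar> \<le> \<theta> * p * (2 ^ length as * exp (- C / 2)) + \<theta> * p * (2 * (4 * (C + 1)) ^ r / fact r) +
     ((C + 1) * y ^ 361 + r * (4 * (C + 1)) ^ r * y ^ 361 + (4 * (C + 1)) ^ r * y ^ 361)"
    using G n3 by linarith
  also have "\<dots> = \<theta> * p * (2 ^ length as * exp (- C / 2) + 2 * (4 * (C + 1)) ^ r / fact r) +
      ((C + 1) + (real r + 1) * (4 * (C + 1)) ^ r) * y ^ 361"
    by (simp add: distrib_left distrib_right)
  finally show ?thesis unfolding G_def L_def .
qed

lemma card_smooth_roots_estimate:
  fixes y :: real
  assumes y: "y ^ 400 = p" "y \<ge> 4" and d: "squarefree d" "d dvd p - 1" "real d \<le> y"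
  shows "\<bar>real (card (smooth_roots d)) - totient d / d * p\<bar> \<le> y ^ 360"
  \<comment> \<open>The empty set of offsets leaves the base point alone.\<close>
  using window_correlation[of y 0 d 0 "{}"] assms p_gt_1 by (simp add: card_base_points)

end

section \<open>The asymptotic formula\<close>

text \<open>Each factor lies in [0, 1] and has derivative at most 1 in absolute value there. This
  permits replacing \<open>totient d / d\<close> by \<open>totient (p - 1) / p\<close>.\<close>

lemma limit_prob_lipschitz:
  fixes \<theta> \<theta>' :: real
  assumes "0 \<le> \<theta>" "\<theta> \<le> 1" "0 \<le> \<theta>'" "\<theta>' \<le> 1"
  shows "\<bar>limit_prob \<theta> as c - limit_prob \<theta>' as c\<bar> \<le> length as * \<bar>\<theta> - \<theta>'\<bar>"
proof (induction as arbitrary: c)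
  case (Cons a as)
  define u where "u t = (if a = c then 1 / (2 - t) else (1 - t) / (2 - t))" for t :: real
  define L where "L t = limit_prob t as True" for t
  have u1: "0 \<le> u t \<and> u t \<le> 1" if "0 \<le> t" "t \<le> 1" for t
    using that by (simp add: u_def divide_le_eq)
  have "\<bar>u \<theta> - u \<theta>'\<bar> = \<bar>\<theta> - \<theta>'\<bar> / ((2 - \<theta>) * (2 - \<theta>'))"
  proof -
    have "(1 - t) / (2 - t) = 1 - 1 / (2 - t)" if "t \<le> 1" for t :: real
      using that by (simp add: field_simps)
    then have "\<bar>u \<theta> - u \<theta>'\<bar> = \<bar>1 / (2 - \<theta>) - 1 / (2 - \<theta>')\<bar>"
      using assms by (auto simp: u_def abs_minus_commute)
    also have "1 / (2 - \<theta>) - 1 / (2 - \<theta>') = (\<theta> - \<theta>') / ((2 - \<theta>) * (2 - \<theta>'))"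
      using assms by (subst diff_frac_eq) auto
    finally show ?thesis using assms by (simp add: abs_mult)
  qed
  also have "\<dots> \<le> \<bar>\<theta> - \<theta>'\<bar> / 1"
    using assms mult_mono[of 1 "2 - \<theta>" 1 "2 - \<theta>'"] by (intro divide_left_mono) auto
  finally have du: "\<bar>u \<theta> - u \<theta>'\<bar> \<le> \<bar>\<theta> - \<theta>'\<bar>" by simp
  have L1: "0 \<le> L \<theta>" "L \<theta> \<le> 1" using limit_prob_bounds[of \<theta>] assms by (auto simp: L_def)
  have "limit_prob \<theta> (a # as) c - limit_prob \<theta>' (a # as) c = (u \<theta> - u \<theta>') * L \<theta> + u \<theta>' * (L \<theta> - L \<theta>')"
    by (simp add: u_def L_def algebra_simps)
  also have "\<bar>\<dots>\<bar> \<le> \<bar>u \<theta> - u \<theta>'\<bar> * L \<theta> + u \<theta>' * \<bar>L \<theta> - L \<theta>'\<bar>"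
    using L1 u1[of \<theta>'] assms by (intro order_trans[OF abs_triangle_ineq]) (simp add: abs_mult)
  also have "\<dots> \<le> \<bar>\<theta> - \<theta>'\<bar> * 1 + 1 * (length as * \<bar>\<theta> - \<theta>'\<bar>)"
    using du L1 u1[of \<theta>'] assms Cons[of True] unfolding L_def by (intro add_mono mult_mono) auto
  also have "\<dots> = length (a # as) * \<bar>\<theta> - \<theta>'\<bar>" by (simp add: algebra_simps)
  finally show ?case .
qed simp

lemma limit_prob_closed_form:
  "limit_prob \<theta> as True =
     (1 / (2 - \<theta>)) ^ length (filter (\<lambda>b. b) as) * ((1 - \<theta>) / (2 - \<theta>)) ^ (length as - length (filter (\<lambda>b. b) as))"
proof (induction as)
  case (Cons a as)
  have "length (filter (\<lambda>b. b) as) \<le> length as" by (rule length_filter_le)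
  then show ?case using Cons by (cases a) (auto simp: Suc_diff_le)
qed simp

text \<open>\<open>C\<close> is settled before \<open>r\<close>, since the factorial has to beat a
  power of \<open>C + 1\<close>.\<close>

lemma exists_truncation_parameters:
  fixes \<epsilon> :: real
  assumes "\<epsilon> > 0"
  obtains C :: real and r :: nat where "C \<ge> 1" "r \<ge> 1" "2 ^ l * exp (- C / 2) \<le> \<epsilon>" "2 * (4 * (C + 1)) ^ r / fact r \<le> \<epsilon>"
proof -
  define C where "C = max 1 (- 2 * ln (\<epsilon> / 2 ^ l))"
  have "exp (- C / 2) \<le> exp (ln (\<epsilon> / 2 ^ l))" by (simp add: C_def max_def)
  also have "\<dots> = \<epsilon> / 2 ^ l" using assms by simp
  finally have 1: "2 ^ l * exp (- C / 2) \<le> \<epsilon>" by (simp add: field_simps)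
  have "(\<lambda>r. inverse (fact r) * (4 * (C + 1)) ^ r) \<longlonglongrightarrow> 0"
    by (rule summable_LIMSEQ_zero[OF summable_exp])
  then have "eventually (\<lambda>r. inverse (fact r) * (4 * (C + 1)) ^ r < \<epsilon> / 2) sequentially"
    using assms by (intro order_tendstoD) auto
  then have "eventually (\<lambda>r. inverse (fact r) * (4 * (C + 1)) ^ r < \<epsilon> / 2 \<and> r \<ge> 1) sequentially"
    using eventually_ge_at_top[of 1] by eventually_elim simp
  then obtain r where "inverse (fact r) * (4 * (C + 1)) ^ r < \<epsilon> / 2" "r \<ge> 1"
    using eventually_happens'[OF sequentially_bot] by blast
  then have "2 * (4 * (C + 1)) ^ r / fact r \<le> \<epsilon>" by (simp add: field_simps)
  with 1 \<open>r \<ge> 1\<close> show ?thesis by (intro that[of C r]) (auto simp: C_def)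
qed

text \<open>\<open>c\<close> is chosen so that \<open>4 ^ (Y * (r + 1))\<close> is at most
  \<open>p^(1/400)\<close>; \<open>B\<close> collects the lower bounds wanted for \<open>y\<close>;
  the exponential condition gives \<open>ln Y >= 2 / (c * \<epsilon>)\<close>, so that sieving loses
  at most a proportion \<open>\<epsilon>\<close>. With \<open>l = length as\<close> the final
  constant is twice \<open>5 * l + 9\<close>: \<open>3 * (l + 1)\<close> for deleted elements, 3 for
  the count in the smooth roots, \<open>2 * l\<close> for the change of density, 3 for replacing
  \<open>Q\<close> by \<open>T\<close>, and the factor 2 from \<open>Q <= 2 * T\<close>.\<close>

lemma gapcount_primroots_estimate:
  fixes \<epsilon> C :: real
  assumes p: "prime p" and \<epsilon>: "0 < \<epsilon>" "\<epsilon> \<le> 1 / 16"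
    and C: "C \<ge> 1" and r: "r \<ge> 1" "2 ^ length as * exp (- C / 2) \<le> \<epsilon>" "2 * (4 * (C + 1)) ^ r / fact r \<le> \<epsilon>"
    and c: "c = 1 / (400 * ln 4 * (real r + 1))"
    and B: "B = real r + 4 + (C + 1) + 1 / \<epsilon> + ((C + 1) + (real r + 1) * (4 * (C + 1)) ^ r) / \<epsilon>"
    and large: "ln p \<ge> 400 * ln B" "c * ln p \<ge> 4" "c / 2 * ln p \<ge> exp (2 / (c * \<epsilon>))"
  defines "T \<equiv> real (totient (p - 1)) - 1"
  shows "\<bar>real (gapcount as (sorted_list_of_set (primroots p))) - limit_prob (totient (p - 1) / p) as True * T\<bar>
      \<le> (10 * length as + 18) * \<epsilon> * T" "T > 0"
proof -
  have p1: "p > 1" using p prime_gt_1_nat by blast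
  obtain g where "residue_primroot p g" using prime_primitive_root_exists[OF p1 p] by blast
  then interpret prime_root p g using p by unfold_locales
  define y where "y = exp (ln p / 400)"
  have y400: "y ^ 400 = p" using p1 by (simp add: y_def flip: exp_of_nat_mult)
  define M where "M = (C + 1) + (real r + 1) * (4 * (C + 1)) ^ r"
  have M0: "M \<ge> 0" unfolding M_def using C by simp
  have Beq: "B = real r + 4 + (C + 1) + 1 / \<epsilon> + M / \<epsilon>" unfolding B M_def by simp
  have "0 \<le> 1 / \<epsilon>" "0 \<le> M / \<epsilon>" using \<epsilon> M0 by simp_all
  then have B0: "B \<ge> real r + 4" "B \<ge> C + 1" "B \<ge> 1 / \<epsilon>" "B \<ge> M / \<epsilon>"
    unfolding Beq using C of_nat_0_le_iff[of r, where ?'a = real] by linarith+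
  have "B = exp (ln B)" using B0 by simp
  also have "\<dots> \<le> y" unfolding y_def using large(1) by simp
  finally have yB: "y \<ge> B" .
  have y: "y \<ge> real r + 4" "y \<ge> C + 1" "y \<ge> 1 / \<epsilon>" "y \<ge> M / \<epsilon>" "y \<ge> 4" "y \<ge> 1"
    using yB B0 by linarith+
  have lnp: "ln p > 0" using p1 by simp
  have c0: "c > 0" unfolding c by simp
  define Y where "Y = nat \<lfloor>c * ln p\<rfloor>"
  have Yle: "real Y \<le> c * ln p" unfolding Y_def using large(2) by linarith
  have Yge: "real Y \<ge> c * ln p - 1" unfolding Y_def using large(2) by linarith
  then have Y2: "Y \<ge> 2" using large(2) by linarith
  have Yhalf: "real Y \<ge> c / 2 * ln p" using Yge large(2) by simp
  have lnY: "ln Y \<ge> 2 / (c * \<epsilon>)"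
  proof -
    have "exp (2 / (c * \<epsilon>)) \<le> Y" using Yhalf large(3) by linarith
    then show ?thesis using Y2 by (simp add: ln_ge_iff)
  qed
  have n0: "p - 1 > 0" using p1 by simp
  obtain d where d: "squarefree d" "d dvd p - 1" "real d \<le> 4 ^ Y"
    "real (totient (p - 1)) / real (p - 1) \<ge> real (totient d) / d * (1 - ln (real (p - 1)) / (Y * ln Y))"
    using small_radical_exists[OF n0 Y2] by blast
  have d0: "d > 0" using d(1) by (cases d) auto
  have dr: "real d ^ (r + 1) \<le> y"
  proof -
    have "real d ^ (r + 1) \<le> (4 ^ Y) ^ (r + 1)" using d(3) by (intro power_mono) auto
    also have "\<dots> = exp (ln 4) ^ (Y * (r + 1))" by (simp only: power_mult exp_ln zero_less_numeral)
    also have "\<dots> = exp (real (Y * (r + 1)) * ln 4)" by (simp only: exp_of_nat_mult)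
    also have "\<dots> \<le> exp (ln p / 400)"
    proof -
      have "real Y * ((real r + 1) * ln 4) \<le> (c * ln p) * ((real r + 1) * ln 4)"
        using Yle by (intro mult_right_mono) auto
      also have "\<dots> = ln p / 400"
      proof -
        have "ln (4::real) \<noteq> 0" "real r + 1 \<noteq> 0" by auto
        then show ?thesis unfolding c by (simp add: divide_simps)
      qed
      finally have "real Y * ((real r + 1) * ln 4) \<le> ln p / 400" .
      moreover have "real (Y * (r + 1)) * ln 4 = real Y * ((real r + 1) * ln 4)" by (simp add: algebra_simps)
      ultimately show ?thesis by (simp only: exp_le_cancel_iff)
    qed
    finally show ?thesis unfolding y_def .
  qed
  have dy: "real d \<le> y"
  proof -
    have "real d ^ 1 \<le> real d ^ (r + 1)" using d0 by (intro power_increasing) auto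
    then show ?thesis using dr by simp
  qed
  define \<theta> where "\<theta> = real (totient d) / d"
  define l where "l = length as"
  have \<theta>: "0 \<le> \<theta>" "\<theta> \<le> 1" "\<theta> \<ge> 1 / y"
  proof -
    show "0 \<le> \<theta>" by (simp add: \<theta>_def)
    show "\<theta> \<le> 1" unfolding \<theta>_def using d0 totient_le[of d] by simp
    have "1 / y \<le> 1 / real d" using dy d0 by (intro divide_left_mono) auto
    also have "\<dots> \<le> \<theta>" unfolding \<theta>_def using d0 by (intro divide_right_mono) (auto simp: Suc_le_eq)
    finally show "\<theta> \<ge> 1 / y" .
  qed
  define Q where "Q = \<theta> * p"
  \<comment> \<open>\<open>\<theta> >= 1 / y\<close> loses a single power of \<open>y\<close>, so
    errors of order \<open>y ^ 361\<close> are negligible.\<close>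
  have Q: "Q \<ge> y ^ 399"
  proof -
    have "y ^ 399 = 1 / y * (y * y ^ 399)" using y by simp
    also have "y * y ^ 399 = y ^ 400" by (simp flip: power_Suc)
    also have "1 / y * y ^ 400 \<le> \<theta> * y ^ 400" using \<theta> y by (intro mult_right_mono) auto
    finally show ?thesis unfolding Q_def y400 .
  qed
  have small: "x * y ^ 361 \<le> \<epsilon> * Q" if "x / \<epsilon> \<le> y" for x
  proof -
    have "x \<le> \<epsilon> * y" using that \<epsilon> by (simp add: field_simps)
    then have "x * y ^ 361 \<le> \<epsilon> * y * y ^ 361" using y by (intro mult_right_mono) auto
    also have "\<dots> = \<epsilon> * y ^ 362" by (simp flip: power_Suc)
    also have "\<dots> \<le> \<epsilon> * y ^ 399" using y \<epsilon> by (intro mult_left_mono power_increasing) auto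
    also have "\<dots> \<le> \<epsilon> * Q" using Q \<epsilon> by (intro mult_left_mono) auto
    finally show ?thesis .
  qed
  have y360: "y ^ 360 \<le> \<epsilon> * Q" "1 \<le> \<epsilon> * Q"
  proof -
    have "y ^ 360 \<le> 1 * y ^ 361" using y by (simp add: power_increasing)
    then show "y ^ 360 \<le> \<epsilon> * Q" using small[of 1] y by linarith
    moreover have "1 \<le> y ^ 360" using y by simp
    ultimately show "1 \<le> \<epsilon> * Q" by linarith
  qed
  have Q0: "Q > 0" using y360(2) \<epsilon> by (smt (verit) mult_nonneg_nonpos)
  define \<Phi> where "\<Phi> = real (totient (p - 1))"
  define U where "U = real (card (smooth_roots d))"
  have U: "\<bar>U - Q\<bar> \<le> \<epsilon> * Q"
    using card_smooth_roots_estimate[OF y400 y(5) d(1,2) dy] y360(1) by (simp add: U_def Q_def \<theta>_def)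
  have cardU: "card (primroots p) = totient (p - 1)" by (rule card_primroots[OF p])
  have sub: "primroots p \<subseteq> smooth_roots d" by (rule primroots_subset_smooth_roots[OF d(2)])
  have diff: "real (card (smooth_roots d - primroots p)) = U - \<Phi>"
    using sub cardU card_mono[OF finite_smooth_roots sub]
    by (subst card_Diff_subset) (auto simp: U_def \<Phi>_def of_nat_diff finite_subset[OF sub])
  have \<sigma>: "ln (real (p - 1)) / (Y * ln Y) \<le> \<epsilon>"
  proof -
    have "ln (real (p - 1)) / (Y * ln Y) \<le> ln p / ((c / 2 * ln p) * (2 / (c * \<epsilon>)))"
      using Yhalf lnY c0 lnp \<epsilon> p1 n0 by (intro frac_le mult_mono) auto
    also have "\<dots> = \<epsilon>" using c0 lnp \<epsilon> by (simp add: field_simps)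
    finally show ?thesis .
  qed
  \<comment> \<open>One \<open>\<epsilon>\<close> is the sieve loss, the other pays for passing from
    \<open>p\<close> to \<open>p - 1\<close>.\<close>
  have \<Phi>1: "\<Phi> \<ge> (1 - 2 * \<epsilon>) * Q"
  proof -
    have "\<theta> * (1 - \<epsilon>) \<le> \<theta> * (1 - ln (real (p - 1)) / (Y * ln Y))"
      using \<sigma> \<theta> by (intro mult_left_mono) auto
    also have "\<dots> \<le> \<Phi> / real (p - 1)" using d(4) by (simp add: \<theta>_def \<Phi>_def)
    finally have "\<theta> * (1 - \<epsilon>) * real (p - 1) \<le> \<Phi>" using n0 by (simp add: field_simps)
    moreover have "\<theta> * (1 - \<epsilon>) * real (p - 1) = Q - \<epsilon> * Q - \<theta> * (1 - \<epsilon>)"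
      using p1 by (simp add: Q_def of_nat_diff algebra_simps)
    moreover have "\<theta> * (1 - \<epsilon>) \<le> 1 * 1" using \<theta> \<epsilon> by (intro mult_mono) auto
    ultimately show ?thesis using y360(2) by (simp add: algebra_simps)
  qed
  have \<Phi>2: "\<Phi> \<le> U" unfolding \<Phi>_def U_def cardU[symmetric] using card_mono[OF finite_smooth_roots sub] by simp
  have U\<Phi>: "U - \<Phi> \<le> 3 * \<epsilon> * Q" using U \<Phi>1 by (simp add: algebra_simps abs_le_iff)
  define G where "G V = real (gapcount as (sorted_list_of_set V))" for V
  define L where "L t = limit_prob t as True" for t
  have G1: "\<bar>G (smooth_roots d) - Q * L \<theta>\<bar> \<le> 3 * \<epsilon> * Q"
  proof -
    have "\<bar>G (smooth_roots d) - Q * L \<theta>\<bar> \<le> Q * (2 ^ l * exp (- C / 2) + 2 * (4 * (C + 1)) ^ r / fact r) + M * y ^ 361"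
      unfolding G_def L_def Q_def \<theta>_def l_def M_def
      by (rule gapcount_smooth_roots_estimate[OF y400 y(1,2) d(1,2) dr r(1) C])
    also have "\<dots> \<le> Q * (\<epsilon> + \<epsilon>) + \<epsilon> * Q"
      using r Q0 small[OF y(4)] by (intro add_mono mult_left_mono) (auto simp: l_def)
    finally show ?thesis by (simp add: algebra_simps)
  qed
  have G2: "\<bar>G (smooth_roots d) - G (primroots p)\<bar> \<le> (real l + 1) * (3 * \<epsilon> * Q)"
  proof -
    have "\<bar>int (gapcount as (sorted_list_of_set (smooth_roots d))) - int (gapcount as (sorted_list_of_set (primroots p)))\<bar>
      \<le> (int (length as) + 1) * int (card (smooth_roots d - primroots p))"
      by (rule gapcount_subset[OF finite_smooth_roots sub])
    then have "real_of_int \<bar>int (gapcount as (sorted_list_of_set (smooth_roots d))) - int (gapcount as (sorted_list_of_set (primroots p)))\<bar>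
      \<le> real_of_int ((int (length as) + 1) * int (card (smooth_roots d - primroots p)))"
      by (simp only: of_int_le_iff)
    then have "\<bar>G (smooth_roots d) - G (primroots p)\<bar> \<le> (real l + 1) * (U - \<Phi>)"
      by (simp add: G_def l_def diff)
    also have "\<dots> \<le> (real l + 1) * (3 * \<epsilon> * Q)" using U\<Phi> by (intro mult_left_mono) auto
    finally show ?thesis .
  qed
  define \<theta>p where "\<theta>p = \<Phi> / p"
  have \<Phi>Q: "\<bar>\<Phi> - Q\<bar> \<le> 2 * \<epsilon> * Q"
  proof -
    have "\<Phi> \<le> Q + \<epsilon> * Q" using U \<Phi>2 by (simp add: abs_le_iff)
    moreover have "0 \<le> \<epsilon> * Q" using \<epsilon> Q0 by simp
    ultimately show ?thesis using \<Phi>1 by (simp add: algebra_simps abs_le_iff)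
  qed
  have \<theta>p: "0 \<le> \<theta>p" "\<theta>p \<le> 1" "\<bar>\<theta> - \<theta>p\<bar> \<le> 2 * \<epsilon>"
  proof -
    show "0 \<le> \<theta>p" by (simp add: \<theta>p_def \<Phi>_def)
    show "\<theta>p \<le> 1" using totient_le[of "p - 1"] p1 by (simp add: \<theta>p_def \<Phi>_def divide_le_eq)
    have "\<theta> - \<theta>p = (Q - \<Phi>) / p" using p1 by (simp add: \<theta>p_def Q_def field_simps)
    then have "\<bar>\<theta> - \<theta>p\<bar> = \<bar>\<Phi> - Q\<bar> / p" by (simp add: abs_minus_commute)
    also have "\<dots> \<le> 2 * \<epsilon> * Q / p" using \<Phi>Q by (intro divide_right_mono) auto
    also have "\<dots> = 2 * \<epsilon> * \<theta>" using p1 by (simp add: Q_def)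
    also have "\<dots> \<le> 2 * \<epsilon> * 1" using \<theta> \<epsilon> by (intro mult_left_mono) auto
    finally show "\<bar>\<theta> - \<theta>p\<bar> \<le> 2 * \<epsilon>" by simp
  qed
  have L1: "\<bar>L \<theta> - L \<theta>p\<bar> \<le> l * (2 * \<epsilon>)"
  proof -
    have "\<bar>L \<theta> - L \<theta>p\<bar> \<le> l * \<bar>\<theta> - \<theta>p\<bar>"
      unfolding L_def l_def using \<theta> \<theta>p by (intro limit_prob_lipschitz) auto
    also have "\<dots> \<le> l * (2 * \<epsilon>)" using \<theta>p by (intro mult_left_mono) auto
    finally show ?thesis .
  qed
  have T: "\<bar>Q - T\<bar> \<le> 3 * \<epsilon> * Q"
    unfolding T_def \<Phi>_def[symmetric] using \<Phi>Q y360(2) by (simp add: abs_le_iff algebra_simps)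
  have QT: "Q \<le> 2 * T"
  proof -
    have "3 * \<epsilon> * Q \<le> 1 / 2 * Q" using \<epsilon> Q0 by (intro mult_right_mono) auto
    then show ?thesis using T by (simp add: abs_le_iff)
  qed
  then show "T > 0" using Q0 by simp
  have L2: "0 \<le> L \<theta>p" "L \<theta>p \<le> 1" using limit_prob_bounds[of \<theta>p] \<theta>p by (auto simp: L_def)
  have e1: "\<bar>Q * (L \<theta> - L \<theta>p)\<bar> \<le> Q * (l * (2 * \<epsilon>))"
    using L1 Q0 unfolding abs_mult by (intro mult_mono) auto
  have e2: "\<bar>L \<theta>p * (Q - T)\<bar> \<le> 1 * (3 * \<epsilon> * Q)"
    unfolding abs_mult using L2 T by (intro mult_mono) auto
  have "G (primroots p) - L \<theta>p * T = - (G (smooth_roots d) - G (primroots p)) + (G (smooth_roots d) - Q * L \<theta>)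
      + Q * (L \<theta> - L \<theta>p) + L \<theta>p * (Q - T)"
    by (simp add: algebra_simps)
  then have "\<bar>G (primroots p) - L \<theta>p * T\<bar> \<le> (real l + 1) * (3 * \<epsilon> * Q) + 3 * \<epsilon> * Q + Q * (l * (2 * \<epsilon>)) + 1 * (3 * \<epsilon> * Q)"
    using G1 G2 e1 e2 by linarith
  also have "\<dots> = ((5 * l + 9) * \<epsilon>) * Q" by (simp add: algebra_simps)
  also have "\<dots> \<le> ((5 * l + 9) * \<epsilon>) * (2 * T)" using QT \<epsilon> by (intro mult_left_mono) auto
  also have "\<dots> = (10 * l + 18) * \<epsilon> * T" by (simp add: algebra_simps)
  finally show "\<bar>real (gapcount as (sorted_list_of_set (primroots p))) - limit_prob (totient (p - 1) / p) as True * T\<bar>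
      \<le> (10 * length as + 18) * \<epsilon> * T"
    by (simp add: G_def L_def \<theta>p_def \<Phi>_def l_def)
qed

lemma eventually_gapcount_primroots:
  assumes "e > 0"
  shows "eventually (\<lambda>p. prime p \<longrightarrow>
    \<bar>real (gapcount as (sorted_list_of_set (primroots p))) - limit_prob (totient (p - 1) / p) as True * (real (totient (p - 1)) - 1)\<bar>
      \<le> e * (real (totient (p - 1)) - 1) \<and> real (totient (p - 1)) - 1 > 0) at_top"
proof -
  define \<epsilon> where "\<epsilon> = min (1 / 16) (e / (10 * length as + 18))"
  have \<epsilon>: "0 < \<epsilon>" using assms by (auto simp: \<epsilon>_def intro!: divide_pos_pos)
  have \<epsilon>16: "\<epsilon> \<le> 1 / 16" unfolding \<epsilon>_def by (rule min.cobounded1)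
  have "\<epsilon> \<le> e / (10 * length as + 18)" by (simp add: \<epsilon>_def)
  then have e: "(10 * length as + 18) * \<epsilon> \<le> e" by (simp add: field_simps)
  obtain C :: real and r :: nat where Cr: "C \<ge> 1" "r \<ge> 1" "2 ^ length as * exp (- C / 2) \<le> \<epsilon>" "2 * (4 * (C + 1)) ^ r / fact r \<le> \<epsilon>"
    using exists_truncation_parameters[OF \<epsilon>] by blast
  define c where "c = 1 / (400 * ln 4 * (real r + 1))"
  define B where "B = real r + 4 + (C + 1) + 1 / \<epsilon> + ((C + 1) + (real r + 1) * (4 * (C + 1)) ^ r) / \<epsilon>"
  have c0: "c > 0" by (simp add: c_def)
  define \<Lambda> where "\<Lambda> = max (400 * ln B) (max (4 / c) (2 / c * exp (2 / (c * \<epsilon>))))"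
  have "filterlim (\<lambda>p::nat. ln (real p)) at_top at_top"
    by (rule filterlim_compose[OF ln_at_top filterlim_real_sequentially])
  then have "eventually (\<lambda>p::nat. ln (real p) \<ge> \<Lambda>) at_top" by (auto simp: filterlim_at_top)
  then show ?thesis
  proof eventually_elim
    case (elim p)
    show ?case
    proof
      assume p: "prime p"
      let ?T = "real (totient (p - 1)) - 1"
      let ?D = "\<bar>real (gapcount as (sorted_list_of_set (primroots p))) - limit_prob (totient (p - 1) / p) as True * ?T\<bar>"
      have "ln p \<ge> 400 * ln B" using elim by (simp add: \<Lambda>_def)
      moreover have "c * ln p \<ge> 4" using elim c0 by (simp add: \<Lambda>_def field_simps)
      moreover have "c / 2 * ln p \<ge> exp (2 / (c * \<epsilon>))" using elim c0 by (simp add: \<Lambda>_def field_simps)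
      ultimately have est: "?D
         \<le> (10 * length as + 18) * \<epsilon> * ?T" "?T > 0"
        using gapcount_primroots_estimate[OF p \<epsilon> \<epsilon>16 Cr c_def B_def] by blast+
      have "(10 * length as + 18) * \<epsilon> * ?T \<le> e * ?T"
        using e est(2) by (intro mult_right_mono) auto
      with est show "?D
         \<le> e * ?T \<and> ?T > 0" by linarith
    qed
  qed
qed

theorem theorem2:
  fixes a :: "bit list" and l w :: nat
  assumes "l \<ge> 1"
    and "length a = l"
    and "card {i. i < l \<and> a ! i = 1} = w"
  shows "\<exists>\<epsilon> :: nat \<Rightarrow> real.
    (\<epsilon> \<longlongrightarrow> 0) primes_at_top \<and>
    (\<forall>p. prime p \<and> p \<ge> 11 \<longrightarrow>
      real (pattern_count p a) =
        ((1 / (2 - real (totient (p - 1)) / real p)) ^ w *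
         ((1 - real (totient (p - 1)) / real p) /
          (2 - real (totient (p - 1)) / real p)) ^ (l - w) + \<epsilon> p) *
        real (seq_period p))"
proof -
  define as where "as = map (\<lambda>b. b = 1) a"
  define L where "L p = limit_prob (totient (p - 1) / p) as True" for p
  \<comment> \<open>For the primes 2 and 3 the period is 0 and the quotient is 0 by convention; the
    limit does not see these values.\<close>
  define \<epsilon> where "\<epsilon> p = real (pattern_count p a) / real (seq_period p) - L p" for p
  have w: "length (filter (\<lambda>b. b) as) = w" "length as = l"
    using assms by (simp_all add: as_def filter_map o_def length_filter_conv_card)
  have L: "L p = (1 / (2 - real (totient (p - 1)) / real p)) ^ w *
         ((1 - real (totient (p - 1)) / real p) / (2 - real (totient (p - 1)) / real p)) ^ (l - w)" for p
    unfolding L_def limit_prob_closed_form w ..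
  have count: "pattern_count p a = gapcount as (sorted_list_of_set (primroots p))" if "prime p" for p
    unfolding as_def using assms by (intro pattern_count_eq_gapcount card_primroots that) auto
  have "(\<epsilon> \<longlongrightarrow> 0) primes_at_top"
  proof (rule tendstoI)
    fix e :: real assume "e > 0"
    then have "e / 2 > 0" by simp
    from eventually_gapcount_primroots[OF this, of as]
    have "eventually (\<lambda>p. prime p \<longrightarrow> dist (\<epsilon> p) 0 < e) at_top"
    proof eventually_elim
      case (elim p)
      show ?case
      proof
        assume p: "prime p"
        define T where "T = real (totient (p - 1)) - 1"
        have T: "T > 0" "\<bar>real (pattern_count p a) - L p * T\<bar> \<le> e / 2 * T"
          using elim p unfolding T_def L_def count[OF p] by auto
        then have "totient (p - 1) \<ge> 1" by (simp add: T_def)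
        then have sp: "real (seq_period p) = T" by (simp add: seq_period_def T_def of_nat_diff)
        have "\<epsilon> p * T = real (pattern_count p a) - L p * T"
          using T by (simp add: \<epsilon>_def sp field_simps)
        then have "\<bar>\<epsilon> p\<bar> * T \<le> e / 2 * T" using T by (metis abs_mult abs_of_pos)
        then have "\<bar>\<epsilon> p\<bar> \<le> e / 2" using T by simp
        then show "dist (\<epsilon> p) 0 < e" using \<open>e > 0\<close> by simp
      qed
    qed
    then show "eventually (\<lambda>p. dist (\<epsilon> p) 0 < e) primes_at_top"
      by (simp add: eventually_inf_principal)
  qed
  moreover have "real (pattern_count p a) = (L p + \<epsilon> p) * real (seq_period p)" if "prime p" "p \<ge> 11" for p
  proof -
    have "totient (p - 1) > 1" using that totient_gt_1[of "p - 1"] by simp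
    then have "seq_period p > 0" by (simp add: seq_period_def)
    then show ?thesis by (simp add: \<epsilon>_def)
  qed
  ultimately show ?thesis unfolding L by blast
qed

end
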